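(* Let $\nabla$ be a $\Gamma$-linear connection on $E=J^1(T,M)$, with curvature $\mathbf R(X,Y)Z=\nabla_X\nabla_YZ-\nabla_Y\nabla_XZ-\nabla_{[X,Y]}Z$. Then $\mathbf R$ is determined by eighteen families of local components, through the following eighteen local expressions (i.e. in each adapted basis there are unique functions, denoted as on the right-hand sides, for which these equalities hold, and together they determine $\mathbf R$): $$\mathbf R\Big(\frac{\delta}{\delta t^\gamma},\frac{\delta}{\delta t^\beta}\Big)\frac{\delta}{\delta t^\alpha}=\bar R^\delta_{\alpha\beta\gamma}\frac{\delta}{\delta t^\delta},\quad \mathbf R\Big(\frac{\delta}{\delta t^\gamma},\frac{\delta}{\delta t^\beta}\Big)\frac{\delta}{\delta x^i}=R^l_{i\beta\gamma}\frac{\delta}{\delta x^l},\quad \mathbf R\Big(\frac{\delta}{\delta t^\gamma},\frac{\delta}{\delta t^\beta}\Big)\frac{\partial}{\partial x^i_\alpha}=R^{(l)(\alpha)}_{(\delta)(i)\beta\gamma}\frac{\partial}{\partial x^l_\delta},$$ $$\mathbf R\Big(\frac{\delta}{\delta x^k},\frac{\delta}{\delta t^\beta}\Big)\frac{\delta}{\delta t^\alpha}=\bar R^\delta_{\alpha\beta k}\frac{\delta}{\delta t^\delta},\quad \mathbf R\Big(\frac{\delta}{\delta x^k},\frac{\delta}{\delta t^\beta}\Big)\frac{\delta}{\delta x^i}=R^l_{i\beta k}\frac{\delta}{\delta x^l},\quad \mathbf R\Big(\frac{\delta}{\delta x^k},\frac{\delta}{\delta t^\beta}\Big)\frac{\partial}{\partial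 x^i_\alpha}=R^{(l)(\alpha)}_{(\delta)(i)\beta k}\frac{\partial}{\partial x^l_\delta},$$ $$\mathbf R\Big(\frac{\delta}{\delta x^k},\frac{\delta}{\delta x^j}\Big)\frac{\delta}{\delta t^\alpha}=\bar R^\delta_{\alpha jk}\frac{\delta}{\delta t^\delta},\quad \mathbf R\Big(\frac{\delta}{\delta x^k},\frac{\delta}{\delta x^j}\Big)\frac{\delta}{\delta x^i}=R^l_{ijk}\frac{\delta}{\delta x^l},\quad \mathbf R\Big(\frac{\delta}{\delta x^k},\frac{\delta}{\delta x^j}\Big)\frac{\partial}{\partial x^i_\alpha}=R^{(l)(\alpha)}_{(\delta)(i)jk}\frac{\partial}{\partial x^l_\delta},$$ $$\mathbf R\Big(\frac{\partial}{\partial x^k_\gamma},\frac{\delta}{\delta t^\beta}\Big)\frac{\delta}{\delta t^\alpha}=\bar P^{\delta\;\;(\gamma)}_{\alpha\beta(k)}\frac{\delta}{\delta t^\delta},\quad \mathbf R\Big(\frac{\partial}{\partial x^k_\gamma},\frac{\delta}{\delta t^\beta}\Big)\frac{\delta}{\delta x^i}=P^{l\;\;(\gamma)}_{i\beta(k)}\frac{\delta}{\delta x^l},\quad \mathbf R\Big(\frac{\partial}{\partial x^k_\gamma},\frac{\delta}{\delta t^\beta}\Big)\frac{\partial}{\partial x^i_\alpha}=P^{(l)(\alpha)\;(\gamma)}_{(\delta)(i)\beta(k)}\frac{\partial}{\partial x^l_\delta},$$ $$\mathbf R\Big(\frac{\partial}{\partial x^k_\gamma},\frac{\delta}{\delta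 x^j}\Big)\frac{\delta}{\delta t^\alpha}=\bar P^{\delta\;\;(\gamma)}_{\alpha j(k)}\frac{\delta}{\delta t^\delta},\quad \mathbf R\Big(\frac{\partial}{\partial x^k_\gamma},\frac{\delta}{\delta x^j}\Big)\frac{\delta}{\delta x^i}=P^{l\;\;(\gamma)}_{ij(k)}\frac{\delta}{\delta x^l},\quad \mathbf R\Big(\frac{\partial}{\partial x^k_\gamma},\frac{\delta}{\delta x^j}\Big)\frac{\partial}{\partial x^i_\alpha}=P^{(l)(\alpha)\;(\gamma)}_{(\delta)(i)j(k)}\frac{\partial}{\partial x^l_\delta},$$ $$\mathbf R\Big(\frac{\partial}{\partial x^k_\gamma},\frac{\partial}{\partial x^j_\beta}\Big)\frac{\delta}{\delta t^\alpha}=\bar S^{\delta(\beta)(\gamma)}_{\alpha(j)(k)}\frac{\delta}{\delta t^\delta},\quad \mathbf R\Big(\frac{\partial}{\partial x^k_\gamma},\frac{\partial}{\partial x^j_\beta}\Big)\frac{\delta}{\delta x^i}=S^{l(\beta)(\gamma)}_{i(j)(k)}\frac{\delta}{\delta x^l},\quad \mathbf R\Big(\frac{\partial}{\partial x^k_\gamma},\frac{\partial}{\partial x^j_\beta}\Big)\frac{\partial}{\partial x^i_\alpha}=S^{(l)(\alpha)(\beta)(\gamma)}_{(\delta)(i)(j)(k)}\frac{\partial}{\partial x^l_\delta}.$$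
   Context: $T$ and $M$ are smooth manifolds of dimensions $p$ and $n$, with local coordinates $(t^\alpha)$ and $(x^i)$; Greek indices run from $1$ to $p$, Latin indices from $1$ to $n$, and repeated indices are summed. $E=J^1(T,M)\to T\times M$ is the first-order jet bundle, with coordinates $(t^\alpha,x^i,x^i_\alpha)$; coordinate changes have the form $\tilde t^\alpha=\tilde t^\alpha(t)$, $\tilde x^i=\tilde x^i(x)$, $\tilde x^j_\beta=\frac{\partial\tilde x^j}{\partial x^i}\frac{\partial t^\alpha}{\partial\tilde t^\beta}x^i_\alpha$. $\mathcal X(E)$ denotes the vector fields on $E$. A fixed nonlinear connection $\Gamma$ on $E$ is given by local functions $M^{(i)}_{(\alpha)\beta},N^{(i)}_{(\alpha)j}$ on $E$ with transformation rules $$\tilde M^{(j)}_{(\beta)\mu}\frac{\partial\tilde t^\mu}{\partial t^\alpha}=M^{(k)}_{(\gamma)\alpha}\frac{\partial\tilde x^j}{\partial x^k}\frac{\partial t^\gamma}{\partial\tilde t^\beta}-\frac{\partial\tilde x^j_\beta}{\partial t^\alpha},\qquad \tilde N^{(j)}_{(\beta)k}\frac{\partial\tilde x^k}{\partial x^i}=N^{(k)}_{(\gamma)i}\frac{\partial\tilde x^j}{\partial x^k}\frac{\partial t^\gamma}{\partial\tilde t^\beta}-\frac{\partial\tilde x^j_\beta}{\partial x^i}.$$ Its adapted basis of vector fields is $\frac{\delta}{\delta t^\alpha}=\frac{\partial}{\partial t^\alpha}-M^{(j)}_{(\beta)\alpha}\frac{\partial}{\partial x^j_\beta}$, $\frac{\delta}{\delta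 x^i}=\frac{\partial}{\partial x^i}-N^{(j)}_{(\beta)i}\frac{\partial}{\partial x^j_\beta}$, $\frac{\partial}{\partial x^i_\alpha}$. These span, respectively, three distributions whose direct sum is $TE$; $h_T,h_M,v$ denote the corresponding projections. A $\Gamma$-linear connection is a linear connection $\nabla:\mathcal X(E)\times\mathcal X(E)\to\mathcal X(E)$ with $\nabla h_T=0$, $\nabla h_M=0$, $\nabla v=0$ (i.e. $\nabla_X(h_TY)=h_T(\nabla_XY)$, and similarly for $h_M,v$). *)

theory Defs
  imports "HOL-Analysis.Analysis" "HOL-Library.Function_Algebras"
begin

section \<open>Smooth maps and smooth manifolds\<close>

primrec Ck_on ::
  "nat \<Rightarrow> 'a::real_normed_vector set \<Rightarrow> ('a \<Rightarrow> 'b::real_normed_vector) \<Rightarrow> bool" where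
  "Ck_on 0 S f \<longleftrightarrow> continuous_on S f"
| "Ck_on (Suc k) S f \<longleftrightarrow>
     (\<forall>x\<in>S. f differentiable (at x)) \<and> (\<forall>v. Ck_on k S (\<lambda>x. frechet_derivative f (at x) v))"

text \<open>Only used on open sets of Euclidean spaces.\<close>

definition smooth_on ::
  "'a::real_normed_vector set \<Rightarrow> ('a \<Rightarrow> 'b::real_normed_vector) \<Rightarrow> bool" where
  "smooth_on S f \<longleftrightarrow> (\<forall>k. Ck_on k S f)"

text \<open>A chart is a domain together with a coordinate map.\<close>

type_synonym ('a, 'v) chart = "'a set \<times> ('a \<Rightarrow> 'v)"

definition chart_inv :: "('a, 'v) chart \<Rightarrow> 'v \<Rightarrow> 'a" where
  "chart_inv c = inv_into (fst c) (snd c)"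

text \<open>
  The atlas need not be maximal; a manifold of dimension \<open>n\<close> is a Hausdorff, second countable
  type with an atlas of charts into \<open>real ^ 'n\<close>, where \<open>CARD('n) = n\<close>.
\<close>

definition smooth_atlas ::
  "('a::topological_space, 'v::euclidean_space) chart set \<Rightarrow> bool" where
  "smooth_atlas \<A> \<longleftrightarrow>
     (\<Union>c\<in>\<A>. fst c) = UNIV \<and>
     (\<forall>c\<in>\<A>. open (fst c) \<and> open (snd c ` fst c) \<and>
        homeomorphism (fst c) (snd c ` fst c) (snd c) (chart_inv c)) \<and>
     (\<forall>c\<in>\<A>. \<forall>c'\<in>\<A>. smooth_on (snd c ` (fst c \<inter> fst c')) (snd c' \<circ> chart_inv c))"


section \<open>Calculus relative to an atlas\<close>

text \<open>
  The jet space below is a subset of a type that carries no topology, so open sets, smooth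
  functions, tangent vectors and vector fields on it are defined through its charts.
\<close>

definition carrier_of :: "('e, 'v) chart set \<Rightarrow> 'e set" where
  "carrier_of \<A> = (\<Union>c\<in>\<A>. fst c)"

definition atlas_open :: "('e, 'v::euclidean_space) chart set \<Rightarrow> 'e set \<Rightarrow> bool" where
  "atlas_open \<A> W \<longleftrightarrow> W \<subseteq> carrier_of \<A> \<and> (\<forall>c\<in>\<A>. open (snd c ` (W \<inter> fst c)))"

definition smooth_fun ::
  "('e, 'v::euclidean_space) chart set \<Rightarrow> 'e set \<Rightarrow> ('e \<Rightarrow> 'b::real_normed_vector) \<Rightarrow> bool" where
  "smooth_fun \<A> W f \<longleftrightarrow> (\<forall>c\<in>\<A>. smooth_on (snd c ` (W \<inter> fst c)) (f \<circ> chart_inv c))"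

definition smooth_near ::
  "('e, 'v::euclidean_space) chart set \<Rightarrow> 'e \<Rightarrow> ('e \<Rightarrow> real) \<Rightarrow> bool" where
  "smooth_near \<A> p f \<longleftrightarrow> (\<exists>W. atlas_open \<A> W \<and> p \<in> W \<and> smooth_fun \<A> W f)"

text \<open>
  Tangent vectors at \<open>p\<close> are directional derivatives, acting on the functions that are smooth
  near \<open>p\<close>; on all other functions they are \<open>0\<close> by convention. Likewise a vector field on the
  carrier is \<open>0\<close> outside it. Sums, differences and \<open>0\<close> of such objects are pointwise.
\<close>

type_synonym 'e tangent = "('e \<Rightarrow> real) \<Rightarrow> real"
type_synonym 'e vfield = "'e \<Rightarrow> 'e tangent"

definition scale_tangent :: "real \<Rightarrow> 'e tangent \<Rightarrow> 'e tangent" (infixr "*\<^sub>T" 75) where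
  "a *\<^sub>T u = (\<lambda>f. a * u f)"

definition scale_field :: "('e \<Rightarrow> real) \<Rightarrow> 'e vfield \<Rightarrow> 'e vfield" (infixr "*\<^sub>F" 75) where
  "f *\<^sub>F X = (\<lambda>p. f p *\<^sub>T X p)"

definition partial ::
  "('e, 'v::euclidean_space) chart set \<Rightarrow> ('e, 'v) chart \<Rightarrow> 'v \<Rightarrow> 'e vfield" where
  "partial \<A> c v p = (\<lambda>f. if smooth_near \<A> p f
     then frechet_derivative (f \<circ> chart_inv c) (at (snd c p)) v else 0)"

definition vector_fields :: "('e, 'v::euclidean_space) chart set \<Rightarrow> 'e vfield set" where
  "vector_fields \<A> = {X.
     (\<forall>c\<in>\<A>. \<exists>a. smooth_fun \<A> (fst c) a \<and> (\<forall>p\<in>fst c. X p = partial \<A> c (a p) p)) \<and>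
     (\<forall>p. p \<notin> carrier_of \<A> \<longrightarrow> X p = 0)}"

definition lie_bracket ::
  "('e, 'v::euclidean_space) chart set \<Rightarrow> 'e vfield \<Rightarrow> 'e vfield \<Rightarrow> 'e vfield" where
  "lie_bracket \<A> X Y p = (\<lambda>f. if smooth_near \<A> p f
     then X p (\<lambda>q. Y q f) - Y p (\<lambda>q. X q f) else 0)"

definition linear_connection ::
  "('e, 'v::euclidean_space) chart set \<Rightarrow> ('e vfield \<Rightarrow> 'e vfield \<Rightarrow> 'e vfield) \<Rightarrow> bool" where
  "linear_connection \<A> D \<longleftrightarrow>
     (\<forall>X\<in>vector_fields \<A>. \<forall>Y\<in>vector_fields \<A>. D X Y \<in> vector_fields \<A>) \<and>
     (\<forall>X\<in>vector_fields \<A>. \<forall>X'\<in>vector_fields \<A>. \<forall>Y\<in>vector_fields \<A>.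
        D (X + X') Y = D X Y + D X' Y) \<and>
     (\<forall>X\<in>vector_fields \<A>. \<forall>Y\<in>vector_fields \<A>. \<forall>Y'\<in>vector_fields \<A>.
        D X (Y + Y') = D X Y + D X Y') \<and>
     (\<forall>f. smooth_fun \<A> (carrier_of \<A>) f \<longrightarrow>
        (\<forall>X\<in>vector_fields \<A>. \<forall>Y\<in>vector_fields \<A>.
           D (f *\<^sub>F X) Y = f *\<^sub>F D X Y \<and>
           D X (f *\<^sub>F Y) = (\<lambda>p. X p f) *\<^sub>F Y + f *\<^sub>F D X Y))"

definition curvature ::
  "('e, 'v::euclidean_space) chart set \<Rightarrow> ('e vfield \<Rightarrow> 'e vfield \<Rightarrow> 'e vfield)
     \<Rightarrow> 'e vfield \<Rightarrow> 'e vfield \<Rightarrow> 'e vfield \<Rightarrow> 'e vfield" where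
  "curvature \<A> D X Y Z = D X (D Y Z) - D Y (D X Z) - D (lie_bracket \<A> X Y) Z"

text \<open>Tensor fields of the type of a curvature: trilinear over the smooth functions, and skew in
  the first two arguments (so linearity in the second argument need not be listed).\<close>

definition curvature_type_tensor ::
  "('e, 'v::euclidean_space) chart set
     \<Rightarrow> ('e vfield \<Rightarrow> 'e vfield \<Rightarrow> 'e vfield \<Rightarrow> 'e vfield) \<Rightarrow> bool" where
  "curvature_type_tensor \<A> Q \<longleftrightarrow>
     (\<forall>X\<in>vector_fields \<A>. \<forall>Y\<in>vector_fields \<A>. \<forall>Z\<in>vector_fields \<A>.
        Q X Y Z \<in> vector_fields \<A> \<and>
        Q Y X Z = - Q X Y Z \<and>
        (\<forall>X'\<in>vector_fields \<A>. Q (X + X') Y Z = Q X Y Z + Q X' Y Z) \<and>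
        (\<forall>Z'\<in>vector_fields \<A>. Q X Y (Z + Z') = Q X Y Z + Q X Y Z') \<and>
        (\<forall>f. smooth_fun \<A> (carrier_of \<A>) f \<longrightarrow>
           Q (f *\<^sub>F X) Y Z = f *\<^sub>F Q X Y Z \<and> Q X Y (f *\<^sub>F Z) = f *\<^sub>F Q X Y Z))"

text \<open>
  Frame fields live on a chart domain only. A tensor field \<open>Q\<close> is evaluated on local fields \<open>A\<close>,
  \<open>B\<close>, \<open>C\<close> at \<open>p\<close> through global vector fields that coincide with them near \<open>p\<close>; tensoriality makes
  the result independent of the choice.
\<close>

definition agree_near ::
  "('e, 'v::euclidean_space) chart set \<Rightarrow> 'e \<Rightarrow> 'e vfield \<Rightarrow> 'e vfield \<Rightarrow> bool" where
  "agree_near \<A> p X A \<longleftrightarrow> (\<exists>W. atlas_open \<A> W \<and> p \<in> W \<and> (\<forall>q\<in>W. X q = A q))"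

definition local_value ::
  "('e, 'v::euclidean_space) chart set \<Rightarrow> ('e vfield \<Rightarrow> 'e vfield \<Rightarrow> 'e vfield \<Rightarrow> 'e vfield)
     \<Rightarrow> 'e vfield \<Rightarrow> 'e vfield \<Rightarrow> 'e vfield \<Rightarrow> 'e vfield" where
  "local_value \<A> Q A B C p = (THE w.
     \<forall>X\<in>vector_fields \<A>. \<forall>Y\<in>vector_fields \<A>. \<forall>Z\<in>vector_fields \<A>.
       agree_near \<A> p X A \<and> agree_near \<A> p Y B \<and> agree_near \<A> p Z C \<longrightarrow> Q X Y Z p = w)"


section \<open>The first-order jet space\<close>

definition smooth_map_near ::
  "('t::topological_space, 'v::euclidean_space) chart set
     \<Rightarrow> ('m::topological_space, 'w::euclidean_space) chart set \<Rightarrow> ('t \<Rightarrow> 'm) \<Rightarrow> 't \<Rightarrow> bool" where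
  "smooth_map_near AT AM f t \<longleftrightarrow>
     (\<exists>\<phi>\<in>AT. \<exists>\<psi>\<in>AM. \<exists>W. open W \<and> t \<in> W \<and> W \<subseteq> fst \<phi> \<and> f ` W \<subseteq> fst \<psi> \<and>
        smooth_on (snd \<phi> ` W) (snd \<psi> \<circ> f \<circ> chart_inv \<phi>))"

text \<open>The 1-jet of \<open>f\<close> at \<open>t\<close>: \<open>t\<close> together with the class of all maps that are smooth near \<open>t\<close> and
  have the same value and the same first derivatives as \<open>f\<close> at \<open>t\<close>.\<close>

type_synonym ('t, 'm) jet = "'t \<times> ('t \<Rightarrow> 'm) set"

definition jet_of ::
  "('t::topological_space, 'v::euclidean_space) chart set
     \<Rightarrow> ('m::topological_space, 'w::euclidean_space) chart set
     \<Rightarrow> ('t \<Rightarrow> 'm) \<Rightarrow> 't \<Rightarrow> ('t, 'm) jet" where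
  "jet_of AT AM f t = (t, {g. smooth_map_near AT AM g t \<and> g t = f t \<and>
     (\<forall>\<phi>\<in>AT. \<forall>\<psi>\<in>AM. t \<in> fst \<phi> \<and> f t \<in> fst \<psi> \<longrightarrow>
        frechet_derivative (snd \<psi> \<circ> g \<circ> chart_inv \<phi>) (at (snd \<phi> t)) =
        frechet_derivative (snd \<psi> \<circ> f \<circ> chart_inv \<phi>) (at (snd \<phi> t)))})"

definition jet_space ::
  "('t::topological_space, 'v::euclidean_space) chart set
     \<Rightarrow> ('m::topological_space, 'w::euclidean_space) chart set \<Rightarrow> ('t, 'm) jet set" where
  "jet_space AT AM = {jet_of AT AM f t | f t. smooth_map_near AT AM f t}"

definition jet_rep :: "('t, 'm) jet \<Rightarrow> 't \<Rightarrow> 'm" where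
  "jet_rep p = (SOME f. f \<in> snd p)"

definition jet_target :: "('t, 'm) jet \<Rightarrow> 'm" where
  "jet_target p = jet_rep p (fst p)"

text \<open>
  A pair of charts \<open>(\<phi>, \<psi>)\<close> of \<open>T\<close> and \<open>M\<close> induces the coordinates \<open>(t\<^sup>\<alpha>, x\<^sup>i, x\<^sup>i\<^sub>\<alpha>)\<close>; the last
  block is the Jacobian of a representative, with \<open>x\<^sup>i\<^sub>\<alpha>\<close> in row \<open>i\<close> and column \<open>\<alpha>\<close>.
\<close>

type_synonym ('t, 'm, 'p, 'n) chart_pair =
  "('t, (real, 'p) vec) chart \<times> ('m, (real, 'n) vec) chart"

type_synonym ('p, 'n) jet_coords =
  "(real, 'p) vec \<times> (real, 'n) vec \<times> ((real, 'p) vec, 'n) vec"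

definition jet_chart ::
  "('t::topological_space, real ^ 'p) chart set \<Rightarrow> ('m::topological_space, real ^ 'n) chart set
     \<Rightarrow> ('t, 'm, 'p::finite, 'n::finite) chart_pair
     \<Rightarrow> (('t, 'm) jet, ('p, 'n) jet_coords) chart" where
  "jet_chart AT AM c = (case c of (\<phi>, \<psi>) \<Rightarrow>
     ({p \<in> jet_space AT AM. fst p \<in> fst \<phi> \<and> jet_target p \<in> fst \<psi>},
      \<lambda>p. (snd \<phi> (fst p), snd \<psi> (jet_target p),
           \<chi> i \<alpha>. frechet_derivative (snd \<psi> \<circ> jet_rep p \<circ> chart_inv \<phi>)
                    (at (snd \<phi> (fst p))) (axis \<alpha> 1) $ i)))"

definition jet_dom ::
  "('t::topological_space, real ^ 'p) chart set \<Rightarrow> ('m::topological_space, real ^ 'n) chart set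
     \<Rightarrow> ('t, 'm, 'p::finite, 'n::finite) chart_pair \<Rightarrow> ('t, 'm) jet set" where
  "jet_dom AT AM c = fst (jet_chart AT AM c)"

definition jet_atlas ::
  "('t::topological_space, real ^ 'p) chart set \<Rightarrow> ('m::topological_space, real ^ 'n) chart set
     \<Rightarrow> (('t, 'm) jet, ('p::finite, 'n::finite) jet_coords) chart set" where
  "jet_atlas AT AM = jet_chart AT AM ` (AT \<times> AM)"

definition coord_t ::
  "('t::topological_space, real ^ 'p) chart set \<Rightarrow> ('m::topological_space, real ^ 'n) chart set
     \<Rightarrow> ('t, 'm, 'p::finite, 'n::finite) chart_pair \<Rightarrow> 'p \<Rightarrow> ('t, 'm) jet \<Rightarrow> real" where
  "coord_t AT AM c \<alpha> p = fst (snd (jet_chart AT AM c) p) $ \<alpha>"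

definition coord_x ::
  "('t::topological_space, real ^ 'p) chart set \<Rightarrow> ('m::topological_space, real ^ 'n) chart set
     \<Rightarrow> ('t, 'm, 'p::finite, 'n::finite) chart_pair \<Rightarrow> 'n \<Rightarrow> ('t, 'm) jet \<Rightarrow> real" where
  "coord_x AT AM c i p = fst (snd (snd (jet_chart AT AM c) p)) $ i"

definition coord_v ::
  "('t::topological_space, real ^ 'p) chart set \<Rightarrow> ('m::topological_space, real ^ 'n) chart set
     \<Rightarrow> ('t, 'm, 'p::finite, 'n::finite) chart_pair \<Rightarrow> 'n \<Rightarrow> 'p \<Rightarrow> ('t, 'm) jet \<Rightarrow> real" where
  "coord_v AT AM c i \<alpha> p = snd (snd (snd (jet_chart AT AM c) p)) $ i $ \<alpha>"

definition d_t ::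
  "('t::topological_space, real ^ 'p) chart set \<Rightarrow> ('m::topological_space, real ^ 'n) chart set
     \<Rightarrow> ('t, 'm, 'p::finite, 'n::finite) chart_pair \<Rightarrow> 'p \<Rightarrow> ('t, 'm) jet vfield" where
  "d_t AT AM c \<alpha> = partial (jet_atlas AT AM) (jet_chart AT AM c) (axis \<alpha> 1, 0, 0)"

definition d_x ::
  "('t::topological_space, real ^ 'p) chart set \<Rightarrow> ('m::topological_space, real ^ 'n) chart set
     \<Rightarrow> ('t, 'm, 'p::finite, 'n::finite) chart_pair \<Rightarrow> 'n \<Rightarrow> ('t, 'm) jet vfield" where
  "d_x AT AM c i = partial (jet_atlas AT AM) (jet_chart AT AM c) (0, axis i 1, 0)"

definition d_v ::
  "('t::topological_space, real ^ 'p) chart set \<Rightarrow> ('m::topological_space, real ^ 'n) chart set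
     \<Rightarrow> ('t, 'm, 'p::finite, 'n::finite) chart_pair \<Rightarrow> 'n \<Rightarrow> 'p \<Rightarrow> ('t, 'm) jet vfield" where
  "d_v AT AM c i \<alpha> = partial (jet_atlas AT AM) (jet_chart AT AM c) (0, 0, axis i (axis \<alpha> 1))"


section \<open>Nonlinear connections and adapted bases\<close>

text \<open>
  \<open>M c i \<alpha> \<beta>\<close> is the coefficient \<open>M\<close> with upper index \<open>(i)\<close> and lower indices \<open>(\<alpha>)\<beta>\<close>, and
  \<open>N c i \<alpha> j\<close> the coefficient \<open>N\<close> with upper index \<open>(i)\<close> and lower indices \<open>(\<alpha>)j\<close>, in the
  coordinates given by \<open>c\<close>. In the transformation rules \<open>c'\<close> gives the coordinates with a tilde.
\<close>

type_synonym ('t, 'm, 'p, 'n) coeffs_t =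
  "('t, 'm, 'p, 'n) chart_pair \<Rightarrow> 'n \<Rightarrow> 'p \<Rightarrow> 'p \<Rightarrow> ('t, 'm) jet \<Rightarrow> real"
type_synonym ('t, 'm, 'p, 'n) coeffs_x =
  "('t, 'm, 'p, 'n) chart_pair \<Rightarrow> 'n \<Rightarrow> 'p \<Rightarrow> 'n \<Rightarrow> ('t, 'm) jet \<Rightarrow> real"

definition nonlinear_connection ::
  "('t::topological_space, real ^ 'p) chart set \<Rightarrow> ('m::topological_space, real ^ 'n) chart set
     \<Rightarrow> ('t, 'm, 'p::finite, 'n::finite) coeffs_t \<Rightarrow> ('t, 'm, 'p, 'n) coeffs_x \<Rightarrow> bool" where
  "nonlinear_connection AT AM M N \<longleftrightarrow>
     (\<forall>c\<in>AT \<times> AM. \<forall>i \<alpha> \<beta> j.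
        smooth_fun (jet_atlas AT AM) (jet_dom AT AM c) (M c i \<alpha> \<beta>) \<and>
        smooth_fun (jet_atlas AT AM) (jet_dom AT AM c) (N c i \<alpha> j)) \<and>
     (\<forall>c\<in>AT \<times> AM. \<forall>c'\<in>AT \<times> AM. \<forall>p\<in>jet_dom AT AM c \<inter> jet_dom AT AM c'.
        (\<forall>j \<beta> \<alpha>.
           (\<Sum>\<mu>\<in>UNIV. M c' j \<beta> \<mu> p * d_t AT AM c \<alpha> p (coord_t AT AM c' \<mu>)) =
           (\<Sum>k\<in>UNIV. \<Sum>\<gamma>\<in>UNIV. M c k \<gamma> \<alpha> p * d_x AT AM c k p (coord_x AT AM c' j)
              * d_t AT AM c' \<beta> p (coord_t AT AM c \<gamma>))
           - d_t AT AM c \<alpha> p (coord_v AT AM c' j \<beta>)) \<and>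
        (\<forall>j \<beta> i.
           (\<Sum>k\<in>UNIV. N c' j \<beta> k p * d_x AT AM c i p (coord_x AT AM c' k)) =
           (\<Sum>k\<in>UNIV. \<Sum>\<gamma>\<in>UNIV. N c k \<gamma> i p * d_x AT AM c k p (coord_x AT AM c' j)
              * d_t AT AM c' \<beta> p (coord_t AT AM c \<gamma>))
           - d_x AT AM c i p (coord_v AT AM c' j \<beta>)))"

definition delta_t ::
  "('t::topological_space, real ^ 'p) chart set \<Rightarrow> ('m::topological_space, real ^ 'n) chart set
     \<Rightarrow> ('t, 'm, 'p::finite, 'n::finite) coeffs_t
     \<Rightarrow> ('t, 'm, 'p, 'n) chart_pair \<Rightarrow> 'p \<Rightarrow> ('t, 'm) jet vfield" where
  "delta_t AT AM M c \<alpha> =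
     d_t AT AM c \<alpha> - (\<Sum>j\<in>UNIV. \<Sum>\<beta>\<in>UNIV. M c j \<beta> \<alpha> *\<^sub>F d_v AT AM c j \<beta>)"

definition delta_x ::
  "('t::topological_space, real ^ 'p) chart set \<Rightarrow> ('m::topological_space, real ^ 'n) chart set
     \<Rightarrow> ('t, 'm, 'p::finite, 'n::finite) coeffs_x
     \<Rightarrow> ('t, 'm, 'p, 'n) chart_pair \<Rightarrow> 'n \<Rightarrow> ('t, 'm) jet vfield" where
  "delta_x AT AM N c i =
     d_x AT AM c i - (\<Sum>j\<in>UNIV. \<Sum>\<beta>\<in>UNIV. N c j \<beta> i *\<^sub>F d_v AT AM c j \<beta>)"

text \<open>The three distributions; by the transformation rules every chart pair around \<open>p\<close> contributes
  the same subspace.\<close>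

definition dist_t ::
  "('t::topological_space, real ^ 'p) chart set \<Rightarrow> ('m::topological_space, real ^ 'n) chart set
     \<Rightarrow> ('t, 'm, 'p::finite, 'n::finite) coeffs_t \<Rightarrow> ('t, 'm) jet \<Rightarrow> ('t, 'm) jet tangent set" where
  "dist_t AT AM M p = {u. \<exists>c\<in>AT \<times> AM. p \<in> jet_dom AT AM c \<and>
     (\<exists>a. u = (\<Sum>\<alpha>\<in>UNIV. a \<alpha> *\<^sub>T delta_t AT AM M c \<alpha> p))}"

definition dist_x ::
  "('t::topological_space, real ^ 'p) chart set \<Rightarrow> ('m::topological_space, real ^ 'n) chart set
     \<Rightarrow> ('t, 'm, 'p::finite, 'n::finite) coeffs_x \<Rightarrow> ('t, 'm) jet \<Rightarrow> ('t, 'm) jet tangent set" where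
  "dist_x AT AM N p = {u. \<exists>c\<in>AT \<times> AM. p \<in> jet_dom AT AM c \<and>
     (\<exists>a. u = (\<Sum>i\<in>UNIV. a i *\<^sub>T delta_x AT AM N c i p))}"

definition dist_v ::
  "('t::topological_space, real ^ 'p) chart set \<Rightarrow> ('m::topological_space, real ^ 'n) chart set
     \<Rightarrow> ('t, 'm) jet \<Rightarrow> ('t, 'm) jet tangent set" where
  "dist_v (AT :: ('t, real ^ 'p::finite) chart set) (AM :: ('m, real ^ 'n::finite) chart set) p =
     {u. \<exists>c\<in>AT \<times> AM. p \<in> jet_dom AT AM c \<and>
        (\<exists>a. u = (\<Sum>i\<in>UNIV. \<Sum>\<alpha>\<in>UNIV. a i \<alpha> *\<^sub>T d_v AT AM c i \<alpha> p))}"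

definition proj_t ::
  "('t::topological_space, real ^ 'p) chart set \<Rightarrow> ('m::topological_space, real ^ 'n) chart set
     \<Rightarrow> ('t, 'm, 'p::finite, 'n::finite) coeffs_t \<Rightarrow> ('t, 'm, 'p, 'n) coeffs_x
     \<Rightarrow> ('t, 'm) jet vfield \<Rightarrow> ('t, 'm) jet vfield" where
  "proj_t AT AM M N Y = (\<lambda>p. if p \<in> jet_space AT AM
     then THE u. u \<in> dist_t AT AM M p \<and>
       (\<exists>u'\<in>dist_x AT AM N p. \<exists>u''\<in>dist_v AT AM p. Y p = u + u' + u'')
     else 0)"

definition proj_x ::
  "('t::topological_space, real ^ 'p) chart set \<Rightarrow> ('m::topological_space, real ^ 'n) chart set
     \<Rightarrow> ('t, 'm, 'p::finite, 'n::finite) coeffs_t \<Rightarrow> ('t, 'm, 'p, 'n) coeffs_x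
     \<Rightarrow> ('t, 'm) jet vfield \<Rightarrow> ('t, 'm) jet vfield" where
  "proj_x AT AM M N Y = (\<lambda>p. if p \<in> jet_space AT AM
     then THE u'. u' \<in> dist_x AT AM N p \<and>
       (\<exists>u\<in>dist_t AT AM M p. \<exists>u''\<in>dist_v AT AM p. Y p = u + u' + u'')
     else 0)"

definition proj_v ::
  "('t::topological_space, real ^ 'p) chart set \<Rightarrow> ('m::topological_space, real ^ 'n) chart set
     \<Rightarrow> ('t, 'm, 'p::finite, 'n::finite) coeffs_t \<Rightarrow> ('t, 'm, 'p, 'n) coeffs_x
     \<Rightarrow> ('t, 'm) jet vfield \<Rightarrow> ('t, 'm) jet vfield" where
  "proj_v AT AM M N Y = (\<lambda>p. if p \<in> jet_space AT AM
     then THE u''. u'' \<in> dist_v AT AM p \<and>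
       (\<exists>u\<in>dist_t AT AM M p. \<exists>u'\<in>dist_x AT AM N p. Y p = u + u' + u'')
     else 0)"

definition gamma_linear_connection ::
  "('t::topological_space, real ^ 'p) chart set \<Rightarrow> ('m::topological_space, real ^ 'n) chart set
     \<Rightarrow> ('t, 'm, 'p::finite, 'n::finite) coeffs_t \<Rightarrow> ('t, 'm, 'p, 'n) coeffs_x
     \<Rightarrow> (('t, 'm) jet vfield \<Rightarrow> ('t, 'm) jet vfield \<Rightarrow> ('t, 'm) jet vfield) \<Rightarrow> bool" where
  "gamma_linear_connection AT AM M N D \<longleftrightarrow>
     linear_connection (jet_atlas AT AM) D \<and>
     (\<forall>X\<in>vector_fields (jet_atlas AT AM). \<forall>Y\<in>vector_fields (jet_atlas AT AM).
        D X (proj_t AT AM M N Y) = proj_t AT AM M N (D X Y) \<and>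
        D X (proj_x AT AM M N Y) = proj_x AT AM M N (D X Y) \<and>
        D X (proj_v AT AM M N Y) = proj_v AT AM M N (D X Y))"


section \<open>Local components of the curvature\<close>

text \<open>
  The values of the eighteen families at one point. The suffix \<open>tt\<close>, \<open>tx\<close>, \<open>xx\<close>, \<open>tv\<close>, \<open>xv\<close>, \<open>vv\<close>
  tells the kinds of the last two (groups of) indices; the prefix tells whether the field acted on is
  of kind \<open>t\<close> (\<open>Rt\<close>, \<open>Pt\<close>, \<open>St\<close>: the barred components), \<open>x\<close> or \<open>v\<close>. Arguments are in the order:
  first the indices of the resulting basis vector, then those of the field acted on, then the last
  groups from left to right; for example \<open>P\<close> with upper indices \<open>(l)(\<alpha>)(\<gamma>)\<close> and lower indices
  \<open>(\<delta>)(i)j(k)\<close> is \<open>Pv_xv l \<delta> i \<alpha> j k \<gamma>\<close>.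
\<close>

record ('p, 'n) curvature_components =
  Rt_tt :: "'p \<Rightarrow> 'p \<Rightarrow> 'p \<Rightarrow> 'p \<Rightarrow> real"
  Rx_tt :: "'n \<Rightarrow> 'n \<Rightarrow> 'p \<Rightarrow> 'p \<Rightarrow> real"
  Rv_tt :: "'n \<Rightarrow> 'p \<Rightarrow> 'n \<Rightarrow> 'p \<Rightarrow> 'p \<Rightarrow> 'p \<Rightarrow> real"
  Rt_tx :: "'p \<Rightarrow> 'p \<Rightarrow> 'p \<Rightarrow> 'n \<Rightarrow> real"
  Rx_tx :: "'n \<Rightarrow> 'n \<Rightarrow> 'p \<Rightarrow> 'n \<Rightarrow> real"
  Rv_tx :: "'n \<Rightarrow> 'p \<Rightarrow> 'n \<Rightarrow> 'p \<Rightarrow> 'p \<Rightarrow> 'n \<Rightarrow> real"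
  Rt_xx :: "'p \<Rightarrow> 'p \<Rightarrow> 'n \<Rightarrow> 'n \<Rightarrow> real"
  Rx_xx :: "'n \<Rightarrow> 'n \<Rightarrow> 'n \<Rightarrow> 'n \<Rightarrow> real"
  Rv_xx :: "'n \<Rightarrow> 'p \<Rightarrow> 'n \<Rightarrow> 'p \<Rightarrow> 'n \<Rightarrow> 'n \<Rightarrow> real"
  Pt_tv :: "'p \<Rightarrow> 'p \<Rightarrow> 'p \<Rightarrow> 'n \<Rightarrow> 'p \<Rightarrow> real"
  Px_tv :: "'n \<Rightarrow> 'n \<Rightarrow> 'p \<Rightarrow> 'n \<Rightarrow> 'p \<Rightarrow> real"
  Pv_tv :: "'n \<Rightarrow> 'p \<Rightarrow> 'n \<Rightarrow> 'p \<Rightarrow> 'p \<Rightarrow> 'n \<Rightarrow> 'p \<Rightarrow> real"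
  Pt_xv :: "'p \<Rightarrow> 'p \<Rightarrow> 'n \<Rightarrow> 'n \<Rightarrow> 'p \<Rightarrow> real"
  Px_xv :: "'n \<Rightarrow> 'n \<Rightarrow> 'n \<Rightarrow> 'n \<Rightarrow> 'p \<Rightarrow> real"
  Pv_xv :: "'n \<Rightarrow> 'p \<Rightarrow> 'n \<Rightarrow> 'p \<Rightarrow> 'n \<Rightarrow> 'n \<Rightarrow> 'p \<Rightarrow> real"
  St_vv :: "'p \<Rightarrow> 'p \<Rightarrow> 'n \<Rightarrow> 'p \<Rightarrow> 'n \<Rightarrow> 'p \<Rightarrow> real"
  Sx_vv :: "'n \<Rightarrow> 'n \<Rightarrow> 'n \<Rightarrow> 'p \<Rightarrow> 'n \<Rightarrow> 'p \<Rightarrow> real"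
  Sv_vv :: "'n \<Rightarrow> 'p \<Rightarrow> 'n \<Rightarrow> 'p \<Rightarrow> 'n \<Rightarrow> 'p \<Rightarrow> 'n \<Rightarrow> 'p \<Rightarrow> real"

definition smooth_components ::
  "('e, 'v::euclidean_space) chart set \<Rightarrow> 'e set
     \<Rightarrow> ('e \<Rightarrow> ('p, 'n) curvature_components) \<Rightarrow> bool" where
  "smooth_components \<A> W K \<longleftrightarrow>
     (\<forall>\<delta> \<alpha> \<beta> \<gamma>. smooth_fun \<A> W (\<lambda>p. Rt_tt (K p) \<delta> \<alpha> \<beta> \<gamma>)) \<and>
     (\<forall>l i \<beta> \<gamma>. smooth_fun \<A> W (\<lambda>p. Rx_tt (K p) l i \<beta> \<gamma>)) \<and>
     (\<forall>l \<delta> i \<alpha> \<beta> \<gamma>. smooth_fun \<A> W (\<lambda>p. Rv_tt (K p) l \<delta> i \<alpha> \<beta> \<gamma>)) \<and>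
     (\<forall>\<delta> \<alpha> \<beta> k. smooth_fun \<A> W (\<lambda>p. Rt_tx (K p) \<delta> \<alpha> \<beta> k)) \<and>
     (\<forall>l i \<beta> k. smooth_fun \<A> W (\<lambda>p. Rx_tx (K p) l i \<beta> k)) \<and>
     (\<forall>l \<delta> i \<alpha> \<beta> k. smooth_fun \<A> W (\<lambda>p. Rv_tx (K p) l \<delta> i \<alpha> \<beta> k)) \<and>
     (\<forall>\<delta> \<alpha> j k. smooth_fun \<A> W (\<lambda>p. Rt_xx (K p) \<delta> \<alpha> j k)) \<and>
     (\<forall>l i j k. smooth_fun \<A> W (\<lambda>p. Rx_xx (K p) l i j k)) \<and>
     (\<forall>l \<delta> i \<alpha> j k. smooth_fun \<A> W (\<lambda>p. Rv_xx (K p) l \<delta> i \<alpha> j k)) \<and>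
     (\<forall>\<delta> \<alpha> \<beta> k \<gamma>. smooth_fun \<A> W (\<lambda>p. Pt_tv (K p) \<delta> \<alpha> \<beta> k \<gamma>)) \<and>
     (\<forall>l i \<beta> k \<gamma>. smooth_fun \<A> W (\<lambda>p. Px_tv (K p) l i \<beta> k \<gamma>)) \<and>
     (\<forall>l \<delta> i \<alpha> \<beta> k \<gamma>. smooth_fun \<A> W (\<lambda>p. Pv_tv (K p) l \<delta> i \<alpha> \<beta> k \<gamma>)) \<and>
     (\<forall>\<delta> \<alpha> j k \<gamma>. smooth_fun \<A> W (\<lambda>p. Pt_xv (K p) \<delta> \<alpha> j k \<gamma>)) \<and>
     (\<forall>l i j k \<gamma>. smooth_fun \<A> W (\<lambda>p. Px_xv (K p) l i j k \<gamma>)) \<and>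
     (\<forall>l \<delta> i \<alpha> j k \<gamma>. smooth_fun \<A> W (\<lambda>p. Pv_xv (K p) l \<delta> i \<alpha> j k \<gamma>)) \<and>
     (\<forall>\<delta> \<alpha> j \<beta> k \<gamma>. smooth_fun \<A> W (\<lambda>p. St_vv (K p) \<delta> \<alpha> j \<beta> k \<gamma>)) \<and>
     (\<forall>l i j \<beta> k \<gamma>. smooth_fun \<A> W (\<lambda>p. Sx_vv (K p) l i j \<beta> k \<gamma>)) \<and>
     (\<forall>l \<delta> i \<alpha> j \<beta> k \<gamma>. smooth_fun \<A> W (\<lambda>p. Sv_vv (K p) l \<delta> i \<alpha> j \<beta> k \<gamma>))"

text \<open>The eighteen local expressions, for a tensor field \<open>Q\<close> in the adapted basis of \<open>c\<close>.\<close>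

definition local_expressions ::
  "('t::topological_space, real ^ 'p) chart set \<Rightarrow> ('m::topological_space, real ^ 'n) chart set
     \<Rightarrow> ('t, 'm, 'p::finite, 'n::finite) coeffs_t \<Rightarrow> ('t, 'm, 'p, 'n) coeffs_x
     \<Rightarrow> (('t, 'm) jet vfield \<Rightarrow> ('t, 'm) jet vfield \<Rightarrow> ('t, 'm) jet vfield \<Rightarrow> ('t, 'm) jet vfield)
     \<Rightarrow> ('t, 'm, 'p, 'n) chart_pair
     \<Rightarrow> (('t, 'm) jet \<Rightarrow> ('p, 'n) curvature_components) \<Rightarrow> bool" where
  "local_expressions AT AM M N Q c K \<longleftrightarrow>
     (let R = local_value (jet_atlas AT AM) Q;
          T = delta_t AT AM M c;
          X = delta_x AT AM N c;
          V = d_v AT AM c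
      in \<forall>p\<in>jet_dom AT AM c.
        (\<forall>\<alpha> \<beta> \<gamma>. R (T \<gamma>) (T \<beta>) (T \<alpha>) p = (\<Sum>\<delta>\<in>UNIV. Rt_tt (K p) \<delta> \<alpha> \<beta> \<gamma> *\<^sub>T T \<delta> p)) \<and>
        (\<forall>i \<beta> \<gamma>. R (T \<gamma>) (T \<beta>) (X i) p = (\<Sum>l\<in>UNIV. Rx_tt (K p) l i \<beta> \<gamma> *\<^sub>T X l p)) \<and>
        (\<forall>i \<alpha> \<beta> \<gamma>. R (T \<gamma>) (T \<beta>) (V i \<alpha>) p =
           (\<Sum>l\<in>UNIV. \<Sum>\<delta>\<in>UNIV. Rv_tt (K p) l \<delta> i \<alpha> \<beta> \<gamma> *\<^sub>T V l \<delta> p)) \<and>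
        (\<forall>\<alpha> \<beta> k. R (X k) (T \<beta>) (T \<alpha>) p = (\<Sum>\<delta>\<in>UNIV. Rt_tx (K p) \<delta> \<alpha> \<beta> k *\<^sub>T T \<delta> p)) \<and>
        (\<forall>i \<beta> k. R (X k) (T \<beta>) (X i) p = (\<Sum>l\<in>UNIV. Rx_tx (K p) l i \<beta> k *\<^sub>T X l p)) \<and>
        (\<forall>i \<alpha> \<beta> k. R (X k) (T \<beta>) (V i \<alpha>) p =
           (\<Sum>l\<in>UNIV. \<Sum>\<delta>\<in>UNIV. Rv_tx (K p) l \<delta> i \<alpha> \<beta> k *\<^sub>T V l \<delta> p)) \<and>
        (\<forall>\<alpha> j k. R (X k) (X j) (T \<alpha>) p = (\<Sum>\<delta>\<in>UNIV. Rt_xx (K p) \<delta> \<alpha> j k *\<^sub>T T \<delta> p)) \<and>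
        (\<forall>i j k. R (X k) (X j) (X i) p = (\<Sum>l\<in>UNIV. Rx_xx (K p) l i j k *\<^sub>T X l p)) \<and>
        (\<forall>i \<alpha> j k. R (X k) (X j) (V i \<alpha>) p =
           (\<Sum>l\<in>UNIV. \<Sum>\<delta>\<in>UNIV. Rv_xx (K p) l \<delta> i \<alpha> j k *\<^sub>T V l \<delta> p)) \<and>
        (\<forall>\<alpha> \<beta> k \<gamma>. R (V k \<gamma>) (T \<beta>) (T \<alpha>) p = (\<Sum>\<delta>\<in>UNIV. Pt_tv (K p) \<delta> \<alpha> \<beta> k \<gamma> *\<^sub>T T \<delta> p)) \<and>
        (\<forall>i \<beta> k \<gamma>. R (V k \<gamma>) (T \<beta>) (X i) p = (\<Sum>l\<in>UNIV. Px_tv (K p) l i \<beta> k \<gamma> *\<^sub>T X l p)) \<and>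
        (\<forall>i \<alpha> \<beta> k \<gamma>. R (V k \<gamma>) (T \<beta>) (V i \<alpha>) p =
           (\<Sum>l\<in>UNIV. \<Sum>\<delta>\<in>UNIV. Pv_tv (K p) l \<delta> i \<alpha> \<beta> k \<gamma> *\<^sub>T V l \<delta> p)) \<and>
        (\<forall>\<alpha> j k \<gamma>. R (V k \<gamma>) (X j) (T \<alpha>) p = (\<Sum>\<delta>\<in>UNIV. Pt_xv (K p) \<delta> \<alpha> j k \<gamma> *\<^sub>T T \<delta> p)) \<and>
        (\<forall>i j k \<gamma>. R (V k \<gamma>) (X j) (X i) p = (\<Sum>l\<in>UNIV. Px_xv (K p) l i j k \<gamma> *\<^sub>T X l p)) \<and>
        (\<forall>i \<alpha> j k \<gamma>. R (V k \<gamma>) (X j) (V i \<alpha>) p =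
           (\<Sum>l\<in>UNIV. \<Sum>\<delta>\<in>UNIV. Pv_xv (K p) l \<delta> i \<alpha> j k \<gamma> *\<^sub>T V l \<delta> p)) \<and>
        (\<forall>\<alpha> j \<beta> k \<gamma>. R (V k \<gamma>) (V j \<beta>) (T \<alpha>) p =
           (\<Sum>\<delta>\<in>UNIV. St_vv (K p) \<delta> \<alpha> j \<beta> k \<gamma> *\<^sub>T T \<delta> p)) \<and>
        (\<forall>i j \<beta> k \<gamma>. R (V k \<gamma>) (V j \<beta>) (X i) p =
           (\<Sum>l\<in>UNIV. Sx_vv (K p) l i j \<beta> k \<gamma> *\<^sub>T X l p)) \<and>
        (\<forall>i \<alpha> j \<beta> k \<gamma>. R (V k \<gamma>) (V j \<beta>) (V i \<alpha>) p =
           (\<Sum>l\<in>UNIV. \<Sum>\<delta>\<in>UNIV. Sv_vv (K p) l \<delta> i \<alpha> j \<beta> k \<gamma> *\<^sub>T V l \<delta> p)))"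

end

theory Submission
  imports Defs
begin

text \<open>
  On the jet space the curvature of a linear connection is tensorial, so its value at a point depends
  only on the values of its arguments there, and local frame fields may be replaced by global
  fields obtained with bump functions (this is where the Hausdorff property enters). A
  \<open>\<Gamma>\<close>-linear connection commutes with the three projections, hence so does every operator
  \<open>R(X, Y)\<close>, which therefore preserves each of the three distributions; this kills the mixed
  components. The remaining coefficients are read off by applying the tangent vector \<open>R(X, Y)Z\<close> to
  the coordinate functions \<open>t\<^sup>\<delta>\<close>, \<open>x\<^sup>l\<close> and \<open>x\<^sup>l\<^sub>\<delta>\<close>, which are dual to the adapted basis on the
  respective distribution; this gives uniqueness and smoothness. Six of the nine pairs of frame
  types occur in the first two arguments, and skew-symmetry supplies the others, so a tensor with
  the same components is the curvature.
\<close>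

section \<open>Calculus of smooth maps\<close>

text \<open>The local expressions concern fields on a chart domain, whereas connections and tensors
  accept only fields on the whole jet space. Tangency of a global substitute to a distribution near
  one point is not enough: the identity \<open>P Z = Z\<close> for a projection \<open>P\<close> has
  to hold as an equality of fields before \<open>D\<close> can be applied to it. A frame field
  multiplied by a bump function stays in its distribution at every point, and this is why extensions
  are tracked off their neighbourhoods. Tangent vectors are directional derivatives in a chart, not
  abstract derivations. The bracket of two fields is defined as a commutator, so it has to be
  exhibited as a directional derivative; this requires the symmetry of second derivatives.
  Smoothness is defined through repeated derivatives in fixed directions. Whenever a direction
  depends on the point, as in the chain rule or when a vector field is applied to a function, the
  derivative is first expanded in a basis.\<close>

abbreviation "fderiv f x \<equiv> frechet_derivative f (at x)"

lemma frechet_derivative_eqI: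
  "(f has_derivative f') (at x) \<Longrightarrow> fderiv f x v = f' v"
  by (metis frechet_derivative_at)

lemma has_derivative_frechet:
  "f differentiable (at x) \<Longrightarrow> (f has_derivative fderiv f x) (at x)"
  by (simp add: frechet_derivative_works)

lemma has_derivative_cong_open:
  assumes "open S" "x \<in> S" "\<And>y. y \<in> S \<Longrightarrow> f y = g y"
  shows "(f has_derivative D) (at x) \<longleftrightarrow> (g has_derivative D) (at x)"
  using has_derivative_transform_within_open[of f D x UNIV S g]
    has_derivative_transform_within_open[of g D x UNIV S f] assms by auto

lemma differentiable_cong_open:
  assumes "open S" "x \<in> S" "\<And>y. y \<in> S \<Longrightarrow> f y = g y"
  shows "f differentiable (at x) \<longleftrightarrow> g differentiable (at x)"
  using has_derivative_cong_open[of S x f g] assms by (auto simp: differentiable_def)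

lemma frechet_derivative_cong_open:
  assumes "open S" "x \<in> S" "\<And>y. y \<in> S \<Longrightarrow> f y = g y"
  shows "fderiv f x = fderiv g x"
  using has_derivative_cong_open[of S x f g] assms by (auto simp: frechet_derivative_def)

section \<open>Closure properties of maps of class C^k\<close>

lemma Ck_on_cong:
  assumes "open S" "\<And>x. x \<in> S \<Longrightarrow> f x = g x"
  shows "Ck_on k S f \<longleftrightarrow> Ck_on k S g"
  using assms(2)
proof (induction k arbitrary: f g)
  case 0
  then show ?case by (simp cong: continuous_on_cong)
next
  case (Suc k)
  have "Ck_on k S (\<lambda>x. fderiv f x v) \<longleftrightarrow>
      Ck_on k S (\<lambda>x. fderiv g x v)" for v
    using frechet_derivative_cong_open[of S _ f g] assms(1) Suc.prems by (intro Suc.IH) simp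
  moreover have "f differentiable (at x) \<longleftrightarrow> g differentiable (at x)" if "x \<in> S" for x
    using differentiable_cong_open[of S x f g] assms(1) Suc.prems that by blast
  ultimately show ?case by auto
qed

text \<open>\<open>frechet_derivative\<close> is a choice operator and awkward to compute with. The
  inductions for linear images, sums, products, compositions and reciprocals all end here, with an
  explicit derivative \<open>D\<close>.\<close>

lemma Ck_on_SucI:
  assumes "open S" "\<And>x. x \<in> S \<Longrightarrow> (f has_derivative D x) (at x)"
    "\<And>v. Ck_on k S (\<lambda>x. D x v)"
  shows "Ck_on (Suc k) S f"
proof -
  have "Ck_on k S (\<lambda>x. fderiv f x v)" for v
    using Ck_on_cong[OF assms(1), of "\<lambda>x. fderiv f x v" "\<lambda>x. D x v"]
      frechet_derivative_eqI[OF assms(2)] assms(3) by simp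
  moreover have "f differentiable (at x)" if "x \<in> S" for x
    using assms(2)[OF that] by (rule differentiableI)
  ultimately show ?thesis by simp
qed

text \<open>Order \<open>Suc k\<close> speaks only of derivatives, so lowering the order takes an
  induction, whose base is that differentiability gives continuity.\<close>

lemma Ck_on_SucD: "Ck_on (Suc k) S f \<Longrightarrow> Ck_on k S f"
proof (induction k arbitrary: f)
  case 0
  then show ?case
    by (auto intro!: continuous_at_imp_continuous_on differentiable_imp_continuous_within)
next
  case (Suc k)
  then have "Ck_on (Suc k) S (\<lambda>x. fderiv f x v)" for v by simp
  then show ?case using Suc.IH Suc.prems by simp
qed

lemma Ck_on_subset: "Ck_on k S f \<Longrightarrow> T \<subseteq> S \<Longrightarrow> Ck_on k T f"
  by (induction k arbitrary: f) (auto intro: continuous_on_subset)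

lemma Ck_on_local:
  assumes "\<And>x. x \<in> S \<Longrightarrow> \<exists>T. open T \<and> x \<in> T \<and> Ck_on k T f"
  shows "Ck_on k S f"
  using assms
proof (induction k arbitrary: f)
  case 0
  then have "isCont f x" if "x \<in> S" for x
    using that by (fastforce simp: continuous_on_eq_continuous_at)
  then show ?case by (simp add: continuous_at_imp_continuous_on)
next
  case (Suc k)
  have "f differentiable (at x)" if "x \<in> S" for x
    using Suc.prems[OF that] by auto
  moreover have "Ck_on k S (\<lambda>x. fderiv f x v)" for v
    using Suc.prems by (intro Suc.IH) fastforce
  ultimately show ?case by simp
qed

lemma Ck_on_const: "Ck_on k S (\<lambda>x. c)"
  by (induction k arbitrary: c) auto

lemma Ck_on_bounded_linear_compose:
  assumes "open S" "bounded_linear L" "Ck_on k S f"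
  shows "Ck_on k S (\<lambda>x. L (f x))"
  using assms(3)
proof (induction k arbitrary: f)
  case 0
  then show ?case using assms(2) by (simp add: bounded_linear.continuous_on)
next
  case (Suc k)
  have D: "((\<lambda>x. L (f x)) has_derivative (\<lambda>v. L (fderiv f x v))) (at x)"
    if "x \<in> S" for x
    using bounded_linear.has_derivative[OF assms(2) has_derivative_frechet, of f x] Suc.prems that by auto
  show ?case using Suc by (intro Ck_on_SucI[OF assms(1) D]) simp_all
qed

lemma Ck_on_add:
  assumes "open S" "Ck_on k S f" "Ck_on k S g"
  shows "Ck_on k S (\<lambda>x. f x + g x)"
  using assms(2,3)
proof (induction k arbitrary: f g)
  case 0
  then show ?case by (simp add: continuous_on_add)
next
  case (Suc k)
  have D: "((\<lambda>x. f x + g x) has_derivative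
      (\<lambda>v. fderiv f x v + fderiv g x v)) (at x)"
    if "x \<in> S" for x
    using has_derivative_add[OF has_derivative_frechet has_derivative_frechet, of f x g] Suc.prems that by auto
  show ?case using Suc by (intro Ck_on_SucI[OF assms(1) D]) simp_all
qed

lemma Ck_on_bounded_bilinear:
  assumes "open S" "bounded_bilinear B" "Ck_on k S f" "Ck_on k S g"
  shows "Ck_on k S (\<lambda>x. B (f x) (g x))"
  using assms(3,4)
proof (induction k arbitrary: f g)
  case 0
  then show ?case using assms(2) by (simp add: bounded_bilinear.continuous_on)
next
  case (Suc k)
  have D: "((\<lambda>x. B (f x) (g x)) has_derivative
      (\<lambda>v. B (f x) (fderiv g x v) + B (fderiv f x v) (g x))) (at x)"
    if "x \<in> S" for x
    using bounded_bilinear.FDERIV[OF assms(2) has_derivative_frechet has_derivative_frechet, of f x g]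
      Suc.prems that by auto
  \<comment> \<open>Each term of the product rule pairs a derivative with an undifferentiated
    factor: the induction hypothesis is applied to new factors, and the undifferentiated one is
    lowered by one order.\<close>
  have "Ck_on k S (\<lambda>x. B (f x) (fderiv g x v)
      + B (fderiv f x v) (g x))" for v
    using Suc.prems Ck_on_SucD[of k S f] Ck_on_SucD[of k S g]
    by (intro Ck_on_add[OF assms(1)] Suc.IH) auto
  then show ?case by (intro Ck_on_SucI[OF assms(1) D])
qed

lemma Ck_on_sum:
  assumes "open S" "\<And>i. i \<in> I \<Longrightarrow> Ck_on k S (f i)"
  shows "Ck_on k S (\<lambda>x. \<Sum>i\<in>I. f i x)"
  using assms(2)
proof (induction I rule: infinite_finite_induct)
  case (insert i I)
  then show ?case using Ck_on_add[OF assms(1), of k "f i"] by simp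
qed (simp_all add: Ck_on_const)

text \<open>\<open>Ck_on\<close> controls derivatives in fixed directions only. The expansion moves
  a direction that depends on the point into scalar coefficients; this is what the Euclidean type is
  for.\<close>

lemma frechet_derivative_euclidean_expansion:
  fixes f :: "'a::euclidean_space \<Rightarrow> 'b::real_normed_vector"
  assumes "f differentiable (at x)"
  shows "fderiv f x v = (\<Sum>b\<in>Basis. (v \<bullet> b) *\<^sub>R fderiv f x b)"
proof -
  interpret linear "fderiv f x" using assms by (rule linear_frechet_derivative)
  show ?thesis using sum[of "\<lambda>b. (v \<bullet> b) *\<^sub>R b" Basis] scale
    by (simp add: euclidean_representation)
qed

text \<open>The chain rule differentiates \<open>f\<close> in the direction
  \<open>fderiv g x v\<close>, which varies with \<open>x\<close>; hence the sum over
  \<open>Basis\<close>. The induction runs over all \<open>f\<close> with \<open>g\<close> fixed,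
  because the derivatives of \<open>f\<close> are composed with the same \<open>g\<close>.\<close>

lemma Ck_on_compose:
  fixes f :: "'b::euclidean_space \<Rightarrow> 'c::real_normed_vector" and g :: "'a::real_normed_vector \<Rightarrow> 'b"
  assumes "open S" "open T" "Ck_on k S g" "Ck_on k T f" "g ` S \<subseteq> T"
  shows "Ck_on k S (f \<circ> g)"
  using assms(3,4)
proof (induction k arbitrary: f)
  case 0
  then show ?case
    using assms(5) continuous_on_compose2[of T f S g] by (simp add: o_def)
next
  case (Suc k)
  have D: "((f \<circ> g) has_derivative
      (\<lambda>v. \<Sum>b\<in>Basis. (fderiv g x v \<bullet> b) *\<^sub>R fderiv f (g x) b)) (at x)"
    if "x \<in> S" for x
  proof -
    have fg: "f differentiable (at (g x))" "g differentiable (at x)"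
      using that Suc.prems assms(5) by auto
    show ?thesis
      using diff_chain_at[OF has_derivative_frechet[OF fg(2)] has_derivative_frechet[OF fg(1)]]
      by (rule has_derivative_eq_rhs)
        (simp add: fun_eq_iff frechet_derivative_euclidean_expansion[OF fg(1), symmetric])
  qed
  have "Ck_on k S ((\<lambda>y. fderiv f y b) \<circ> g)" for b
    using Suc.prems by (intro Suc.IH Ck_on_SucD[OF Suc.prems(1)]) simp
  then have "Ck_on k S (\<lambda>x. fderiv f (g x) b)" for b by (simp add: o_def)
  then have "Ck_on k S (\<lambda>x. \<Sum>b\<in>Basis. (fderiv g x v \<bullet> b) *\<^sub>R fderiv f (g x) b)" for v
    using Suc.prems(1)
    by (intro Ck_on_sum[OF assms(1)] Ck_on_bounded_bilinear[OF assms(1) bounded_bilinear_scaleR]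
         Ck_on_bounded_linear_compose[OF assms(1) bounded_linear_inner_left]) simp_all
  then show ?case by (intro Ck_on_SucI[OF assms(1) D])
qed

text \<open>The derivative of a reciprocal is built from the reciprocal itself and the derivative of
  \<open>f\<close>, so the induction on the order closes. The sign is written as a factor
  \<open>- 1\<close> to fit the law for products.\<close>

lemma Ck_on_inverse:
  fixes f :: "'a::real_normed_vector \<Rightarrow> real"
  assumes "open S" "Ck_on k S f" "\<And>x. x \<in> S \<Longrightarrow> f x \<noteq> 0"
  shows "Ck_on k S (\<lambda>x. inverse (f x))"
  using assms(2)
proof (induction k)
  case 0
  then show ?case using assms(3) by (simp add: continuous_on_inverse)
next
  case (Suc k)
  have D: "((\<lambda>x. inverse (f x)) has_derivative
      (\<lambda>v. - 1 * (inverse (f x) * (fderiv f x v * inverse (f x))))) (at x)"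
    if "x \<in> S" for x
    using Deriv.has_derivative_inverse[of f x "fderiv f x" UNIV] assms(3) has_derivative_frechet[of f x] Suc.prems that
    by (auto simp: mult.assoc)
  have "Ck_on k S (\<lambda>x. - 1 * (inverse (f x) * (fderiv f x v * inverse (f x))))" for v
    using Suc Ck_on_SucD[OF Suc.prems]
    by (intro Ck_on_bounded_bilinear[OF assms(1) bounded_bilinear_mult] Ck_on_const) auto
  then show ?case by (intro Ck_on_SucI[OF assms(1) D])
qed

lemma Ck_on_id: "Ck_on k S (\<lambda>x. x)"
proof (cases k)
  case (Suc k)
  then show ?thesis by (auto simp: Ck_on_const differentiable_ident)
qed auto

lemma smooth_on_cong:
  "open S \<Longrightarrow> (\<And>x. x \<in> S \<Longrightarrow> f x = g x) \<Longrightarrow> smooth_on S f \<longleftrightarrow> smooth_on S g"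
  unfolding smooth_on_def using Ck_on_cong by blast

section \<open>Closure properties of smooth maps\<close>

lemma smooth_on_subset: "smooth_on S f \<Longrightarrow> T \<subseteq> S \<Longrightarrow> smooth_on T f"
  unfolding smooth_on_def using Ck_on_subset by blast

lemma smooth_on_local:
  assumes "\<And>x. x \<in> S \<Longrightarrow> \<exists>T. open T \<and> x \<in> T \<and> smooth_on T f"
  shows "smooth_on S f"
  unfolding smooth_on_def
proof
  show "Ck_on k S f" for k
    using assms by (intro Ck_on_local) (auto simp: smooth_on_def)
qed

lemma smooth_on_const [simp]: "smooth_on S (\<lambda>x. c)"
  by (simp add: smooth_on_def Ck_on_const)

lemma smooth_on_id [simp]: "smooth_on S (\<lambda>x. x)"
  by (simp add: smooth_on_def Ck_on_id)

lemma smooth_on_linear: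
  "open S \<Longrightarrow> bounded_linear L \<Longrightarrow> smooth_on S f \<Longrightarrow> smooth_on S (\<lambda>x. L (f x))"
  by (simp add: smooth_on_def Ck_on_bounded_linear_compose)

lemma smooth_on_bilinear:
  "open S \<Longrightarrow> bounded_bilinear B \<Longrightarrow> smooth_on S f \<Longrightarrow> smooth_on S g \<Longrightarrow> smooth_on S (\<lambda>x. B (f x) (g x))"
  by (simp add: smooth_on_def Ck_on_bounded_bilinear)

lemmas smooth_on_mult = smooth_on_bilinear[OF _ bounded_bilinear_mult]
lemmas smooth_on_scaleR = smooth_on_bilinear[OF _ bounded_bilinear_scaleR]

lemma smooth_on_add:
  "open S \<Longrightarrow> smooth_on S f \<Longrightarrow> smooth_on S g \<Longrightarrow> smooth_on S (\<lambda>x. f x + g x)"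
  by (simp add: smooth_on_def Ck_on_add)

lemma smooth_on_sum:
  "open S \<Longrightarrow> (\<And>i. i \<in> I \<Longrightarrow> smooth_on S (f i)) \<Longrightarrow> smooth_on S (\<lambda>x. \<Sum>i\<in>I. f i x)"
  by (simp add: smooth_on_def Ck_on_sum)

lemma smooth_on_diff:
  assumes "open S" "smooth_on S f" "smooth_on S g"
  shows "smooth_on S (\<lambda>x. f x - g x)"
  using smooth_on_add[OF assms(1,2) smooth_on_linear[OF assms(1) bounded_linear_minus[OF bounded_linear_ident] assms(3)]]
  by simp

lemma smooth_on_inverse:
  fixes f :: "'a::real_normed_vector \<Rightarrow> real"
  shows "open S \<Longrightarrow> smooth_on S f \<Longrightarrow> (\<And>x. x \<in> S \<Longrightarrow> f x \<noteq> 0) \<Longrightarrow> smooth_on S (\<lambda>x. inverse (f x))"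
  by (simp add: smooth_on_def Ck_on_inverse)

lemma smooth_on_compose:
  fixes f :: "'b::euclidean_space \<Rightarrow> 'c::real_normed_vector" and g :: "'a::real_normed_vector \<Rightarrow> 'b"
  assumes "open S" "open T" "smooth_on S g" "smooth_on T f" "g ` S \<subseteq> T"
  shows "smooth_on S (f \<circ> g)"
  using assms by (simp add: smooth_on_def Ck_on_compose)

lemma smooth_on_Pair:
  assumes "open S" "smooth_on S f" "smooth_on S g"
  shows "smooth_on S (\<lambda>x. (f x, g x))"
proof -
  have "smooth_on S (\<lambda>x. (f x, 0) + (0, g x))"
    using assms by (intro smooth_on_add smooth_on_linear[where L = "\<lambda>a. (a, 0)"]
      smooth_on_linear[where L = "\<lambda>a. (0, a)"])
     (auto intro: bounded_linear_Pair bounded_linear_ident bounded_linear_zero)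
  then show ?thesis by simp
qed

lemma smooth_on_euclidean:
  fixes f :: "'a::real_normed_vector \<Rightarrow> 'b::euclidean_space"
  assumes "open S" "\<And>b. b \<in> Basis \<Longrightarrow> smooth_on S (\<lambda>x. f x \<bullet> b)"
  shows "smooth_on S f"
proof -
  have "smooth_on S (\<lambda>x. \<Sum>b\<in>Basis. (f x \<bullet> b) *\<^sub>R b)"
    using assms by (intro smooth_on_sum smooth_on_scaleR) auto
  then show ?thesis by (simp add: euclidean_representation)
qed

lemma smooth_on_imp_differentiable: "smooth_on S f \<Longrightarrow> x \<in> S \<Longrightarrow> f differentiable (at x)"
  unfolding smooth_on_def by (metis Ck_on.simps(2))

lemma smooth_on_imp_continuous_on: "smooth_on S f \<Longrightarrow> continuous_on S f"
  unfolding smooth_on_def by (metis Ck_on.simps(1))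

lemma smooth_on_frechet_derivative:
  "smooth_on S f \<Longrightarrow> smooth_on S (\<lambda>x. fderiv f x v)"
  unfolding smooth_on_def by (metis Ck_on.simps(2))

text \<open>The coordinate form of applying a vector field to a function: the direction is itself a
  smooth function of the point.\<close>

lemma smooth_on_frechet_derivative_field:
  fixes f :: "'a::euclidean_space \<Rightarrow> 'b::real_normed_vector"
  assumes "open S" "smooth_on S f" "smooth_on S v"
  shows "smooth_on S (\<lambda>x. fderiv f x (v x))"
proof -
  have "smooth_on S (\<lambda>x. \<Sum>b\<in>Basis. (v x \<bullet> b) *\<^sub>R fderiv f x b)"
    using assms by (intro smooth_on_sum smooth_on_scaleR smooth_on_frechet_derivative
      smooth_on_linear[OF _ bounded_linear_inner_left]) auto
  then show ?thesis
    by (subst smooth_on_cong[OF assms(1)])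
      (auto intro: frechet_derivative_euclidean_expansion smooth_on_imp_differentiable[OF assms(2)])
qed

subsection \<open>Symmetry of second derivatives\<close>

text \<open>Brings functions on a normed space within reach of the mean value theorem in one
  variable.\<close>

lemma has_real_derivative_along_line:
  fixes F :: "'a::real_normed_vector \<Rightarrow> real"
  assumes "F differentiable (at (x + a *\<^sub>R u))"
  shows "((\<lambda>a. F (x + a *\<^sub>R u)) has_real_derivative fderiv F (x + a *\<^sub>R u) u) (at a)"
proof -
  have 1: "((\<lambda>a. x + a *\<^sub>R u) has_derivative (\<lambda>h. h *\<^sub>R u)) (at a)"
    by (auto intro!: derivative_eq_intros)
  have "linear (fderiv F (x + a *\<^sub>R u))"
    using assms by (rule linear_frechet_derivative)
  then have "fderiv F (x + a *\<^sub>R u) (h *\<^sub>R u)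
      = fderiv F (x + a *\<^sub>R u) u * h" for h
    by (simp add: linear_scale)
  then show ?thesis
    unfolding has_field_derivative_def
    using diff_chain_at[OF 1 has_derivative_frechet[OF assms]] by (simp add: o_def)
qed

text \<open>The mean value theorem is used twice: in the direction \<open>u\<close> on the
  difference of two translates of \<open>F\<close> by \<open>s *\<^sub>R v\<close>, then in the
  direction \<open>v\<close> on the derivative of \<open>F\<close> along \<open>u\<close>.\<close>

lemma second_difference_mean_value:
  fixes F :: "'a::real_normed_vector \<Rightarrow> real"
  assumes F: "smooth_on S F" and s: "0 < s"
    and S: "\<And>a b. 0 \<le> a \<Longrightarrow> a \<le> s \<Longrightarrow> 0 \<le> b \<Longrightarrow> b \<le> s \<Longrightarrow> x + a *\<^sub>R u + b *\<^sub>R v \<in> S"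
  obtains a b where "0 < a" "a < s" "0 < b" "b < s"
    "F (x + s *\<^sub>R u + s *\<^sub>R v) - F (x + s *\<^sub>R u) - F (x + s *\<^sub>R v) + F x =
     s * s * fderiv (\<lambda>y. fderiv F y u) (x + a *\<^sub>R u + b *\<^sub>R v) v"
proof -
  define G where "G a = F (x + s *\<^sub>R v + a *\<^sub>R u) - F (x + a *\<^sub>R u)" for a
  define G' where "G' a = fderiv F (x + s *\<^sub>R v + a *\<^sub>R u) u
    - fderiv F (x + a *\<^sub>R u) u" for a
  have "(G has_real_derivative G' a) (at a)" if "0 \<le> a" "a \<le> s" for a
    unfolding G_def G'_def using S[of a s] S[of a 0] that s
    by (intro DERIV_diff has_real_derivative_along_line smooth_on_imp_differentiable[OF F])
      (auto simp: algebra_simps)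
  then obtain a where a: "0 < a" "a < s" "G s - G 0 = (s - 0) * G' a"
    using MVT2[OF s, of G G'] by blast
  let ?H = "\<lambda>y. fderiv F y u"
  have "((\<lambda>b. ?H (x + a *\<^sub>R u + b *\<^sub>R v)) has_real_derivative
    fderiv ?H (x + a *\<^sub>R u + b *\<^sub>R v) v) (at b)" if "0 \<le> b" "b \<le> s" for b
    using S[of a b] that a
    by (intro has_real_derivative_along_line
      smooth_on_imp_differentiable[OF smooth_on_frechet_derivative[OF F]]) auto
  then obtain b where b: "0 < b" "b < s"
    "?H (x + a *\<^sub>R u + s *\<^sub>R v) - ?H (x + a *\<^sub>R u + 0 *\<^sub>R v)
      = (s - 0) * fderiv ?H (x + a *\<^sub>R u + b *\<^sub>R v) v"
    using MVT2[OF s, of "\<lambda>b. ?H (x + a *\<^sub>R u + b *\<^sub>R v)"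
      "\<lambda>b. fderiv ?H (x + a *\<^sub>R u + b *\<^sub>R v) v"] by blast
  have "G' a = s * fderiv ?H (x + a *\<^sub>R u + b *\<^sub>R v) v"
    using b(3) unfolding G'_def by (simp add: add.commute add.left_commute)
  then have "G s - G 0 = s * s * fderiv ?H (x + a *\<^sub>R u + b *\<^sub>R v) v"
    using a(3) by simp
  moreover have "G s - G 0 = F (x + s *\<^sub>R u + s *\<^sub>R v) - F (x + s *\<^sub>R u) - F (x + s *\<^sub>R v) + F x"
    unfolding G_def by (simp add: add.commute add.left_commute)
  ultimately show ?thesis using that[of a b] a b by simp
qed

text \<open>The second difference over a small parallelogram is symmetric in the two directions, and
  it equals the squared side parameter times either mixed derivative at some point of the
  parallelogram. Continuity of both mixed derivatives at \<open>x\<close> then forces them to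
  coincide.\<close>

lemma second_derivative_symmetric:
  fixes F :: "'a::real_normed_vector \<Rightarrow> real"
  assumes S: "open S" "x \<in> S" and F: "smooth_on S F"
  shows "fderiv (\<lambda>y. fderiv F y u) x v =
    fderiv (\<lambda>y. fderiv F y v) x u"
proof -
  define P where "P y = fderiv (\<lambda>y. fderiv F y u) y v" for y
  define Q where "Q y = fderiv (\<lambda>y. fderiv F y v) y u" for y
  have "\<bar>P x - Q x\<bar> \<le> 0"
  proof (rule field_le_epsilon)
    fix e :: real assume e: "0 < e"
    have "isCont P x" "isCont Q x"
      unfolding P_def Q_def
      using S smooth_on_imp_continuous_on[OF smooth_on_frechet_derivative[OF smooth_on_frechet_derivative[OF F]]]
      by (auto simp: continuous_on_eq_continuous_at)
    moreover have "e / 2 > 0" using e by simp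
    ultimately obtain d1 d2 where d1: "d1 > 0" "\<And>y. dist y x < d1 \<Longrightarrow> dist (P y) (P x) < e / 2"
      and d2: "d2 > 0" "\<And>y. dist y x < d2 \<Longrightarrow> dist (Q y) (Q x) < e / 2"
      unfolding continuous_at_eps_delta by blast
    obtain d3 where d3: "d3 > 0" "ball x d3 \<subseteq> S" using S openE by blast
    define d where "d = min d1 (min d2 d3)"
    have d: "d > 0" using d1 d2 d3 by (simp add: d_def)
    \<comment> \<open>The whole parallelogram lies within
      \<open>s * (norm u + norm v) \<le> d / 2\<close> of \<open>x\<close>. The summand 1 keeps the
      denominator positive when both directions vanish.\<close>
    define s where "s = d / (2 * (1 + norm u + norm v))"
    have s: "0 < s" using d by (simp add: s_def add_pos_nonneg)
    have near: "dist (x + a *\<^sub>R u + b *\<^sub>R v) x < d" if "0 \<le> a" "a \<le> s" "0 \<le> b" "b \<le> s" for a b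
    proof -
      have "dist (x + a *\<^sub>R u + b *\<^sub>R v) x = norm (a *\<^sub>R u + b *\<^sub>R v)"
        by (simp add: dist_norm)
      also have "\<dots> \<le> a * norm u + b * norm v"
        using norm_triangle_ineq[of "a *\<^sub>R u" "b *\<^sub>R v"] that by simp
      also have "\<dots> \<le> s * norm u + s * norm v"
        using that by (intro add_mono mult_right_mono) auto
      also have "\<dots> \<le> s * (1 + norm u + norm v)" using s by (simp add: algebra_simps)
      also have "\<dots> = d / 2"
      proof -
        have "1 + norm u + norm v > 0" by (simp add: add_pos_nonneg)
        then show ?thesis unfolding s_def by (simp only: divide_divide_eq_left times_divide_eq_left mult.assoc[symmetric]) (simp add: field_simps)
      qed
      finally show ?thesis using d by simp
    qed
    have inS: "x + a *\<^sub>R u + b *\<^sub>R v \<in> S" if "0 \<le> a" "a \<le> s" "0 \<le> b" "b \<le> s" for a b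
      using near[OF that] d3 by (auto simp: d_def dist_commute)
    obtain a b where ab: "0 < a" "a < s" "0 < b" "b < s"
      "F (x + s *\<^sub>R u + s *\<^sub>R v) - F (x + s *\<^sub>R u) - F (x + s *\<^sub>R v) + F x = s * s * P (x + a *\<^sub>R u + b *\<^sub>R v)"
      using second_difference_mean_value[OF F s inS] unfolding P_def by blast
    have inS': "x + b *\<^sub>R v + a *\<^sub>R u \<in> S" if "0 \<le> b" "b \<le> s" "0 \<le> a" "a \<le> s" for a b
      using inS[of a b] that by (simp add: algebra_simps)
    \<comment> \<open>Exchanging the directions leaves the second difference unchanged, but the mean
      value now involves the other mixed derivative.\<close>
    obtain b' a' where ab': "0 < b'" "b' < s" "0 < a'" "a' < s"
      "F (x + s *\<^sub>R v + s *\<^sub>R u) - F (x + s *\<^sub>R v) - F (x + s *\<^sub>R u) + F x = s * s * Q (x + b' *\<^sub>R v + a' *\<^sub>R u)"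
      using second_difference_mean_value[OF F s inS'] unfolding Q_def by blast
    have "s * s * P (x + a *\<^sub>R u + b *\<^sub>R v) = s * s * Q (x + a' *\<^sub>R u + b' *\<^sub>R v)"
      using ab(5) ab'(5) by (simp add: algebra_simps)
    then have "P (x + a *\<^sub>R u + b *\<^sub>R v) = Q (x + a' *\<^sub>R u + b' *\<^sub>R v)" using s by simp
    moreover have "dist (P (x + a *\<^sub>R u + b *\<^sub>R v)) (P x) < e / 2"
      using near[of a b] ab by (intro d1) (auto simp: d_def)
    moreover have "dist (Q (x + a' *\<^sub>R u + b' *\<^sub>R v)) (Q x) < e / 2"
      using near[of a' b'] ab' by (intro d2) (auto simp: d_def)
    ultimately show "\<bar>P x - Q x\<bar> \<le> 0 + e"
      unfolding dist_real_def by linarith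
  qed
  then show ?thesis by (simp add: P_def Q_def)
qed

subsection \<open>Bump functions\<close>

text \<open>The span of these functions is closed under differentiation, which turns smoothness into an
  induction.\<close>

definition flat_exp :: "nat \<Rightarrow> real \<Rightarrow> real" where
  "flat_exp n t = (if t \<le> 0 then 0 else exp (- inverse t) * inverse t ^ n)"

text \<open>On the right, substituting the reciprocal of \<open>t\<close> turns the claim into the
  decay of a power against the exponential at infinity; on the left the function vanishes.\<close>

lemma flat_exp_tendsto_0: "(flat_exp n \<longlongrightarrow> 0) (at 0)"
proof -
  have "((\<lambda>s. s ^ n / exp s) \<longlongrightarrow> 0) (at_top :: real filter)"
    by (rule tendsto_power_div_exp_0)
  then have "((\<lambda>t. inverse t ^ n / exp (inverse t)) \<longlongrightarrow> 0) (at_right (0::real))"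
    by (simp add: filterlim_at_right_to_top)
  moreover have "\<forall>\<^sub>F t in at_right 0. inverse t ^ n / exp (inverse t) = flat_exp n t"
    by (rule eventually_mono[OF eventually_at_right_less])
      (auto simp: flat_exp_def exp_minus field_simps)
  ultimately have "(flat_exp n \<longlongrightarrow> 0) (at_right 0)" by (rule Lim_transform_eventually)
  moreover have "(flat_exp n \<longlongrightarrow> 0) (at_left 0)"
    by (rule Lim_transform_eventually[OF tendsto_const])
      (auto simp: flat_exp_def eventually_at_filter)
  ultimately show ?thesis by (simp add: filterlim_at_split)
qed

lemma flat_exp_has_real_derivative:
  "(flat_exp n has_real_derivative flat_exp (n + 2) t - n * flat_exp (n + 1) t) (at t)"
proof -
  consider "t < 0" | "t = 0" | "t > 0" by linarith
  then show ?thesis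
  proof cases
    case 1
    have "((\<lambda>x. 0) has_real_derivative 0) (at t)" by simp
    then have "(flat_exp n has_real_derivative 0) (at t)"
      by (rule has_field_derivative_transform_within_open[of _ _ _ "{..<0}"])
        (use 1 in \<open>auto simp: flat_exp_def\<close>)
    then show ?thesis using 1 by (simp add: flat_exp_def)
  next
    case 2
    \<comment> \<open>Dividing by \<open>h\<close> raises the exponent by one, so the difference
      quotient at 0 is again a function of the family, and it tends to 0.\<close>
    have "(flat_exp n (0 + h) - flat_exp n 0) / h = flat_exp (Suc n) h" for h
      by (auto simp: flat_exp_def field_simps)
    then show ?thesis using 2 flat_exp_tendsto_0[of "Suc n"]
      unfolding DERIV_def by (simp add: flat_exp_def[of _ "0::real"])
  next
    case 3
    have "((\<lambda>t. exp (- inverse t) * inverse t ^ n) has_real_derivative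
      flat_exp (n + 2) t - n * flat_exp (n + 1) t) (at t)"
      using 3 by (auto intro!: derivative_eq_intros simp: flat_exp_def)
        (cases n; simp add: field_simps power2_eq_square)
    then show ?thesis
      by (rule has_field_derivative_transform_within_open[of _ _ _ "{0<..}"])
        (use 3 in \<open>auto simp: flat_exp_def\<close>)
  qed
qed

lemma Ck_on_flat_exp: "Ck_on k UNIV (flat_exp n)"
proof (induction k arbitrary: n)
  case 0
  then show ?case
    using flat_exp_has_real_derivative DERIV_isCont by (metis Ck_on.simps(1) continuous_at_imp_continuous_on)
next
  case (Suc k)
  have D: "(flat_exp n has_derivative (\<lambda>v. flat_exp (n + 2) t * v + (- real n * v) * flat_exp (n + 1) t)) (at t)" for n t
    using flat_exp_has_real_derivative[of n t] unfolding has_field_derivative_def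
    by (rule has_derivative_eq_rhs) (simp add: fun_eq_iff algebra_simps)
  have "Ck_on k UNIV (\<lambda>t. flat_exp (n + 2) t * v + (- real n * v) * flat_exp (n + 1) t)" for v
    using Suc by (intro Ck_on_add Ck_on_bounded_bilinear[OF _ bounded_bilinear_mult] Ck_on_const) auto
  moreover have "(\<lambda>t. fderiv (flat_exp n) t v) =
      (\<lambda>t. flat_exp (n + 2) t * v + (- real n * v) * flat_exp (n + 1) t)" for v
    using frechet_derivative_eqI[OF D] by blast
  moreover have "flat_exp n differentiable (at t)" for t using D differentiableI by blast
  ultimately show ?case by simp
qed

lemma smooth_bump_exists:
  fixes x\<^sub>0 :: "'a::euclidean_space"
  assumes "r > 0"
  obtains \<rho> :: "'a \<Rightarrow> real" where "smooth_on UNIV \<rho>"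
    "\<And>x. dist x\<^sub>0 x \<le> r / 2 \<Longrightarrow> \<rho> x = 1" "\<And>x. dist x\<^sub>0 x \<ge> r \<Longrightarrow> \<rho> x = 0"
proof -
  \<comment> \<open>A smooth step: 0 for \<open>s \<le> 0\<close>, 1 for \<open>s \<ge> 1\<close>.
    The two summands of the denominator never vanish together.\<close>
  define \<psi> :: "real \<Rightarrow> real" where
    "\<psi> s = flat_exp 0 s * inverse (flat_exp 0 s + flat_exp 0 (1 - s))" for s
  have pos: "flat_exp 0 s + flat_exp 0 (1 - s) > 0" for s
    by (auto simp: flat_exp_def add_pos_nonneg add_nonneg_pos)
  have h: "smooth_on UNIV (flat_exp 0)" by (simp add: smooth_on_def Ck_on_flat_exp)
  have "smooth_on UNIV (flat_exp 0 \<circ> (\<lambda>s. 1 - s))"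
    by (rule smooth_on_compose[OF _ _ _ h]) (auto intro: smooth_on_diff)
  then have \<psi>: "smooth_on UNIV \<psi>"
    unfolding \<psi>_def using h pos
    by (intro smooth_on_mult smooth_on_inverse smooth_on_add) (auto simp: o_def less_imp_neq[symmetric])
  \<comment> \<open>A quadratic in the distance, hence smooth at the centre too. It equals 1 at
    distance \<open>r / 2\<close> and is larger inside, and it is at most -2 from distance
    \<open>r\<close> on, so the step \<open>\<psi>\<close> is saturated in both regions.\<close>
  define q where "q x = 2 - (2 / r)\<^sup>2 * ((x - x\<^sub>0) \<bullet> (x - x\<^sub>0))" for x :: 'a
  have q: "smooth_on UNIV q"
    unfolding q_def by (intro smooth_on_diff smooth_on_mult smooth_on_bilinear[OF _ bounded_bilinear_inner]) auto
  have q_eq: "q x = 2 - (2 * dist x\<^sub>0 x / r)\<^sup>2" for x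
    by (simp add: q_def dist_norm norm_minus_commute power_divide power_mult_distrib flip: power2_norm_eq_inner)
  show ?thesis
  proof
    show "smooth_on UNIV (\<psi> \<circ> q)" using smooth_on_compose[OF _ _ q \<psi>] by simp
    show "(\<psi> \<circ> q) x = 1" if "dist x\<^sub>0 x \<le> r / 2" for x
    proof -
      have "2 * dist x\<^sub>0 x / r \<le> 1" using that assms by (simp add: field_simps)
      then have "(2 * dist x\<^sub>0 x / r)\<^sup>2 \<le> 1" using assms by (intro power_le_one) auto
      then have "q x \<ge> 1" by (simp add: q_eq)
      then show ?thesis using pos[of "q x"] by (simp add: \<psi>_def flat_exp_def)
    qed
    show "(\<psi> \<circ> q) x = 0" if "dist x\<^sub>0 x \<ge> r" for x
    proof -
      have "2 \<le> 2 * dist x\<^sub>0 x / r" using that assms by (simp add: field_simps)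
      then have "2\<^sup>2 \<le> (2 * dist x\<^sub>0 x / r)\<^sup>2" by (intro power_mono) auto
      then have "q x \<le> 0" by (simp add: q_eq)
      then show ?thesis by (simp add: \<psi>_def flat_exp_def)
    qed
  qed
qed

section \<open>Tangent vectors and vector fields relative to an atlas\<close>

lemma sum_apply_fun: "(\<Sum>i\<in>I. F i) x = (\<Sum>i\<in>I. F i x)"
  by (induction I rule: infinite_finite_induct) auto

lemma scale_tangent_apply [simp]: "(a *\<^sub>T u) f = a * u f"
  by (simp add: scale_tangent_def)

lemma scale_field_apply [simp]: "(f *\<^sub>F X) p = f p *\<^sub>T X p"
  by (simp add: scale_field_def)

lemma scale_tangent_simps [simp]:
  "0 *\<^sub>T u = 0" "1 *\<^sub>T u = u" "a *\<^sub>T 0 = 0"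
  by (auto simp: fun_eq_iff)

lemma scale_tangent_distribs:
  "a *\<^sub>T (u + v) = a *\<^sub>T u + a *\<^sub>T v" "(a + b) *\<^sub>T u = a *\<^sub>T u + b *\<^sub>T u"
  "a *\<^sub>T (u - v) = a *\<^sub>T u - a *\<^sub>T v" "(a - b) *\<^sub>T u = a *\<^sub>T u - b *\<^sub>T u"
  "a *\<^sub>T b *\<^sub>T u = (a * b) *\<^sub>T u"
  "a *\<^sub>T (- u) = - (a *\<^sub>T u)" "(- a) *\<^sub>T u = - (a *\<^sub>T u)"
  by (auto simp: fun_eq_iff algebra_simps)

text \<open>The Hausdorff axiom is kept separate because the open sets constructed from charts are used
  to verify it for the jet space.\<close>

locale compatible_charts =
  fixes A :: "('e, 'v::euclidean_space) chart set"
  assumes inj_chart: "c \<in> A \<Longrightarrow> inj_on (snd c) (fst c)"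
    and open_overlap: "c \<in> A \<Longrightarrow> c' \<in> A \<Longrightarrow> open (snd c ` (fst c \<inter> fst c'))"
    and smooth_transition:
      "c \<in> A \<Longrightarrow> c' \<in> A \<Longrightarrow> smooth_on (snd c ` (fst c \<inter> fst c')) (snd c' \<circ> chart_inv c)"
begin

section \<open>Open sets relative to an atlas\<close>

lemma chart_inv_chart [simp]: "c \<in> A \<Longrightarrow> p \<in> fst c \<Longrightarrow> chart_inv c (snd c p) = p"
  by (simp add: chart_inv_def inj_chart)

lemma carrierI: "c \<in> A \<Longrightarrow> p \<in> fst c \<Longrightarrow> p \<in> carrier_of A"
  by (auto simp: carrier_of_def)

lemma carrierE: "p \<in> carrier_of A \<Longrightarrow> (\<And>c. c \<in> A \<Longrightarrow> p \<in> fst c \<Longrightarrow> thesis) \<Longrightarrow> thesis"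
  by (auto simp: carrier_of_def)

lemma atlas_open_subset: "atlas_open A W \<Longrightarrow> W \<subseteq> carrier_of A"
  by (simp add: atlas_open_def)

lemma atlas_openD: "atlas_open A W \<Longrightarrow> c \<in> A \<Longrightarrow> open (snd c ` (W \<inter> fst c))"
  by (simp add: atlas_open_def)

lemma atlas_open_chart_domain: "c \<in> A \<Longrightarrow> atlas_open A (fst c)"
  unfolding atlas_open_def using open_overlap by (auto simp: Int_commute carrier_of_def)

lemma atlas_open_Int:
  assumes "atlas_open A U" "atlas_open A V"
  shows "atlas_open A (U \<inter> V)"
proof -
  \<comment> \<open>Images commute with this intersection because charts are injective on their
    domains.\<close>
  have "snd c ` (U \<inter> V \<inter> fst c) = snd c ` (U \<inter> fst c) \<inter> snd c ` (V \<inter> fst c)" if "c \<in> A" for c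
    using inj_chart[OF that] by (auto simp: inj_on_def)
  then show ?thesis using assms by (auto simp: atlas_open_def)
qed

lemma atlas_open_Union:
  assumes "\<And>U. U \<in> \<U> \<Longrightarrow> atlas_open A U"
  shows "atlas_open A (\<Union>\<U>)"
proof -
  have "snd c ` (\<Union>\<U> \<inter> fst c) = (\<Union>U\<in>\<U>. snd c ` (U \<inter> fst c))" for c :: "('e, 'v) chart"
    by auto
  then show ?thesis using assms unfolding atlas_open_def
    by (auto simp only: intro!: open_UN) blast+
qed

lemma atlas_open_carrier: "atlas_open A (carrier_of A)"
  unfolding carrier_of_def by (rule atlas_open_Union) (auto intro: atlas_open_chart_domain)

lemma atlas_open_finite_Inter:
  assumes "finite I" "\<And>i. i \<in> I \<Longrightarrow> atlas_open A (U i)" "atlas_open A W"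
  shows "atlas_open A (W \<inter> (\<Inter>i\<in>I. U i))"
  using assms(1,2)
proof (induction I)
  case (insert i I)
  then have "atlas_open A (U i \<inter> (W \<inter> (\<Inter>i\<in>I. U i)))"
    by (intro atlas_open_Int[of "U i" "W \<inter> (\<Inter>i\<in>I. U i)"]) auto
  moreover have "U i \<inter> (W \<inter> (\<Inter>i\<in>I. U i)) = W \<inter> (\<Inter>i\<in>insert i I. U i)" by auto
  ultimately show ?case by simp
qed (simp add: assms(3))

lemma atlas_open_local:
  assumes "\<And>p. p \<in> W \<Longrightarrow> \<exists>U. atlas_open A U \<and> p \<in> U \<and> U \<subseteq> W"
  shows "atlas_open A W"
proof -
  have "W = \<Union>{U. atlas_open A U \<and> U \<subseteq> W}" using assms by blast
  then show ?thesis using atlas_open_Union[of "{U. atlas_open A U \<and> U \<subseteq> W}"] by auto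
qed

text \<open>Seen in another chart, the set is the preimage of \<open>S\<close> under a transition
  map, which is continuous on an open overlap.\<close>

lemma atlas_open_preimage:
  assumes c: "c \<in> A" and "open S"
  shows "atlas_open A {p \<in> fst c. snd c p \<in> S}"
  unfolding atlas_open_def
proof (intro conjI ballI)
  show "{p \<in> fst c. snd c p \<in> S} \<subseteq> carrier_of A" using c by (auto simp: carrier_of_def)
  fix c' assume c': "c' \<in> A"
  have "continuous_on (snd c' ` (fst c' \<inter> fst c)) (snd c \<circ> chart_inv c')"
    using smooth_transition[OF c' c] by (rule smooth_on_imp_continuous_on)
  then have "open (snd c' ` (fst c' \<inter> fst c) \<inter> (snd c \<circ> chart_inv c') -` S)"
    using open_overlap[OF c' c] assms(2) by (rule continuous_open_preimage)
  moreover have "snd c' ` ({p \<in> fst c. snd c p \<in> S} \<inter> fst c')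
      = snd c' ` (fst c' \<inter> fst c) \<inter> (snd c \<circ> chart_inv c') -` S"
    using c' by auto
  ultimately show "open (snd c' ` ({p \<in> fst c. snd c p \<in> S} \<inter> fst c'))" by simp
qed

end

locale smooth_charts = compatible_charts A for A :: "('e, 'v::euclidean_space) chart set" +
  assumes hausdorff: "p \<in> carrier_of A \<Longrightarrow> q \<in> carrier_of A \<Longrightarrow> p \<noteq> q \<Longrightarrow>
    \<exists>U V. atlas_open A U \<and> atlas_open A V \<and> p \<in> U \<and> q \<in> V \<and> U \<inter> V = {}"

context smooth_charts
begin

abbreviation "VF \<equiv> vector_fields A"
abbreviation "smooth_global \<equiv> smooth_fun A (carrier_of A)"

subsection \<open>Smooth functions\<close>

lemma smooth_funD:
  "smooth_fun A W f \<Longrightarrow> c \<in> A \<Longrightarrow> smooth_on (snd c ` (W \<inter> fst c)) (f \<circ> chart_inv c)"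
  by (simp add: smooth_fun_def)

lemma smooth_fun_subset: "smooth_fun A W f \<Longrightarrow> U \<subseteq> W \<Longrightarrow> smooth_fun A U f"
  unfolding smooth_fun_def by (blast intro: smooth_on_subset)

lemma smooth_fun_cong:
  assumes "atlas_open A W" "\<And>p. p \<in> W \<Longrightarrow> f p = g p"
  shows "smooth_fun A W f \<longleftrightarrow> smooth_fun A W g"
proof -
  have "smooth_on (snd c ` (W \<inter> fst c)) (f \<circ> chart_inv c) \<longleftrightarrow>
      smooth_on (snd c ` (W \<inter> fst c)) (g \<circ> chart_inv c)" if "c \<in> A" for c
    using that assms by (intro smooth_on_cong) (auto simp: atlas_openD)
  then show ?thesis by (simp add: smooth_fun_def)
qed

lemma smooth_fun_local:
  assumes "\<And>p. p \<in> W \<Longrightarrow> \<exists>U. atlas_open A U \<and> p \<in> U \<and> smooth_fun A U f"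
  shows "smooth_fun A W f"
  unfolding smooth_fun_def
proof
  fix c assume c: "c \<in> A"
  show "smooth_on (snd c ` (W \<inter> fst c)) (f \<circ> chart_inv c)"
  proof (rule smooth_on_local)
    fix x assume "x \<in> snd c ` (W \<inter> fst c)"
    then obtain p where p: "p \<in> W" "p \<in> fst c" "x = snd c p" by auto
    then obtain U where "atlas_open A U" "p \<in> U" "smooth_fun A U f" using assms by blast
    then show "\<exists>T. open T \<and> x \<in> T \<and> smooth_on T (f \<circ> chart_inv c)"
      using c p by (intro exI[of _ "snd c ` (U \<inter> fst c)"]) (auto simp: atlas_openD smooth_funD)
  qed
qed

text \<open>One chart suffices when it contains \<open>W\<close>: in every other chart
  \<open>f\<close> is \<open>g\<close> after a smooth transition map.\<close>

lemma smooth_fun_chartI: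
  assumes c: "c \<in> A" and W: "atlas_open A W" "W \<subseteq> fst c"
    and g: "smooth_on (snd c ` W) g" and f: "\<And>p. p \<in> W \<Longrightarrow> f p = g (snd c p)"
  shows "smooth_fun A W f"
  unfolding smooth_fun_def
proof
  fix c' assume c': "c' \<in> A"
  have "smooth_on (snd c' ` (W \<inter> fst c')) (g \<circ> (snd c \<circ> chart_inv c'))"
  proof (rule smooth_on_compose[OF _ _ _ g])
    show "open (snd c' ` (W \<inter> fst c'))" "open (snd c ` W)"
      using atlas_openD[OF W(1) c] atlas_openD[OF W(1) c'] W(2) by (simp_all add: Int_absorb2)
    show "smooth_on (snd c' ` (W \<inter> fst c')) (snd c \<circ> chart_inv c')"
      by (rule smooth_on_subset[OF smooth_transition[OF c' c]]) (use W in auto)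
    show "(snd c \<circ> chart_inv c') ` snd c' ` (W \<inter> fst c') \<subseteq> snd c ` W"
      using c' by auto
  qed
  then show "smooth_on (snd c' ` (W \<inter> fst c')) (f \<circ> chart_inv c')"
    using c' f by (subst smooth_on_cong[OF atlas_openD[OF W(1) c']]) auto
qed

lemma smooth_fun_const [simp]: "smooth_fun A W (\<lambda>p. k)"
  by (simp add: smooth_fun_def o_def)

lemma smooth_fun_bilinear:
  assumes "atlas_open A W" "bounded_bilinear B" "smooth_fun A W f" "smooth_fun A W g"
  shows "smooth_fun A W (\<lambda>p. B (f p) (g p))"
  unfolding smooth_fun_def
proof
  fix c assume c: "c \<in> A"
  show "smooth_on (snd c ` (W \<inter> fst c)) ((\<lambda>p. B (f p) (g p)) \<circ> chart_inv c)"
    using smooth_on_bilinear[OF atlas_openD[OF assms(1) c] assms(2) smooth_funD[OF assms(3) c] smooth_funD[OF assms(4) c]] by (simp add: o_def)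
qed

lemmas smooth_fun_mult = smooth_fun_bilinear[OF _ bounded_bilinear_mult]
lemmas smooth_fun_scaleR = smooth_fun_bilinear[OF _ bounded_bilinear_scaleR]

lemma smooth_fun_add:
  assumes "atlas_open A W" "smooth_fun A W f" "smooth_fun A W g"
  shows "smooth_fun A W (\<lambda>p. f p + g p)"
  unfolding smooth_fun_def
proof
  fix c assume c: "c \<in> A"
  show "smooth_on (snd c ` (W \<inter> fst c)) ((\<lambda>p. f p + g p) \<circ> chart_inv c)"
    using smooth_on_add[OF atlas_openD[OF assms(1) c] smooth_funD[OF assms(2) c] smooth_funD[OF assms(3) c]] by (simp add: o_def)
qed

lemma smooth_fun_diff:
  assumes "atlas_open A W" "smooth_fun A W f" "smooth_fun A W g"
  shows "smooth_fun A W (\<lambda>p. f p - g p)"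
  unfolding smooth_fun_def
proof
  fix c assume c: "c \<in> A"
  show "smooth_on (snd c ` (W \<inter> fst c)) ((\<lambda>p. f p - g p) \<circ> chart_inv c)"
    using smooth_on_diff[OF atlas_openD[OF assms(1) c] smooth_funD[OF assms(2) c] smooth_funD[OF assms(3) c]] by (simp add: o_def)
qed

lemma smooth_fun_sum:
  assumes "atlas_open A W" "\<And>i. i \<in> I \<Longrightarrow> smooth_fun A W (f i)"
  shows "smooth_fun A W (\<lambda>p. \<Sum>i\<in>I. f i p)"
  unfolding smooth_fun_def
proof
  fix c assume c: "c \<in> A"
  show "smooth_on (snd c ` (W \<inter> fst c)) ((\<lambda>p. \<Sum>i\<in>I. f i p) \<circ> chart_inv c)"
    using smooth_on_sum[OF atlas_openD[OF assms(1) c] smooth_funD[OF assms(2) c]] by (simp add: o_def)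
qed

lemma smooth_fun_coordinate:
  assumes "c \<in> A" "bounded_linear L"
  shows "smooth_fun A (fst c) (\<lambda>p. L (snd c p))"
  using assms(1) open_overlap[of c c] smooth_on_linear[OF _ assms(2) smooth_on_id]
  by (intro smooth_fun_chartI[of c "fst c" L] atlas_open_chart_domain) auto

lemma smooth_nearI: "atlas_open A W \<Longrightarrow> p \<in> W \<Longrightarrow> smooth_fun A W f \<Longrightarrow> smooth_near A p f"
  by (auto simp: smooth_near_def)

lemma smooth_near_carrier: "smooth_near A p f \<Longrightarrow> p \<in> carrier_of A"
  using atlas_open_subset by (auto simp: smooth_near_def)

lemma smooth_near_coordinate:
  "c \<in> A \<Longrightarrow> p \<in> fst c \<Longrightarrow> bounded_linear L \<Longrightarrow> smooth_near A p (\<lambda>p. L (snd c p))"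
  using smooth_nearI smooth_fun_coordinate atlas_open_chart_domain by blast

lemma smooth_near_common:
  assumes "smooth_near A p f" "smooth_near A p g"
  obtains W where "atlas_open A W" "p \<in> W" "smooth_fun A W f" "smooth_fun A W g"
proof -
  obtain U V where "atlas_open A U" "p \<in> U" "smooth_fun A U f" "atlas_open A V" "p \<in> V" "smooth_fun A V g"
    using assms by (auto simp: smooth_near_def)
  then show ?thesis
    using that[of "U \<inter> V"] smooth_fun_subset[of U f "U \<inter> V"] smooth_fun_subset[of V g "U \<inter> V"]
      atlas_open_Int by auto
qed

lemma smooth_near_add:
  "smooth_near A p f \<Longrightarrow> smooth_near A p g \<Longrightarrow> smooth_near A p (\<lambda>q. f q + g q)"
  by (erule (1) smooth_near_common, rule smooth_nearI, assumption+, rule smooth_fun_add; assumption)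

lemma smooth_near_mult:
  "smooth_near A p f \<Longrightarrow> smooth_near A p g \<Longrightarrow> smooth_near A p (\<lambda>q. f q * g q)"
  by (erule (1) smooth_near_common, rule smooth_nearI, assumption+, rule smooth_fun_mult; assumption)

lemma smooth_near_differentiable:
  assumes "smooth_near A p f" "c \<in> A" "p \<in> fst c"
  shows "(f \<circ> chart_inv c) differentiable (at (snd c p))"
proof -
  obtain W where "atlas_open A W" "p \<in> W" "smooth_fun A W f"
    using assms(1) by (auto simp: smooth_near_def)
  then show ?thesis
    using assms by (intro smooth_on_imp_differentiable[OF smooth_funD]) auto
qed

subsection \<open>Tangent vectors\<close>

lemma partial_smooth:
  "smooth_near A p f \<Longrightarrow> partial A c v p f = fderiv (f \<circ> chart_inv c) (snd c p) v"
  by (simp add: partial_def)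

lemma partial_not_smooth: "\<not> smooth_near A p f \<Longrightarrow> partial A c v p f = 0"
  by (simp add: partial_def)

lemma linear_partial_direction:
  assumes "c \<in> A" "p \<in> fst c"
  shows "linear (\<lambda>v. partial A c v p f)"
proof (cases "smooth_near A p f")
  case True
  then show ?thesis
    using linear_frechet_derivative[OF smooth_near_differentiable[OF True assms]]
    by (simp add: partial_smooth)
next
  case False
  then show ?thesis by (simp add: partial_not_smooth module_hom_zero)
qed

lemma partial_add: "c \<in> A \<Longrightarrow> p \<in> fst c \<Longrightarrow> partial A c (v + w) p = partial A c v p + partial A c w p"
  by (simp add: fun_eq_iff linear_add[OF linear_partial_direction])

lemma partial_diff: "c \<in> A \<Longrightarrow> p \<in> fst c \<Longrightarrow> partial A c (v - w) p = partial A c v p - partial A c w p"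
  by (simp add: fun_eq_iff linear_diff[OF linear_partial_direction])

lemma partial_scale: "c \<in> A \<Longrightarrow> p \<in> fst c \<Longrightarrow> partial A c (r *\<^sub>R v) p = r *\<^sub>T partial A c v p"
  by (simp add: fun_eq_iff linear_scale[OF linear_partial_direction])

lemma partial_zero: "c \<in> A \<Longrightarrow> p \<in> fst c \<Longrightarrow> partial A c 0 p = 0"
  by (simp add: fun_eq_iff linear_0[OF linear_partial_direction])

lemma partial_sum:
  "c \<in> A \<Longrightarrow> p \<in> fst c \<Longrightarrow> partial A c (\<Sum>i\<in>I. v i) p = (\<Sum>i\<in>I. partial A c (v i) p)"
  by (simp add: fun_eq_iff sum_apply_fun linear_sum[OF linear_partial_direction])

lemma partial_coordinate:
  assumes "c \<in> A" "p \<in> fst c" "bounded_linear L"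
  shows "partial A c v p (\<lambda>q. L (snd c q)) = L v"
proof -
  have "fderiv ((\<lambda>q. L (snd c q)) \<circ> chart_inv c) (snd c p) = fderiv L (snd c p)"
    using open_overlap[of c c] assms
    by (intro frechet_derivative_cong_open[of "snd c ` fst c"]) auto
  also have "\<dots> = L"
    using bounded_linear_imp_has_derivative[OF assms(3)] by (metis frechet_derivative_at)
  finally show ?thesis
    using partial_smooth[OF smooth_near_coordinate[OF assms]] by simp
qed

lemma partial_change_chart:
  assumes c: "c \<in> A" "p \<in> fst c" and c': "c' \<in> A" "p \<in> fst c'"
  shows "partial A c v p =
    partial A c' (fderiv (snd c' \<circ> chart_inv c) (snd c p) v) p"
proof
  fix f
  show "partial A c v p f =
    partial A c' (fderiv (snd c' \<circ> chart_inv c) (snd c p) v) p f"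
  proof (cases "smooth_near A p f")
    case True
    let ?S = "snd c ` (fst c \<inter> fst c')"
    have S: "open ?S" "snd c p \<in> ?S" using open_overlap c c' by auto
    have "(f \<circ> chart_inv c) y = ((f \<circ> chart_inv c') \<circ> (snd c' \<circ> chart_inv c)) y" if "y \<in> ?S" for y
      using that c c' by auto
    then have "fderiv (f \<circ> chart_inv c) (snd c p) =
        fderiv ((f \<circ> chart_inv c') \<circ> (snd c' \<circ> chart_inv c)) (snd c p)"
      by (rule frechet_derivative_cong_open[OF S])
    also have "\<dots> = fderiv (f \<circ> chart_inv c') ((snd c' \<circ> chart_inv c) (snd c p))
        \<circ> fderiv (snd c' \<circ> chart_inv c) (snd c p)"
      using smooth_near_differentiable[OF True c'] c c'
        smooth_on_imp_differentiable[OF smooth_transition[OF c(1) c'(1)] S(2)]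
      by (intro frechet_derivative_compose) auto
    finally show ?thesis using True c by (simp add: partial_smooth)
  qed (simp add: partial_not_smooth)
qed

text \<open>A vector counts as tangent only if some chart presents it as a directional derivative;
  satisfying the Leibniz rule is not the criterion. This is what makes expansions in coordinate
  bases immediate and tangency of the bracket a real task.\<close>

definition tangent_at :: "'e \<Rightarrow> 'e tangent \<Rightarrow> bool" where
  "tangent_at p u \<longleftrightarrow> (\<exists>c\<in>A. p \<in> fst c \<and> (\<exists>v. u = partial A c v p))"

lemma tangent_at_partial: "c \<in> A \<Longrightarrow> p \<in> fst c \<Longrightarrow> tangent_at p (partial A c v p)"
  by (auto simp: tangent_at_def)

lemma tangent_at_chartE:
  assumes "tangent_at p u" "c \<in> A" "p \<in> fst c"
  obtains v where "u = partial A c v p"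
proof -
  obtain c' v' where c': "c' \<in> A" "p \<in> fst c'" "u = partial A c' v' p"
    using assms(1) by (auto simp: tangent_at_def)
  show ?thesis by (rule that) (use partial_change_chart[OF c'(1,2) assms(2,3)] c'(3) in simp)
qed

text \<open>A directional derivative of a coordinate function returns the corresponding coordinate
  of the direction, so the direction can be recovered from the functional.\<close>

lemma tangent_at_chart_expansion:
  assumes "tangent_at p u" "c \<in> A" "p \<in> fst c"
  shows "u = partial A c (\<Sum>b\<in>Basis. u (\<lambda>q. snd c q \<bullet> b) *\<^sub>R b) p"
proof -
  obtain v where v: "u = partial A c v p" using assms by (rule tangent_at_chartE)
  have "u (\<lambda>q. snd c q \<bullet> b) = v \<bullet> b" for b
    unfolding v using partial_coordinate[OF assms(2,3) bounded_linear_inner_left] .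
  then show ?thesis using v by (simp add: euclidean_representation)
qed

lemma tangent_at_add:
  assumes "tangent_at p u" "tangent_at p w" shows "tangent_at p (u + w)"
proof -
  obtain c v where c: "c \<in> A" "p \<in> fst c" and u: "u = partial A c v p"
    using assms(1) by (auto simp: tangent_at_def)
  \<comment> \<open>The two vectors may be presented in different charts, so the second is first
    moved to the chart of the first.\<close>
  obtain v' where "w = partial A c v' p" using tangent_at_chartE[OF assms(2) c] .
  then show ?thesis using tangent_at_partial[OF c, of "v + v'"] u by (simp add: partial_add[OF c])
qed

lemma tangent_at_scale: "tangent_at p u \<Longrightarrow> tangent_at p (r *\<^sub>T u)"
  unfolding tangent_at_def by (metis partial_scale)

lemma tangent_at_diff: "tangent_at p u \<Longrightarrow> tangent_at p w \<Longrightarrow> tangent_at p (u - w)"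
  using tangent_at_add[OF _ tangent_at_scale[of p w "- 1"], of u] by (simp add: scale_tangent_distribs)

lemma tangent_at_zero: "p \<in> carrier_of A \<Longrightarrow> tangent_at p 0"
  unfolding carrier_of_def tangent_at_def using partial_zero by fastforce

lemma tangent_at_not_smooth: "tangent_at p u \<Longrightarrow> \<not> smooth_near A p f \<Longrightarrow> u f = 0"
  by (auto simp: tangent_at_def partial_not_smooth)

lemma tangent_at_fun_add:
  assumes u: "tangent_at p u" and fg: "smooth_near A p f" "smooth_near A p g"
  shows "u (\<lambda>q. f q + g q) = u f + u g"
proof -
  obtain c v where c: "c \<in> A" "p \<in> fst c" "u = partial A c v p"
    using u by (auto simp: tangent_at_def)
  show ?thesis
    unfolding c(3)
    using partial_smooth[OF smooth_near_add[OF fg]] partial_smooth[OF fg(1)] partial_smooth[OF fg(2)]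
      frechet_derivative_eqI[OF has_derivative_add[OF
        has_derivative_frechet[OF smooth_near_differentiable[OF fg(1) c(1,2)]]
        has_derivative_frechet[OF smooth_near_differentiable[OF fg(2) c(1,2)]]]]
    by (simp add: o_def)
qed

lemma tangent_at_fun_mult:
  assumes u: "tangent_at p u" and fg: "smooth_near A p f" "smooth_near A p g"
  shows "u (\<lambda>q. f q * g q) = f p * u g + u f * g p"
proof -
  obtain c v where c: "c \<in> A" "p \<in> fst c" "u = partial A c v p"
    using u by (auto simp: tangent_at_def)
  show ?thesis
    unfolding c(3)
    using partial_smooth[OF smooth_near_mult[OF fg]] partial_smooth[OF fg(1)] partial_smooth[OF fg(2)]
      frechet_derivative_eqI[OF has_derivative_mult[OF
        has_derivative_frechet[OF smooth_near_differentiable[OF fg(1) c(1,2)]]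
        has_derivative_frechet[OF smooth_near_differentiable[OF fg(2) c(1,2)]]]] c
    by (simp add: o_def)
qed

subsection \<open>Vector fields\<close>

lemma smooth_fun_partial_field:
  assumes c: "c \<in> A" and W: "atlas_open A W" "W \<subseteq> fst c"
    and a: "smooth_fun A W a" and f: "smooth_fun A W f"
  shows "smooth_fun A W (\<lambda>q. partial A c (a q) q f)"
proof (rule smooth_fun_chartI[OF c W])
  have [simp]: "W \<inter> fst c = W" using W by auto
  show "smooth_on (snd c ` W) (\<lambda>y. fderiv (f \<circ> chart_inv c) y ((a \<circ> chart_inv c) y))"
    using smooth_funD[OF a c] smooth_funD[OF f c] atlas_openD[OF W(1) c]
    by (intro smooth_on_frechet_derivative_field) (simp_all add: o_def)
  show "partial A c (a q) q f = fderiv (f \<circ> chart_inv c) (snd c q) ((a \<circ> chart_inv c) (snd c q))"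
    if "q \<in> W" for q
    using that c W f by (subst partial_smooth[OF smooth_nearI[OF W(1)]]) auto
qed

text \<open>Replaces the coefficient map, which the definition merely asserts to exist, by the
  canonical coefficients obtained from the coordinate functions. Closure laws for fields thereby
  reduce to closure laws for smooth functions.\<close>

lemma vector_fields_iff:
  "X \<in> VF \<longleftrightarrow>
    (\<forall>p. p \<notin> carrier_of A \<longrightarrow> X p = 0) \<and> (\<forall>p\<in>carrier_of A. tangent_at p (X p)) \<and>
    (\<forall>c\<in>A. \<forall>b\<in>Basis. smooth_fun A (fst c) (\<lambda>p. X p (\<lambda>q. snd c q \<bullet> b)))"
    (is "_ \<longleftrightarrow> ?R")
proof
  assume X: "X \<in> VF"
  show ?R
  proof (intro conjI ballI allI impI)
    show "X p = 0" if "p \<notin> carrier_of A" for p using X that by (simp add: vector_fields_def)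
    show "tangent_at p (X p)" if p: "p \<in> carrier_of A" for p
      using X p by (force simp: vector_fields_def carrier_of_def tangent_at_def)
    fix c and b :: 'v assume c: "c \<in> A" and b: "b \<in> Basis"
    then obtain a where a: "smooth_fun A (fst c) a" "\<And>p. p \<in> fst c \<Longrightarrow> X p = partial A c (a p) p"
      using X unfolding vector_fields_def by blast
    have "smooth_fun A (fst c) (\<lambda>p. partial A c (a p) p (\<lambda>q. snd c q \<bullet> b))"
      using c a by (intro smooth_fun_partial_field atlas_open_chart_domain smooth_fun_coordinate
        bounded_linear_inner_left) auto
    then show "smooth_fun A (fst c) (\<lambda>p. X p (\<lambda>q. snd c q \<bullet> b))"
      using smooth_fun_cong[OF atlas_open_chart_domain[OF c],
        of "\<lambda>p. X p (\<lambda>q. snd c q \<bullet> b)" "\<lambda>p. partial A c (a p) p (\<lambda>q. snd c q \<bullet> b)"] a(2)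
      by simp
  qed
next
  assume R: ?R
  show "X \<in> VF"
    unfolding vector_fields_def
  proof (intro CollectI conjI ballI)
    fix c assume c: "c \<in> A"
    show "\<exists>a. smooth_fun A (fst c) a \<and> (\<forall>p\<in>fst c. X p = partial A c (a p) p)"
    proof (intro exI conjI ballI)
      show "smooth_fun A (fst c) (\<lambda>p. \<Sum>b\<in>Basis. X p (\<lambda>q. snd c q \<bullet> b) *\<^sub>R b)"
        using R c by (intro smooth_fun_sum atlas_open_chart_domain smooth_fun_scaleR) auto
      show "X p = partial A c (\<Sum>b\<in>Basis. X p (\<lambda>q. snd c q \<bullet> b) *\<^sub>R b) p" if "p \<in> fst c" for p
        using R c that carrierI by (intro tangent_at_chart_expansion) auto
    qed
  qed (use R in blast)
qed

lemma vector_field_outside: "X \<in> VF \<Longrightarrow> p \<notin> carrier_of A \<Longrightarrow> X p = 0"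
  by (simp add: vector_fields_iff)

lemma vector_field_tangent: "X \<in> VF \<Longrightarrow> p \<in> carrier_of A \<Longrightarrow> tangent_at p (X p)"
  by (simp add: vector_fields_iff)

lemma vector_field_chartE:
  assumes "X \<in> VF" "c \<in> A"
  obtains a where "smooth_fun A (fst c) a" "\<And>p. p \<in> fst c \<Longrightarrow> X p = partial A c (a p) p"
proof -
  have "\<exists>a. smooth_fun A (fst c) a \<and> (\<forall>p\<in>fst c. X p = partial A c (a p) p)"
    using assms by (simp add: vector_fields_def)
  then show ?thesis using that by blast
qed

lemma vector_field_apply_smooth:
  assumes X: "X \<in> VF" and W: "atlas_open A W" and f: "smooth_fun A W f"
  shows "smooth_fun A W (\<lambda>p. X p f)"
proof (rule smooth_fun_local)
  fix p assume p: "p \<in> W"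
  then obtain c where c: "c \<in> A" "p \<in> fst c" using atlas_open_subset[OF W] carrierE by blast
  obtain a where a: "smooth_fun A (fst c) a" "\<And>p. p \<in> fst c \<Longrightarrow> X p = partial A c (a p) p"
    by (rule vector_field_chartE[OF X c(1)]) blast
  have o: "atlas_open A (W \<inter> fst c)" using W c atlas_open_Int atlas_open_chart_domain by blast
  have "smooth_fun A (W \<inter> fst c) (\<lambda>q. partial A c (a q) q f)"
    using o c smooth_fun_subset[OF a(1)] smooth_fun_subset[OF f] by (intro smooth_fun_partial_field) auto
  then have "smooth_fun A (W \<inter> fst c) (\<lambda>q. X q f)"
    using smooth_fun_cong[OF o, of "\<lambda>q. X q f" "\<lambda>q. partial A c (a q) q f"] a(2) by auto
  then show "\<exists>U. atlas_open A U \<and> p \<in> U \<and> smooth_fun A U (\<lambda>q. X q f)" using o p c by blast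
qed

lemma vector_field_smooth_near:
  assumes "X \<in> VF" "smooth_near A p f"
  shows "smooth_near A p (\<lambda>q. X q f)"
  using assms vector_field_apply_smooth by (auto simp: smooth_near_def)

lemma smooth_fun_chart_inner: "c \<in> A \<Longrightarrow> smooth_fun A (fst c) (\<lambda>q. snd c q \<bullet> b)"
  by (rule smooth_fun_coordinate[OF _ bounded_linear_inner_left])

lemma vector_fieldsI:
  assumes "\<And>p. p \<notin> carrier_of A \<Longrightarrow> X p = 0" "\<And>p. p \<in> carrier_of A \<Longrightarrow> tangent_at p (X p)"
    and "\<And>c b. c \<in> A \<Longrightarrow> b \<in> Basis \<Longrightarrow> smooth_fun A (fst c) (\<lambda>p. X p (\<lambda>q. snd c q \<bullet> b))"
  shows "X \<in> VF"
  using assms by (simp add: vector_fields_iff)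

lemma vector_fields_add:
  assumes "X \<in> VF" "Y \<in> VF" shows "X + Y \<in> VF"
proof (rule vector_fieldsI)
  show "smooth_fun A (fst c) (\<lambda>p. (X + Y) p (\<lambda>q. snd c q \<bullet> b))" if "c \<in> A" for c b
    using that smooth_fun_add[OF _ vector_field_apply_smooth[OF assms(1)] vector_field_apply_smooth[OF assms(2)],
      OF _ _ smooth_fun_chart_inner _ smooth_fun_chart_inner]
    by (simp add: atlas_open_chart_domain)
qed (use assms in \<open>auto simp: vector_field_outside intro: tangent_at_add vector_field_tangent\<close>)

lemma vector_fields_scale:
  assumes "smooth_global f" "X \<in> VF" shows "f *\<^sub>F X \<in> VF"
proof (rule vector_fieldsI)
  show "smooth_fun A (fst c) (\<lambda>p. (f *\<^sub>F X) p (\<lambda>q. snd c q \<bullet> b))" if c: "c \<in> A" for c b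
  proof -
    have "smooth_fun A (fst c) f"
      by (rule smooth_fun_subset[OF assms(1)]) (use c carrierI in blast)
    then show ?thesis
      using c smooth_fun_mult[OF _ _ vector_field_apply_smooth[OF assms(2)], OF _ _ _ smooth_fun_chart_inner]
      by (simp add: atlas_open_chart_domain)
  qed
qed (use assms in \<open>auto simp: vector_field_outside intro: tangent_at_scale vector_field_tangent\<close>)

lemma vector_fields_uminus:
  assumes "X \<in> VF" shows "- X \<in> VF"
proof -
  have "- X = (\<lambda>p. - 1) *\<^sub>F X" by (auto simp: fun_eq_iff)
  then show ?thesis using vector_fields_scale[OF smooth_fun_const assms, of "- 1"] by simp
qed

lemma vector_fields_diff:
  "X \<in> VF \<Longrightarrow> Y \<in> VF \<Longrightarrow> X - Y \<in> VF"
  using vector_fields_add[of X "- Y"] vector_fields_uminus[of Y] by simp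

lemma vector_fields_zero: "0 \<in> VF"
  by (rule vector_fieldsI) (auto intro: tangent_at_zero)

lemma vector_fields_sum:
  "(\<And>i. i \<in> I \<Longrightarrow> X i \<in> VF) \<Longrightarrow> (\<Sum>i\<in>I. X i) \<in> VF"
  by (induction I rule: infinite_finite_induct) (auto intro: vector_fields_add vector_fields_zero)

end

subsection \<open>The Lie bracket\<close>

text \<open>A product rule: the first term differentiates \<open>F\<close> once more with the
  direction frozen at \<open>B x\<close>, the second differentiates the direction.\<close>

lemma frechet_derivative_field_derivative:
  fixes F :: "'a::euclidean_space \<Rightarrow> 'b::real_normed_vector"
  assumes S: "open S" "x \<in> S" and F: "smooth_on S F" and B: "smooth_on S B"
  shows "fderiv (\<lambda>y. fderiv F y (B y)) x v =
    fderiv (\<lambda>y. fderiv F y (B x)) x v +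
    fderiv F x (fderiv B x v)"
proof -
  have exp: "fderiv F y w = (\<Sum>b\<in>Basis. (w \<bullet> b) *\<^sub>R fderiv F y b)"
    if "y \<in> S" for y w
    using smooth_on_imp_differentiable[OF F that] by (rule frechet_derivative_euclidean_expansion)
  have dF: "((\<lambda>y. fderiv F y b) has_derivative
      fderiv (\<lambda>y. fderiv F y b) x) (at x)" for b
    using smooth_on_imp_differentiable[OF smooth_on_frechet_derivative[OF F] S(2)]
    by (rule has_derivative_frechet)
  have dB: "((\<lambda>y. B y \<bullet> b) has_derivative (\<lambda>h. fderiv B x h \<bullet> b)) (at x)" for b
    using has_derivative_frechet[OF smooth_on_imp_differentiable[OF B S(2)]]
    by (rule has_derivative_inner_left)
  have "fderiv (\<lambda>y. fderiv F y (B y)) x v =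
    fderiv (\<lambda>y. \<Sum>b\<in>Basis. (B y \<bullet> b) *\<^sub>R fderiv F y b) x v"
    using frechet_derivative_cong_open[OF S, of "\<lambda>y. fderiv F y (B y)"
      "\<lambda>y. \<Sum>b\<in>Basis. (B y \<bullet> b) *\<^sub>R fderiv F y b"] exp by simp
  also have "\<dots> = (\<Sum>b\<in>Basis. (B x \<bullet> b) *\<^sub>R fderiv (\<lambda>y. fderiv F y b) x v
      + (fderiv B x v \<bullet> b) *\<^sub>R fderiv F x b)"
    by (rule frechet_derivative_eqI[OF has_derivative_sum[OF has_derivative_scaleR[OF dB dF]]])
  also have "\<dots> = (\<Sum>b\<in>Basis. (B x \<bullet> b) *\<^sub>R fderiv (\<lambda>y. fderiv F y b) x v)
      + fderiv F x (fderiv B x v)"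
    by (simp add: sum.distrib exp[OF S(2), symmetric])
  \<comment> \<open>The coefficients are now constants, so the sum is the derivative of a single
    function, the one with frozen direction.\<close>
  also have "(\<Sum>b\<in>Basis. (B x \<bullet> b) *\<^sub>R fderiv (\<lambda>y. fderiv F y b) x v) =
      fderiv (\<lambda>y. \<Sum>b\<in>Basis. (B x \<bullet> b) *\<^sub>R fderiv F y b) x v"
    by (rule frechet_derivative_eqI[OF has_derivative_sum[OF has_derivative_scaleR_right[OF dF]], symmetric])
  also have "\<dots> = fderiv (\<lambda>y. fderiv F y (B x)) x v"
    using frechet_derivative_cong_open[OF S, of "\<lambda>y. fderiv F y (B x)"
      "\<lambda>y. \<Sum>b\<in>Basis. (B x \<bullet> b) *\<^sub>R fderiv F y b"] exp by simp
  finally show ?thesis .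
qed

text \<open>Both second-order terms have frozen directions and cancel by symmetry; only the
  derivatives of the direction fields survive.\<close>

lemma second_derivative_commutator:
  fixes F :: "'a::euclidean_space \<Rightarrow> real"
  assumes S: "open S" "x \<in> S" and F: "smooth_on S F" and G: "smooth_on S G" and H: "smooth_on S H"
  shows "fderiv (\<lambda>y. fderiv F y (H y)) x (G x) -
      fderiv (\<lambda>y. fderiv F y (G y)) x (H x) =
    fderiv F x
      (fderiv H x (G x) - fderiv G x (H x))"
  unfolding frechet_derivative_field_derivative[OF S F G] frechet_derivative_field_derivative[OF S F H]
    second_derivative_symmetric[OF S F, of "G x" "H x"]
  using linear_diff[OF linear_frechet_derivative[OF smooth_on_imp_differentiable[OF F S(2)]]] by simp

context smooth_charts
begin

text \<open>With coefficient fields \<open>a\<close> and \<open>b\<close> in a chart, the bracket is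
  differentiation in the direction given by the derivative of \<open>b\<close> along
  \<open>a\<close> minus the derivative of \<open>a\<close> along \<open>b\<close>.\<close>

lemma lie_bracket_tangent:
  assumes X: "X \<in> VF" and Y: "Y \<in> VF" and p: "p \<in> carrier_of A"
  shows "tangent_at p (lie_bracket A X Y p)"
proof -
  obtain c where c: "c \<in> A" "p \<in> fst c" using p by (rule carrierE)
  obtain a where a: "smooth_fun A (fst c) a" "\<And>p. p \<in> fst c \<Longrightarrow> X p = partial A c (a p) p"
    by (rule vector_field_chartE[OF X c(1)]) blast
  obtain b where b: "smooth_fun A (fst c) b" "\<And>p. p \<in> fst c \<Longrightarrow> Y p = partial A c (b p) p"
    by (rule vector_field_chartE[OF Y c(1)]) blast
  let ?x = "snd c p" let ?a = "a \<circ> chart_inv c" let ?b = "b \<circ> chart_inv c"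
  \<comment> \<open>Stated for an arbitrary ordered pair of fields so that it yields both halves of
    the commutator.\<close>
  have field: "Z p (\<lambda>q. Z' q f) =
      fderiv (\<lambda>y. fderiv (f \<circ> chart_inv c) y ((z' \<circ> chart_inv c) y)) ?x (z p)"
    if W: "atlas_open A W" "p \<in> W" "smooth_fun A W f"
      and Z: "\<And>p. p \<in> fst c \<Longrightarrow> Z p = partial A c (z p) p"
      and Z': "Z' \<in> VF" "\<And>p. p \<in> fst c \<Longrightarrow> Z' p = partial A c (z' p) p"
    for f W z z' and Z Z' :: "'e vfield"
  proof -
    have "smooth_near A p (\<lambda>q. Z' q f)"
      using Z'(1) smooth_nearI[OF W] by (rule vector_field_smooth_near)
    then have "Z p (\<lambda>q. Z' q f) = fderiv ((\<lambda>q. Z' q f) \<circ> chart_inv c) ?x (z p)"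
      using Z c by (simp add: partial_smooth)
    also have "fderiv ((\<lambda>q. Z' q f) \<circ> chart_inv c) ?x =
       fderiv (\<lambda>y. fderiv (f \<circ> chart_inv c) y ((z' \<circ> chart_inv c) y)) ?x"
      using atlas_openD[OF W(1) c(1)] W(2) c
      by (intro frechet_derivative_cong_open[of "snd c ` (W \<inter> fst c)"])
        (auto simp: Z' partial_smooth smooth_nearI[OF W(1) _ W(3)])
    finally show ?thesis .
  qed
  have "lie_bracket A X Y p f = partial A c
    (fderiv ?b ?x (?a ?x) - fderiv ?a ?x (?b ?x)) p f" for f
  proof (cases "smooth_near A p f")
    case True
    then obtain W where W: "atlas_open A W" "p \<in> W" "smooth_fun A W f" by (auto simp: smooth_near_def)
    let ?S = "snd c ` (W \<inter> fst c)"
    have S: "open ?S" "?x \<in> ?S" using W c by (auto intro: atlas_openD)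
    have "smooth_on ?S (f \<circ> chart_inv c)" using W c by (intro smooth_funD)
    moreover have "smooth_on ?S ?a"
      by (rule smooth_on_subset[OF smooth_funD[OF a(1) c(1)]]) auto
    moreover have "smooth_on ?S ?b"
      by (rule smooth_on_subset[OF smooth_funD[OF b(1) c(1)]]) auto
    ultimately show ?thesis
      using True field[OF W a(2) Y b(2)] field[OF W b(2) X a(2)]
        second_derivative_commutator[OF S, of "f \<circ> chart_inv c" ?a ?b] c
      by (simp add: lie_bracket_def partial_smooth)
  qed (simp add: lie_bracket_def partial_not_smooth)
  then have "lie_bracket A X Y p = partial A c
    (fderiv ?b ?x (?a ?x) - fderiv ?a ?x (?b ?x)) p" by blast
  then show ?thesis using tangent_at_partial[OF c] by simp
qed

lemma vector_fields_lie_bracket: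
  assumes X: "X \<in> VF" and Y: "Y \<in> VF"
  shows "lie_bracket A X Y \<in> VF"
proof (rule vector_fieldsI)
  show "lie_bracket A X Y p = 0" if "p \<notin> carrier_of A" for p
    using that smooth_near_carrier by (auto simp: lie_bracket_def fun_eq_iff)
  show "smooth_fun A (fst c) (\<lambda>p. lie_bracket A X Y p (\<lambda>q. snd c q \<bullet> b))" if c: "c \<in> A" for c b
  proof -
    note o = atlas_open_chart_domain[OF c] and s = smooth_fun_chart_inner[OF c, of b]
    have "smooth_fun A (fst c) (\<lambda>p. X p (\<lambda>q. Y q (\<lambda>q. snd c q \<bullet> b)) - Y p (\<lambda>q. X q (\<lambda>q. snd c q \<bullet> b)))"
      by (rule smooth_fun_diff[OF o vector_field_apply_smooth[OF X o vector_field_apply_smooth[OF Y o s]]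
        vector_field_apply_smooth[OF Y o vector_field_apply_smooth[OF X o s]]])
    then show ?thesis
      by (subst smooth_fun_cong[OF o]) (simp_all add: lie_bracket_def smooth_nearI[OF o _ s])
  qed
qed (use assms in \<open>rule lie_bracket_tangent\<close>)

lemma lie_bracket_swap: "lie_bracket A Y X = - lie_bracket A X Y"
  by (simp add: fun_eq_iff lie_bracket_def)

lemma lie_bracket_add:
  assumes "X \<in> VF" "X' \<in> VF" "Y \<in> VF"
  shows "lie_bracket A (X + X') Y = lie_bracket A X Y + lie_bracket A X' Y"
proof (intro ext)
  fix p f
  show "lie_bracket A (X + X') Y p f = (lie_bracket A X Y + lie_bracket A X' Y) p f"
  proof (cases "smooth_near A p f")
    case True
    then show ?thesis
      using tangent_at_fun_add[OF vector_field_tangent[OF assms(3) smooth_near_carrier[OF True]]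
        vector_field_smooth_near[OF assms(1) True] vector_field_smooth_near[OF assms(2) True]]
      by (simp add: lie_bracket_def)
  qed (simp add: lie_bracket_def)
qed

lemma smooth_near_carrierI: "smooth_global f \<Longrightarrow> p \<in> carrier_of A \<Longrightarrow> smooth_near A p f"
  using smooth_nearI[OF atlas_open_carrier] by blast

lemma lie_bracket_scale:
  assumes f: "smooth_global f" and XY: "X \<in> VF" "Y \<in> VF"
  shows "lie_bracket A (f *\<^sub>F X) Y = f *\<^sub>F lie_bracket A X Y - (\<lambda>p. Y p f) *\<^sub>F X"
proof (intro ext)
  fix p g
  show "lie_bracket A (f *\<^sub>F X) Y p g = (f *\<^sub>F lie_bracket A X Y - (\<lambda>p. Y p f) *\<^sub>F X) p g"
  proof (cases "smooth_near A p g")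
    case True
    note p = smooth_near_carrier[OF True]
    show ?thesis
      using True tangent_at_fun_mult[OF vector_field_tangent[OF XY(2) p]
        smooth_near_carrierI[OF f p] vector_field_smooth_near[OF XY(1) True]]
      by (simp add: lie_bracket_def algebra_simps)
  next
    case False
    \<comment> \<open>The bracket is 0 on such \<open>g\<close> by convention, so the additional
      term, a multiple of \<open>X p g\<close>, must vanish as well.\<close>
    then have "X p g = 0"
      using tangent_at_not_smooth[OF vector_field_tangent[OF XY(1)] False] vector_field_outside[OF XY(1)]
      by (cases "p \<in> carrier_of A") auto
    then show ?thesis using False by (simp add: lie_bracket_def)
  qed
qed

subsection \<open>The curvature of a linear connection\<close>

text \<open>Scaling by \<open>f\<close> produces derivatives of \<open>f\<close>, which cancel. In
  the first argument the Leibniz term of \<open>D Y\<close> cancels against the correction in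
  \<open>lie_bracket_scale\<close>. In the third argument the mixed first-order terms cancel in
  pairs, and the second derivatives of \<open>f\<close> combine to the bracket applied to
  \<open>f\<close>.\<close>

lemma curvature_type_tensor_curvature:
  assumes D: "linear_connection A D"
  shows "curvature_type_tensor A (curvature A D)"
proof -
  let ?V = "VF"
  have closed: "X \<in> ?V \<Longrightarrow> Y \<in> ?V \<Longrightarrow> D X Y \<in> ?V" for X Y
    using D by (simp add: linear_connection_def)
  have add1: "X \<in> ?V \<Longrightarrow> X' \<in> ?V \<Longrightarrow> Y \<in> ?V \<Longrightarrow> D (X + X') Y = D X Y + D X' Y" for X X' Y
    using D by (simp add: linear_connection_def)
  have add2: "X \<in> ?V \<Longrightarrow> Y \<in> ?V \<Longrightarrow> Y' \<in> ?V \<Longrightarrow> D X (Y + Y') = D X Y + D X Y'" for X Y Y'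
    using D by (simp add: linear_connection_def)
  have scale1: "smooth_global f \<Longrightarrow> X \<in> ?V \<Longrightarrow> Y \<in> ?V \<Longrightarrow> D (f *\<^sub>F X) Y = f *\<^sub>F D X Y" for f X Y
    using D by (simp add: linear_connection_def)
  have scale2: "smooth_global f \<Longrightarrow> X \<in> ?V \<Longrightarrow> Y \<in> ?V \<Longrightarrow>
      D X (f *\<^sub>F Y) = (\<lambda>p. X p f) *\<^sub>F Y + f *\<^sub>F D X Y" for f X Y
    using D by (simp add: linear_connection_def)
  have minus1: "D (- X) Y = - D X Y" if "X \<in> ?V" "Y \<in> ?V" for X Y
  proof -
    have "- X = (\<lambda>p. - 1) *\<^sub>F X" by (simp add: fun_eq_iff)
    then have "D (- X) Y = (\<lambda>p. - 1) *\<^sub>F D X Y" using scale1[of "\<lambda>p. - 1" X Y] that by simp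
    then show ?thesis by (simp add: fun_eq_iff)
  qed
  have diff1: "D (X - X') Y = D X Y - D X' Y" if "X \<in> ?V" "X' \<in> ?V" "Y \<in> ?V" for X X' Y
    using add1[of X "- X'" Y] minus1[of X' Y] that by (simp add: vector_fields_uminus)
  note vf = closed vector_fields_lie_bracket vector_fields_add vector_fields_diff vector_fields_scale
  have app: "smooth_global (\<lambda>p. X p f)"
    if "X \<in> ?V" "smooth_global f" for X f
    using vector_field_apply_smooth[OF that(1) atlas_open_carrier that(2)] .
  show ?thesis
    unfolding curvature_type_tensor_def
  proof (intro ballI conjI allI impI)
    fix X Y Z assume X: "X \<in> ?V" and Y: "Y \<in> ?V" and Z: "Z \<in> ?V"
    show "curvature A D X Y Z \<in> ?V" using X Y Z by (simp add: curvature_def vf)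
    show "curvature A D Y X Z = - curvature A D X Y Z"
      using X Y Z by (simp add: curvature_def lie_bracket_swap[of Y X] minus1 vf)
    show "curvature A D (X + X') Y Z = curvature A D X Y Z + curvature A D X' Y Z" if "X' \<in> ?V" for X'
      using X Y Z that by (simp add: curvature_def lie_bracket_add add1 add2 vf)
    show "curvature A D X Y (Z + Z') = curvature A D X Y Z + curvature A D X Y Z'" if "Z' \<in> ?V" for Z'
      using X Y Z that by (simp add: curvature_def add2 vf)
    fix f :: "'e \<Rightarrow> real" assume f: "smooth_global f"
    note Xf = app[OF X f] and Yf = app[OF Y f]
    have "curvature A D (f *\<^sub>F X) Y Z =
      f *\<^sub>F D X (D Y Z) - ((\<lambda>p. Y p f) *\<^sub>F D X Z + f *\<^sub>F D Y (D X Z))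
       - (f *\<^sub>F D (lie_bracket A X Y) Z - (\<lambda>p. Y p f) *\<^sub>F D X Z)"
      unfolding curvature_def using X Y Z f Yf
      by (simp add: scale1 scale2 lie_bracket_scale diff1 vf)
    then show "curvature A D (f *\<^sub>F X) Y Z = f *\<^sub>F curvature A D X Y Z"
      by (simp add: curvature_def fun_eq_iff algebra_simps)
    \<comment> \<open>The commutator form of the bracket holds only where \<open>f\<close> is smooth
      nearby; off the carrier the factor \<open>Z\<close> is 0.\<close>
    have bracket: "(\<lambda>p. lie_bracket A X Y p f) *\<^sub>F Z = (\<lambda>p. X p (\<lambda>q. Y q f) - Y p (\<lambda>q. X q f)) *\<^sub>F Z"
    proof
      fix p
      show "((\<lambda>p. lie_bracket A X Y p f) *\<^sub>F Z) p = ((\<lambda>p. X p (\<lambda>q. Y q f) - Y p (\<lambda>q. X q f)) *\<^sub>F Z) p"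
        using smooth_near_carrierI[OF f, of p] vector_field_outside[OF Z, of p]
        by (cases "p \<in> carrier_of A") (auto simp: lie_bracket_def)
    qed
    have "D X (D Y (f *\<^sub>F Z)) = D X ((\<lambda>p. Y p f) *\<^sub>F Z) + D X (f *\<^sub>F D Y Z)"
      using X Y Z f Yf by (simp add: scale2 add2 vf)
    then have 1: "D X (D Y (f *\<^sub>F Z)) = (\<lambda>p. X p (\<lambda>q. Y q f)) *\<^sub>F Z + (\<lambda>p. Y p f) *\<^sub>F D X Z
        + ((\<lambda>p. X p f) *\<^sub>F D Y Z + f *\<^sub>F D X (D Y Z))"
      using X Y Z f Yf by (simp add: scale2 vf)
    have "D Y (D X (f *\<^sub>F Z)) = D Y ((\<lambda>p. X p f) *\<^sub>F Z) + D Y (f *\<^sub>F D X Z)"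
      using X Y Z f Xf by (simp add: scale2 add2 vf)
    then have 2: "D Y (D X (f *\<^sub>F Z)) = (\<lambda>p. Y p (\<lambda>q. X q f)) *\<^sub>F Z + (\<lambda>p. X p f) *\<^sub>F D Y Z
        + ((\<lambda>p. Y p f) *\<^sub>F D X Z + f *\<^sub>F D Y (D X Z))"
      using X Y Z f Xf by (simp add: scale2 vf)
    have 3: "D (lie_bracket A X Y) (f *\<^sub>F Z) =
        (\<lambda>p. X p (\<lambda>q. Y q f) - Y p (\<lambda>q. X q f)) *\<^sub>F Z + f *\<^sub>F D (lie_bracket A X Y) Z"
      using X Y Z f by (simp add: scale2 bracket vf)
    show "curvature A D X Y (f *\<^sub>F Z) = f *\<^sub>F curvature A D X Y Z"
      unfolding curvature_def 1 2 3 by (simp add: fun_eq_iff algebra_simps)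
  qed
qed

end

section \<open>Bump functions and locality of tensor fields\<close>

context smooth_charts
begin

text \<open>The classical argument that compact sets are closed in a Hausdorff space. Compactness is
  used in coordinates, where a topology is available, and the chart carries the finite subcover back
  to the carrier.\<close>

lemma atlas_open_compact_complement:
  assumes c: "c \<in> A" and K: "compact K" "K \<subseteq> snd c ` fst c"
  shows "atlas_open A (carrier_of A - {q \<in> fst c. snd c q \<in> K})"
proof (rule atlas_open_local)
  let ?C = "{q \<in> fst c. snd c q \<in> K}"
  fix q assume q: "q \<in> carrier_of A - ?C"
  have "\<forall>p\<in>?C. \<exists>U V. atlas_open A U \<and> atlas_open A V \<and> p \<in> U \<and> q \<in> V \<and> U \<inter> V = {}"
    using hausdorff q carrierI[OF c] by blast
  then obtain U V where UV: "\<And>p. p \<in> ?C \<Longrightarrow>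
      atlas_open A (U p) \<and> atlas_open A (V p) \<and> p \<in> U p \<and> q \<in> V p \<and> U p \<inter> V p = {}"
    by metis
  have "\<And>p. p \<in> ?C \<Longrightarrow> open (snd c ` (U p \<inter> fst c))" using UV atlas_openD[OF _ c] by blast
  moreover have "K \<subseteq> (\<Union>p\<in>?C. snd c ` (U p \<inter> fst c))" using K(2) UV by blast
  ultimately obtain P where P: "P \<subseteq> ?C" "finite P" "K \<subseteq> (\<Union>p\<in>P. snd c ` (U p \<inter> fst c))"
    using compactE_image[OF K(1), of ?C "\<lambda>p. snd c ` (U p \<inter> fst c)"] by blast
  have "atlas_open A (carrier_of A \<inter> (\<Inter>p\<in>P. V p))"
    using UV P(1) by (intro atlas_open_finite_Inter[OF P(2)] atlas_open_carrier) blast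
  moreover have "q \<in> carrier_of A \<inter> (\<Inter>p\<in>P. V p)" using q UV P(1) by blast
  moreover have "carrier_of A \<inter> (\<Inter>p\<in>P. V p) \<subseteq> carrier_of A - ?C"
  proof
    fix r assume r: "r \<in> carrier_of A \<inter> (\<Inter>p\<in>P. V p)"
    have "r \<notin> ?C"
    proof
      assume "r \<in> ?C"
      then obtain p s where ps: "p \<in> P" "s \<in> U p" "s \<in> fst c" "snd c r = snd c s" "r \<in> fst c" using P(3) by blast
      then have "r = s" using inj_chart[OF c] by (auto dest: inj_onD)
      then show False using ps r UV P(1) by blast
    qed
    then show "r \<in> carrier_of A - ?C" using r by blast
  qed
  ultimately show "\<exists>U. atlas_open A U \<and> q \<in> U \<and> U \<subseteq> carrier_of A - ?C" by blast
qed

text \<open>The closed set \<open>C\<close> inside \<open>W\<close>, off which the function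
  vanishes, is part of the result: extension by zero is smooth because \<open>W\<close> and the
  complement of \<open>C\<close> form an open cover of the carrier.\<close>

lemma bump_function_exists:
  assumes W: "atlas_open A W" "p \<in> W"
  obtains \<rho> U C where "smooth_global \<rho>" "atlas_open A U" "p \<in> U" "U \<subseteq> W"
    "\<And>q. q \<in> U \<Longrightarrow> \<rho> q = (1::real)" "C \<subseteq> W" "atlas_open A (carrier_of A - C)"
    "\<And>q. q \<notin> C \<Longrightarrow> \<rho> q = 0"
proof -
  obtain c where c: "c \<in> A" "p \<in> fst c" using W atlas_open_subset carrierE by blast
  let ?x = "snd c p"
  have "open (snd c ` (W \<inter> fst c))" "?x \<in> snd c ` (W \<inter> fst c)" using W c by (auto intro: atlas_openD)
  then obtain r where r: "r > 0" "cball ?x r \<subseteq> snd c ` (W \<inter> fst c)"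
    using open_contains_cball by blast
  obtain \<eta> :: "'v \<Rightarrow> real" where \<eta>: "smooth_on UNIV \<eta>" "\<And>x. dist ?x x \<le> r / 2 \<Longrightarrow> \<eta> x = 1"
      "\<And>x. dist ?x x \<ge> r \<Longrightarrow> \<eta> x = 0"
    using smooth_bump_exists[OF r(1)] by blast
  define C where "C = {q \<in> fst c. snd c q \<in> cball ?x r}"
  define \<rho> where "\<rho> q = (if q \<in> fst c then \<eta> (snd c q) else 0)" for q
  have CW: "C \<subseteq> W"
  proof
    fix q assume "q \<in> C"
    then obtain s where "s \<in> W" "s \<in> fst c" "snd c q = snd c s" "q \<in> fst c" using r(2) by (auto simp: C_def)
    then show "q \<in> W" using inj_chart[OF c(1)] by (auto dest: inj_onD)
  qed
  have oC: "atlas_open A (carrier_of A - C)"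
    unfolding C_def using r(2) by (intro atlas_open_compact_complement c) auto
  have zero: "\<rho> q = 0" if "q \<notin> C" for q using that \<eta>(3) by (auto simp: \<rho>_def C_def)
  have "smooth_global \<rho>"
  proof (rule smooth_fun_local)
    fix q assume q: "q \<in> carrier_of A"
    show "\<exists>U. atlas_open A U \<and> q \<in> U \<and> smooth_fun A U \<rho>"
    proof (cases "q \<in> C")
      case True
      have "smooth_fun A (fst c) \<rho>"
        by (rule smooth_fun_chartI[OF c(1) atlas_open_chart_domain[OF c(1)] order_refl smooth_on_subset[OF \<eta>(1)]])
          (auto simp: \<rho>_def)
      then show ?thesis using True c by (intro exI[of _ "fst c"]) (simp add: C_def atlas_open_chart_domain)
    next
      case False
      have "smooth_fun A (carrier_of A - C) \<rho>"
        using smooth_fun_cong[OF oC, of \<rho> "\<lambda>q. 0"] zero by simp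
      then show ?thesis using False q oC by blast
    qed
  qed
  moreover have "atlas_open A {q \<in> fst c. snd c q \<in> ball ?x (r / 2)}"
    by (rule atlas_open_preimage[OF c(1)]) simp
  moreover have "{q \<in> fst c. snd c q \<in> ball ?x (r / 2)} \<subseteq> W"
    using CW r(1) by (auto simp: C_def)
  ultimately show ?thesis
    using that[of \<rho> "{q \<in> fst c. snd c q \<in> ball ?x (r / 2)}" C] c r(1) CW oC zero \<eta>(2) by (simp add: \<rho>_def)
qed

text \<open>On \<open>W\<close> this is a product of smooth functions, on the complement of
  \<open>C\<close> it is 0, and these two open sets cover the carrier.\<close>

lemma smooth_fun_extend:
  fixes a :: "'e \<Rightarrow> 'b::real_normed_vector"
  assumes W: "atlas_open A W" and C: "C \<subseteq> W" "atlas_open A (carrier_of A - C)"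
    and \<rho>: "smooth_fun A W \<rho>" "\<And>q. q \<notin> C \<Longrightarrow> \<rho> q = (0::real)" and a: "smooth_fun A W a"
  shows "smooth_global (\<lambda>q. if q \<in> W then \<rho> q *\<^sub>R a q else 0)" (is "smooth_fun A _ ?f")
proof (rule smooth_fun_local)
  fix q assume q: "q \<in> carrier_of A"
  show "\<exists>U. atlas_open A U \<and> q \<in> U \<and> smooth_fun A U ?f"
  proof (cases "q \<in> C")
    case True
    have "smooth_fun A W ?f"
      using smooth_fun_cong[OF W, of ?f "\<lambda>q. \<rho> q *\<^sub>R a q"] smooth_fun_scaleR[OF W \<rho>(1) a] by simp
    then show ?thesis using True W C by blast
  next
    case False
    have "smooth_fun A (carrier_of A - C) ?f"
      using smooth_fun_cong[OF C(2), of ?f "\<lambda>q. 0"] \<rho>(2) by simp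
    then show ?thesis using False q C by blast
  qed
qed

text \<open>The values of \<open>X\<close> off \<open>W\<close> are recorded because the projections have to be computed at every
  point.\<close>

lemma local_field_extension:
  assumes c: "c \<in> A" and W: "atlas_open A W" "W \<subseteq> fst c" and a: "smooth_fun A W a" and p: "p \<in> W"
  obtains X \<rho> U where "X \<in> VF"
    "\<And>q. X q = (if q \<in> W then \<rho> q *\<^sub>T partial A c (a q) q else 0)"
    "atlas_open A U" "p \<in> U" "U \<subseteq> W" "\<And>q. q \<in> U \<Longrightarrow> \<rho> q = 1"
proof -
  obtain \<rho> U C where \<rho>: "smooth_global \<rho>" and U: "atlas_open A U" "p \<in> U" "U \<subseteq> W"
    "\<And>q. q \<in> U \<Longrightarrow> \<rho> q = (1::real)" and C: "C \<subseteq> W" "atlas_open A (carrier_of A - C)"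
    "\<And>q. q \<notin> C \<Longrightarrow> \<rho> q = 0"
    by (rule bump_function_exists[OF W(1) p]) (rule that)
  define X where "X q = (if q \<in> W then \<rho> q *\<^sub>T partial A c (a q) q else 0)" for q
  have "X \<in> VF"
  proof (rule vector_fieldsI)
    show "X q = 0" if "q \<notin> carrier_of A" for q using that W atlas_open_subset by (auto simp: X_def)
    show "tangent_at q (X q)" if "q \<in> carrier_of A" for q
      using that W c by (auto simp: X_def intro!: tangent_at_scale tangent_at_partial tangent_at_zero)
    fix c' and b :: 'v assume c': "c' \<in> A"
    have o: "atlas_open A (W \<inter> fst c')" using W c' by (intro atlas_open_Int atlas_open_chart_domain)
    have "smooth_fun A (W \<inter> fst c') (\<lambda>q. partial A c (a q) q (\<lambda>q. snd c' q \<bullet> b))"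
      by (rule smooth_fun_partial_field[OF c o])
        (use W smooth_fun_subset[OF a] smooth_fun_subset[OF smooth_fun_chart_inner[OF c']] in auto)
    then have s: "smooth_fun A (W \<inter> fst c') (\<lambda>q. \<rho> q * partial A c (a q) q (\<lambda>q. snd c' q \<bullet> b))"
      using o \<rho> by (intro smooth_fun_mult) (auto elim!: smooth_fun_subset dest: atlas_open_subset)
    show "smooth_fun A (fst c') (\<lambda>q. X q (\<lambda>q. snd c' q \<bullet> b))" (is "smooth_fun A _ ?f")
    proof (rule smooth_fun_local)
      fix q assume q: "q \<in> fst c'"
      show "\<exists>U. atlas_open A U \<and> q \<in> U \<and> smooth_fun A U ?f"
      proof (cases "q \<in> C")
        case True
        have "smooth_fun A (W \<inter> fst c') ?f"
          by (subst smooth_fun_cong[OF o, OF _]) (use s in \<open>auto simp: X_def\<close>)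
        then show ?thesis using True q C(1) o by blast
      next
        case False
        have "?f q = 0" if "q \<notin> C" for q using that C(3) by (simp add: X_def)
        then have "smooth_fun A (carrier_of A - C) ?f"
          using smooth_fun_cong[OF C(2), of ?f "\<lambda>q. 0"] by simp
        then show ?thesis using False q C(2) carrierI[OF c' q] by blast
      qed
    qed
  qed
  then show ?thesis using that[of X \<rho> U] U by (simp add: X_def)
qed

text \<open>Models one slot of a tensor evaluated at \<open>p\<close>, the other slots being fixed.
  Locality and frame expansion are proved once for such functionals and then used in each of the
  three slots.\<close>

definition tensorial_at :: "'e \<Rightarrow> ('e vfield \<Rightarrow> 'e tangent) \<Rightarrow> bool" where
  "tensorial_at p L \<longleftrightarrow>
     (\<forall>X\<in>VF. \<forall>X'\<in>VF. L (X + X') = L X + L X') \<and>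
     (\<forall>f. smooth_global f \<longrightarrow> (\<forall>X\<in>VF. L (f *\<^sub>F X) = f p *\<^sub>T L X))"

lemma tensorial_at_zero:
  assumes L: "tensorial_at p L" shows "L 0 = 0"
proof -
  have "L ((\<lambda>p. 0) *\<^sub>F 0) = 0 *\<^sub>T L 0"
    using L vector_fields_zero smooth_fun_const unfolding tensorial_at_def by blast
  moreover have "(\<lambda>p. 0) *\<^sub>F (0 :: 'e vfield) = 0" by (intro ext) simp
  ultimately show ?thesis by simp
qed

text \<open>A bump function supported in \<open>W\<close> annihilates the difference of the two
  fields everywhere, yet it has value 1 at \<open>p\<close>, so \<open>L\<close> of the difference
  is 0.\<close>

lemma tensorial_at_local:
  assumes L: "tensorial_at p L" and X: "X \<in> VF" "X' \<in> VF"
    and W: "atlas_open A W" "p \<in> W" "\<And>q. q \<in> W \<Longrightarrow> X q = X' q"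
  shows "L X = L X'"
proof -
  obtain \<rho> U C where \<rho>: "smooth_global \<rho>" and U: "atlas_open A U" "p \<in> U" "U \<subseteq> W"
    "\<And>q. q \<in> U \<Longrightarrow> \<rho> q = (1::real)" and C: "C \<subseteq> W" "atlas_open A (carrier_of A - C)"
    "\<And>q. q \<notin> C \<Longrightarrow> \<rho> q = 0"
    by (rule bump_function_exists[OF W(1,2)]) (rule that)
  let ?Y = "X - X'"
  have Y: "?Y \<in> VF" using X by (rule vector_fields_diff)
  have "\<rho> *\<^sub>F ?Y = 0"
  proof
    fix q show "(\<rho> *\<^sub>F ?Y) q = 0 q" using C(1,3) W(3)[of q] by (cases "q \<in> C") auto
  qed
  moreover have "L (\<rho> *\<^sub>F ?Y) = \<rho> p *\<^sub>T L ?Y" using L \<rho> Y by (simp add: tensorial_at_def)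
  ultimately have "L ?Y = 0" using U tensorial_at_zero[OF L] by simp
  moreover have "L X = L ?Y + L X'"
  proof -
    have "L (?Y + X') = L ?Y + L X'" using L Y X unfolding tensorial_at_def by blast
    then show ?thesis by simp
  qed
  ultimately show ?thesis by simp
qed

lemma tensorial_at_sum:
  assumes L: "tensorial_at p L" and X: "\<And>i. i \<in> I \<Longrightarrow> X i \<in> VF"
  shows "L (\<Sum>i\<in>I. X i) = (\<Sum>i\<in>I. L (X i))"
  using X
proof (induction I rule: infinite_finite_induct)
  case (insert i I)
  then have "X i \<in> VF" "(\<Sum>i\<in>I. X i) \<in> VF" by (auto intro: vector_fields_sum)
  then have "L (X i + (\<Sum>i\<in>I. X i)) = L (X i) + L (\<Sum>i\<in>I. X i)"
    using L unfolding tensorial_at_def by blast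
  then show ?case unfolding sum.insert[OF insert.hyps] using insert.IH insert.prems by (simp only: insertI1 insertI2)
qed (simp_all add: tensorial_at_zero[OF L])

text \<open>Linearity over functions concerns global functions, but the coefficients are smooth on
  \<open>W\<close> only. Multiplied by a bump function and extended by 0 they become global, with
  unchanged values near \<open>p\<close>.\<close>

lemma tensorial_at_local_combination:
  assumes L: "tensorial_at p L" and X: "X \<in> VF"
    and F: "\<And>i. i \<in> I \<Longrightarrow> F i \<in> VF"
    and W: "atlas_open A W" "p \<in> W" and a: "\<And>i. i \<in> I \<Longrightarrow> smooth_fun A W (a i)"
    and eq: "\<And>q. q \<in> W \<Longrightarrow> X q = (\<Sum>i\<in>I. a i q *\<^sub>T F i q)"
  shows "L X = (\<Sum>i\<in>I. a i p *\<^sub>T L (F i))"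
proof -
  obtain \<rho> U C where \<rho>: "smooth_global \<rho>" and U: "atlas_open A U" "p \<in> U" "U \<subseteq> W"
    "\<And>q. q \<in> U \<Longrightarrow> \<rho> q = (1::real)" and C: "C \<subseteq> W" "atlas_open A (carrier_of A - C)"
    "\<And>q. q \<notin> C \<Longrightarrow> \<rho> q = 0"
    by (rule bump_function_exists[OF W]) (rule that)
  define g where "g i = (\<lambda>q. if q \<in> W then \<rho> q *\<^sub>R a i q else 0)" for i
  have g: "smooth_global (g i)" if "i \<in> I" for i
    unfolding g_def using W C a[OF that] smooth_fun_subset[OF \<rho> atlas_open_subset[OF W(1)]]
    by (intro smooth_fun_extend)
  have "L X = L (\<Sum>i\<in>I. g i *\<^sub>F F i)"
  proof (rule tensorial_at_local[OF L X _ U(1,2)])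
    show "(\<Sum>i\<in>I. g i *\<^sub>F F i) \<in> VF" using g F by (intro vector_fields_sum vector_fields_scale)
    show "X q = (\<Sum>i\<in>I. g i *\<^sub>F F i) q" if "q \<in> U" for q
      using that U(3,4) eq by (auto simp: sum_apply_fun g_def intro!: sum.cong)
  qed
  also have "\<dots> = (\<Sum>i\<in>I. L (g i *\<^sub>F F i))" using g F by (intro tensorial_at_sum[OF L] vector_fields_scale)
  also have "\<dots> = (\<Sum>i\<in>I. a i p *\<^sub>T L (F i))"
    using L g F U by (intro sum.cong) (auto simp: tensorial_at_def g_def)
  finally show ?thesis .
qed

section \<open>Values of a tensor on local fields\<close>

context
  fixes Q assumes Q: "curvature_type_tensor A Q"
begin

lemma tensor_laws:
  assumes "X \<in> VF" "Y \<in> VF" "Z \<in> VF"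
  shows "Q X Y Z \<in> VF" "Q Y X Z = - Q X Y Z"
    "X' \<in> VF \<Longrightarrow> Q (X + X') Y Z = Q X Y Z + Q X' Y Z"
    "Z' \<in> VF \<Longrightarrow> Q X Y (Z + Z') = Q X Y Z + Q X Y Z'"
    "smooth_global f \<Longrightarrow> Q (f *\<^sub>F X) Y Z = f *\<^sub>F Q X Y Z"
    "smooth_global f \<Longrightarrow> Q X Y (f *\<^sub>F Z) = f *\<^sub>F Q X Y Z"
  using Q[unfolded curvature_type_tensor_def, rule_format, OF assms] by blast+

lemmas tensor_closed = tensor_laws(1) and tensor_swap = tensor_laws(2)

lemma tensorial_at_first:
  assumes "Y \<in> VF" "Z \<in> VF"
  shows "tensorial_at p (\<lambda>X. Q X Y Z p)"
  using assms by (simp add: tensorial_at_def tensor_laws(3,5))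

lemma tensorial_at_second:
  assumes "X \<in> VF" "Z \<in> VF"
  shows "tensorial_at p (\<lambda>Y. Q X Y Z p)"
  unfolding tensorial_at_def
proof (intro conjI ballI allI impI)
  note t = tensorial_at_first[OF assms, of p, unfolded tensorial_at_def]
  fix Y assume Y: "Y \<in> VF"
  show "Q X (Y + Y') Z p = Q X Y Z p + Q X Y' Z p" if "Y' \<in> VF" for Y'
    using t Y that assms tensor_swap[of _ X Z] by (simp add: vector_fields_add)
  show "Q X (f *\<^sub>F Y) Z p = f p *\<^sub>T Q X Y Z p" if "smooth_global f" for f
    using t Y that assms tensor_swap[of _ X Z] by (simp add: vector_fields_scale scale_tangent_distribs)
qed

lemma tensorial_at_third:
  assumes "X \<in> VF" "Y \<in> VF"
  shows "tensorial_at p (\<lambda>Z. Q X Y Z p)"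
  using assms by (simp add: tensorial_at_def tensor_laws(4,6))

lemma tensor_local:
  assumes V: "X \<in> VF" "Y \<in> VF" "Z \<in> VF"
      "X' \<in> VF" "Y' \<in> VF" "Z' \<in> VF"
    and eq: "agree_near A p X X'" "agree_near A p Y Y'" "agree_near A p Z Z'"
  shows "Q X Y Z p = Q X' Y' Z' p"
proof -
  have "Q X Y Z p = Q X' Y Z p"
    using tensorial_at_local[OF tensorial_at_first] V eq(1) unfolding agree_near_def by blast
  also have "\<dots> = Q X' Y' Z p"
    using tensorial_at_local[OF tensorial_at_second] V eq(2) unfolding agree_near_def by blast
  also have "\<dots> = Q X' Y' Z' p"
    using tensorial_at_local[OF tensorial_at_third] V eq(3) unfolding agree_near_def by blast
  finally show ?thesis .
qed

lemma agree_near_trans_sym: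
  assumes "agree_near A p X F" "agree_near A p X' F" shows "agree_near A p X X'"
proof -
  obtain U V where "atlas_open A U" "p \<in> U" "\<forall>q\<in>U. X q = F q" "atlas_open A V" "p \<in> V" "\<forall>q\<in>V. X' q = F q"
    using assms by (auto simp: agree_near_def)
  then show ?thesis unfolding agree_near_def
    using atlas_open_Int[of U V] by (intro exI[of _ "U \<inter> V"]) auto
qed

text \<open>Justifies the definite description in \<open>local_value\<close>: locality shows that
  all global substitutes give the same value, and the three given ones show that the description is
  not vacuous.\<close>

lemma local_value_eq:
  assumes "X \<in> VF" "Y \<in> VF" "Z \<in> VF"
    and "agree_near A p X F" "agree_near A p Y G" "agree_near A p Z H"
  shows "local_value A Q F G H p = Q X Y Z p"
  unfolding local_value_def
proof (rule the_equality)
  show "\<forall>X'\<in>VF. \<forall>Y'\<in>VF. \<forall>Z'\<in>VF.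
      agree_near A p X' F \<and> agree_near A p Y' G \<and> agree_near A p Z' H \<longrightarrow> Q X' Y' Z' p = Q X Y Z p"
    using assms by (blast intro: tensor_local agree_near_trans_sym)
  show "w = Q X Y Z p" if "\<forall>X'\<in>VF. \<forall>Y'\<in>VF. \<forall>Z'\<in>VF.
      agree_near A p X' F \<and> agree_near A p Y' G \<and> agree_near A p Z' H \<longrightarrow> Q X' Y' Z' p = w" for w
    using that assms by blast
qed

end

end

section \<open>The jet space as a manifold\<close>

lemma smooth_atlas_chart:
  assumes "smooth_atlas A" "c \<in> A"
  shows "open (fst c)" "open (snd c ` fst c)" "continuous_on (fst c) (snd c)"
    "continuous_on (snd c ` fst c) (chart_inv c)" "p \<in> fst c \<Longrightarrow> chart_inv c (snd c p) = p"
  using assms by (auto simp: smooth_atlas_def homeomorphism_def)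

lemma smooth_atlas_inj:
  assumes "smooth_atlas A" "c \<in> A" shows "inj_on (snd c) (fst c)"
  by (rule inj_on_inverseI[where g = "chart_inv c"]) (use smooth_atlas_chart(5)[OF assms] in auto)

lemma smooth_atlas_cover:
  assumes "smooth_atlas A" obtains c where "c \<in> A" "p \<in> fst c"
proof -
  have "(\<Union>c\<in>A. fst c) = UNIV" using assms by (simp only: smooth_atlas_def)
  then show ?thesis using that by blast
qed

lemma smooth_atlas_transition:
  "smooth_atlas A \<Longrightarrow> c \<in> A \<Longrightarrow> c' \<in> A \<Longrightarrow> smooth_on (snd c ` (fst c \<inter> fst c')) (snd c' \<circ> chart_inv c)"
  by (auto simp: smooth_atlas_def)

lemma smooth_atlas_open_image:
  assumes "smooth_atlas A" "c \<in> A" "open U" shows "open (snd c ` (fst c \<inter> U))"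
proof -
  have "snd c ` (fst c \<inter> U) = snd c ` fst c \<inter> chart_inv c -` U"
    using smooth_atlas_chart(5)[OF assms(1,2)] by auto
  then show ?thesis
    using continuous_open_preimage[OF smooth_atlas_chart(4,2)[OF assms(1,2)] assms(3)] by simp
qed

definition jet_deriv :: "('t, 'v) chart \<Rightarrow> ('m, 'w) chart \<Rightarrow> ('t \<Rightarrow> 'm) \<Rightarrow> 't
    \<Rightarrow> 'v::euclidean_space \<Rightarrow> 'w::euclidean_space" where
  "jet_deriv \<phi> \<psi> f t = fderiv (snd \<psi> \<circ> f \<circ> chart_inv \<phi>) (snd \<phi> t)"

lemma smooth_on_fst:
  fixes S :: "('a::real_normed_vector \<times> 'b::real_normed_vector) set"
  shows "open S \<Longrightarrow> smooth_on S fst"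
  by (rule smooth_on_linear[OF _ bounded_linear_fst smooth_on_id])

lemma smooth_on_snd:
  fixes S :: "('a::real_normed_vector \<times> 'b::real_normed_vector) set"
  shows "open S \<Longrightarrow> smooth_on S snd"
  by (rule smooth_on_linear[OF _ bounded_linear_snd smooth_on_id])

locale jet_bundle =
  fixes AT :: "('t::t2_space, real ^ 'p::finite) chart set"
    and AM :: "('m::t2_space, real ^ 'n::finite) chart set"
  assumes AT: "smooth_atlas AT" and AM: "smooth_atlas AM"
begin

section \<open>Smooth maps and their 1-jets in charts\<close>

abbreviation "E \<equiv> jet_atlas AT AM"
abbreviation "JS \<equiv> jet_space AT AM"
abbreviation "JC \<equiv> jet_chart AT AM"
abbreviation "smooth_at \<equiv> smooth_map_near AT AM"
abbreviation "JO \<equiv> jet_of AT AM"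

text \<open>The definition provides smoothness in one unspecified pair of charts; composing with
  transition maps on both sides transfers it to any pair around \<open>t\<close> and
  \<open>f t\<close>.\<close>

lemma smooth_at_charts:
  assumes f: "smooth_at f t" and \<phi>: "\<phi> \<in> AT" "t \<in> fst \<phi>" and \<psi>: "\<psi> \<in> AM" "f t \<in> fst \<psi>"
  obtains W where "open W" "t \<in> W" "W \<subseteq> fst \<phi>" "f ` W \<subseteq> fst \<psi>"
    "smooth_on (snd \<phi> ` W) (snd \<psi> \<circ> f \<circ> chart_inv \<phi>)"
proof -
  obtain \<phi>' \<psi>' W where c: "\<phi>' \<in> AT" "\<psi>' \<in> AM" and W: "open W" "t \<in> W" "W \<subseteq> fst \<phi>'" "f ` W \<subseteq> fst \<psi>'"
    and s: "smooth_on (snd \<phi>' ` W) (snd \<psi>' \<circ> f \<circ> chart_inv \<phi>')"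
    using f unfolding smooth_map_near_def by blast
  note invT = smooth_atlas_chart(5)[OF AT] and invM = smooth_atlas_chart(5)[OF AM]
  \<comment> \<open>\<open>f\<close> is smooth only through its coordinate expression, so its
    continuity is recovered by factoring it through the charts. The new domain \<open>W'\<close> is
    open for this reason.\<close>
  let ?g = "snd \<psi>' \<circ> f \<circ> chart_inv \<phi>'"
  have "continuous_on W (chart_inv \<psi>' \<circ> (?g \<circ> snd \<phi>'))"
  proof (rule continuous_on_compose[OF continuous_on_compose])
    show "continuous_on W (snd \<phi>')"
      using smooth_atlas_chart(3)[OF AT c(1)] W(3) by (rule continuous_on_subset)
    show "continuous_on (snd \<phi>' ` W) ?g" using s by (rule smooth_on_imp_continuous_on)
    show "continuous_on ((?g \<circ> snd \<phi>') ` W) (chart_inv \<psi>')"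
      by (rule continuous_on_subset[OF smooth_atlas_chart(4)[OF AM c(2)]])
        (use W invT[OF c(1)] in \<open>auto simp: image_subset_iff subset_iff\<close>)
  qed
  moreover have "(chart_inv \<psi>' \<circ> (?g \<circ> snd \<phi>')) s = f s" if "s \<in> W" for s
    using that W invT[OF c(1)] invM[OF c(2)] by (auto simp: image_subset_iff subset_iff)
  ultimately have cont: "continuous_on W f"
    using continuous_on_cong[of W W "chart_inv \<psi>' \<circ> (?g \<circ> snd \<phi>')" f] by simp
  define W' where "W' = (W \<inter> f -` fst \<psi>) \<inter> fst \<phi>"
  have o: "open W'" unfolding W'_def
    using continuous_open_preimage[OF cont W(1) smooth_atlas_chart(1)[OF AM \<psi>(1)]]
      smooth_atlas_chart(1)[OF AT \<phi>(1)] by (rule open_Int)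
  have sub: "W' \<subseteq> fst \<phi>" "W' \<subseteq> fst \<phi>'" using W by (auto simp: W'_def)
  have o1: "open (snd \<phi> ` W')" and o2: "open (snd \<phi>' ` W')"
    using smooth_atlas_open_image[OF AT \<phi>(1) o] smooth_atlas_open_image[OF AT c(1) o] sub
    by (simp_all add: Int_absorb1)
  let ?t = "snd \<phi>' \<circ> chart_inv \<phi>" and ?m = "snd \<psi> \<circ> chart_inv \<psi>'"
  have oM: "open (snd \<psi>' ` (fst \<psi>' \<inter> fst \<psi>))"
    using smooth_atlas_open_image[OF AM c(2) smooth_atlas_chart(1)[OF AM \<psi>(1)]] .
  have 1: "smooth_on (snd \<phi> ` W') (?g \<circ> ?t)"
  proof (rule smooth_on_compose[OF o1 o2])
    show "smooth_on (snd \<phi> ` W') ?t"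
      by (rule smooth_on_subset[OF smooth_atlas_transition[OF AT \<phi>(1) c(1)]]) (use W in \<open>auto simp: W'_def\<close>)
    show "smooth_on (snd \<phi>' ` W') ?g" by (rule smooth_on_subset[OF s]) (auto simp: W'_def)
    show "?t ` snd \<phi> ` W' \<subseteq> snd \<phi>' ` W'" using invT[OF \<phi>(1)] by (auto simp: W'_def)
  qed
  have "smooth_on (snd \<phi> ` W') (?m \<circ> (?g \<circ> ?t))"
  proof (rule smooth_on_compose[OF o1 oM 1])
    show "smooth_on (snd \<psi>' ` (fst \<psi>' \<inter> fst \<psi>)) ?m" by (rule smooth_atlas_transition[OF AM c(2) \<psi>(1)])
    show "(?g \<circ> ?t) ` snd \<phi> ` W' \<subseteq> snd \<psi>' ` (fst \<psi>' \<inter> fst \<psi>)"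
      using W sub invT[OF \<phi>(1)] invT[OF c(1)] by (auto simp: W'_def image_subset_iff subset_iff)
  qed
  moreover have "(?m \<circ> (?g \<circ> ?t)) y = (snd \<psi> \<circ> f \<circ> chart_inv \<phi>) y" if "y \<in> snd \<phi> ` W'" for y
    using that W sub invT[OF \<phi>(1)] invT[OF c(1)] invM[OF c(2)]
    by (auto simp: W'_def image_subset_iff subset_iff)
  ultimately have "smooth_on (snd \<phi> ` W') (snd \<psi> \<circ> f \<circ> chart_inv \<phi>)"
    using smooth_on_cong[OF o1, of "?m \<circ> (?g \<circ> ?t)" "snd \<psi> \<circ> f \<circ> chart_inv \<phi>"] by simp
  then show ?thesis
    using that[of W'] o W \<phi> \<psi> by (auto simp: W'_def)
qed

lemma smooth_at_differentiable:
  assumes "smooth_at f t" "\<phi> \<in> AT" "t \<in> fst \<phi>" "\<psi> \<in> AM" "f t \<in> fst \<psi>"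
  shows "(snd \<psi> \<circ> f \<circ> chart_inv \<phi>) differentiable (at (snd \<phi> t))"
  by (rule smooth_at_charts[OF assms]) (auto intro: smooth_on_imp_differentiable)

lemma linear_jet_deriv:
  assumes "smooth_at f t" "\<phi> \<in> AT" "t \<in> fst \<phi>" "\<psi> \<in> AM" "f t \<in> fst \<psi>"
  shows "linear (jet_deriv \<phi> \<psi> f t)"
  unfolding jet_deriv_def using smooth_at_differentiable[OF assms] by (rule linear_frechet_derivative)

lemma transition_differentiable:
  assumes "smooth_atlas A" "c \<in> A" "c' \<in> A" "p \<in> fst c" "p \<in> fst c'"
  shows "(snd c' \<circ> chart_inv c) differentiable (at (snd c p))"
  by (rule smooth_on_imp_differentiable[OF smooth_atlas_transition[OF assms(1-3)]]) (use assms in auto)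

lemma jet_deriv_change_charts:
  assumes f: "smooth_at f t" and \<phi>: "\<phi> \<in> AT" "t \<in> fst \<phi>" and \<psi>: "\<psi> \<in> AM" "f t \<in> fst \<psi>"
    and \<phi>': "\<phi>' \<in> AT" "t \<in> fst \<phi>'" and \<psi>': "\<psi>' \<in> AM" "f t \<in> fst \<psi>'"
  shows "jet_deriv \<phi>' \<psi>' f t =
    fderiv (snd \<psi>' \<circ> chart_inv \<psi>) (snd \<psi> (f t)) \<circ>
    (jet_deriv \<phi> \<psi> f t \<circ> fderiv (snd \<phi> \<circ> chart_inv \<phi>') (snd \<phi>' t))"
proof -
  obtain W where W: "open W" "t \<in> W" "W \<subseteq> fst \<phi>" "f ` W \<subseteq> fst \<psi>"
    by (rule smooth_at_charts[OF f \<phi> \<psi>]) blast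
  let ?S = "snd \<phi>' ` (fst \<phi>' \<inter> W)"
  let ?m = "snd \<psi>' \<circ> chart_inv \<psi>" and ?g = "snd \<psi> \<circ> f \<circ> chart_inv \<phi>" and ?t = "snd \<phi> \<circ> chart_inv \<phi>'"
  note invT = smooth_atlas_chart(5)[OF AT] and invM = smooth_atlas_chart(5)[OF AM]
  have S: "open ?S" "snd \<phi>' t \<in> ?S" using smooth_atlas_open_image[OF AT \<phi>'(1) W(1)] W(2) \<phi>' by auto
  have eq: "(snd \<psi>' \<circ> f \<circ> chart_inv \<phi>') y = (?m \<circ> (?g \<circ> ?t)) y" if "y \<in> ?S" for y
    using that W invT[OF \<phi>(1)] invT[OF \<phi>'(1)] invM[OF \<psi>(1)]
    by (auto simp: image_subset_iff subset_iff)
  have t: "?t (snd \<phi>' t) = snd \<phi> t" and g: "?g (snd \<phi> t) = snd \<psi> (f t)"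
    using invT \<phi> \<phi>' by auto
  have dt: "?t differentiable (at (snd \<phi>' t))"
    by (rule transition_differentiable[OF AT \<phi>'(1) \<phi>(1) \<phi>'(2) \<phi>(2)])
  have dg: "?g differentiable (at (?t (snd \<phi>' t)))"
    unfolding t by (rule smooth_at_differentiable[OF f \<phi> \<psi>])
  have dm: "?m differentiable (at ((?g \<circ> ?t) (snd \<phi>' t)))"
    using transition_differentiable[OF AM \<psi>(1) \<psi>'(1) \<psi>(2) \<psi>'(2)] t g by simp
  have "fderiv (?m \<circ> (?g \<circ> ?t)) (snd \<phi>' t) =
     fderiv ?m ((?g \<circ> ?t) (snd \<phi>' t)) \<circ>
       (fderiv ?g (?t (snd \<phi>' t)) \<circ> fderiv ?t (snd \<phi>' t))"
    by (simp only: frechet_derivative_compose[OF differentiable_chain_at[OF dt dg] dm]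
         frechet_derivative_compose[OF dt dg])
  moreover have "(?g \<circ> ?t) (snd \<phi>' t) = snd \<psi> (f t)" using t g by simp
  ultimately show ?thesis
    unfolding jet_deriv_def using frechet_derivative_cong_open[OF S eq] t by (simp only:)
qed

lemma jet_of_jet_deriv: "JO f t = (t, {g. smooth_at g t \<and> g t = f t \<and>
    (\<forall>\<phi>\<in>AT. \<forall>\<psi>\<in>AM. t \<in> fst \<phi> \<and> f t \<in> fst \<psi> \<longrightarrow> jet_deriv \<phi> \<psi> g t = jet_deriv \<phi> \<psi> f t)})"
  by (simp add: jet_of_def jet_deriv_def)

text \<open>The definition of a jet compares derivatives in all pairs of charts; by the chain rule
  agreement in one pair spreads to all others.\<close>

lemma jet_of_eqI:
  assumes f: "smooth_at f t" and g: "smooth_at g t" and \<phi>: "\<phi> \<in> AT" "t \<in> fst \<phi>"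
    and \<psi>: "\<psi> \<in> AM" "f t \<in> fst \<psi>" and eq: "g t = f t" "jet_deriv \<phi> \<psi> g t = jet_deriv \<phi> \<psi> f t"
  shows "JO g t = JO f t"
proof -
  have "jet_deriv \<phi>' \<psi>' g t = jet_deriv \<phi>' \<psi>' f t"
    if "\<phi>' \<in> AT" "\<psi>' \<in> AM" "t \<in> fst \<phi>'" "f t \<in> fst \<psi>'" for \<phi>' \<psi>'
    using jet_deriv_change_charts[OF f \<phi> \<psi> that(1,3,2,4)]
      jet_deriv_change_charts[OF g \<phi> \<psi>(1) _ that(1,3,2)] eq \<psi> that by simp
  then show ?thesis unfolding jet_of_jet_deriv using eq(1) by auto
qed

text \<open>The chosen representative need not be \<open>f\<close> itself; value and first
  derivatives, the only data used by the charts, are the same.\<close>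

lemma jet_rep_jet_of:
  assumes f: "smooth_at f t"
  shows "smooth_at (jet_rep (JO f t)) t" "jet_rep (JO f t) t = f t"
    "\<phi> \<in> AT \<Longrightarrow> \<psi> \<in> AM \<Longrightarrow> t \<in> fst \<phi> \<Longrightarrow> f t \<in> fst \<psi> \<Longrightarrow>
      jet_deriv \<phi> \<psi> (jet_rep (JO f t)) t = jet_deriv \<phi> \<psi> f t"
proof -
  have "f \<in> snd (JO f t)" using f by (simp add: jet_of_jet_deriv)
  then have "jet_rep (JO f t) \<in> snd (JO f t)" unfolding jet_rep_def
    by (rule someI[where P = "\<lambda>g. g \<in> snd (JO f t)"])
  then show "smooth_at (jet_rep (JO f t)) t" "jet_rep (JO f t) t = f t"
    "\<phi> \<in> AT \<Longrightarrow> \<psi> \<in> AM \<Longrightarrow> t \<in> fst \<phi> \<Longrightarrow> f t \<in> fst \<psi> \<Longrightarrow>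
      jet_deriv \<phi> \<psi> (jet_rep (JO f t)) t = jet_deriv \<phi> \<psi> f t"
    by (simp_all add: jet_of_jet_deriv)
qed

lemma fst_jet_of [simp]: "fst (JO f t) = t"
  by (simp add: jet_of_def)

lemma jet_target_jet_of: "smooth_at f t \<Longrightarrow> jet_target (JO f t) = f t"
  by (simp add: jet_target_def jet_rep_jet_of)

lemma jet_of_in_jet_space: "smooth_at f t \<Longrightarrow> JO f t \<in> JS"
  by (auto simp: jet_space_def)

lemma jet_of_jet_rep:
  assumes "p \<in> JS"
  shows "smooth_at (jet_rep p) (fst p)" "JO (jet_rep p) (fst p) = p"
proof -
  obtain f t where p: "p = JO f t" and f: "smooth_at f t" using assms by (auto simp: jet_space_def)
  obtain \<phi> where \<phi>: "\<phi> \<in> AT" "t \<in> fst \<phi>" using AT by (rule smooth_atlas_cover)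
  obtain \<psi> where \<psi>: "\<psi> \<in> AM" "f t \<in> fst \<psi>" using AM by (rule smooth_atlas_cover)
  show "smooth_at (jet_rep p) (fst p)" using jet_rep_jet_of(1)[OF f] p by simp
  show "JO (jet_rep p) (fst p) = p"
    unfolding p fst_jet_of using jet_rep_jet_of[OF f] \<phi> \<psi> by (intro jet_of_eqI[OF f _ \<phi> \<psi>]) auto
qed

section \<open>Charts of the jet space and their transition maps\<close>

lemma jet_chart_domain:
  "p \<in> fst (JC (\<phi>, \<psi>)) \<longleftrightarrow> p \<in> JS \<and> fst p \<in> fst \<phi> \<and> jet_target p \<in> fst \<psi>"
  by (simp add: jet_chart_def)

lemma jet_chart_apply:
  "snd (JC (\<phi>, \<psi>)) p = (snd \<phi> (fst p), snd \<psi> (jet_target p), matrix (jet_deriv \<phi> \<psi> (jet_rep p) (fst p)))"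
  by (simp add: jet_chart_def jet_deriv_def matrix_def)

lemma jet_chart_jet_of:
  assumes "smooth_at f t" "\<phi> \<in> AT" "t \<in> fst \<phi>" "\<psi> \<in> AM" "f t \<in> fst \<psi>"
  shows "snd (JC (\<phi>, \<psi>)) (JO f t) = (snd \<phi> t, snd \<psi> (f t), matrix (jet_deriv \<phi> \<psi> f t))"
  using assms by (simp add: jet_chart_apply jet_target_jet_of jet_rep_jet_of)

lemma matrix_eq_iff_linear:
  fixes L L' :: "real ^ 'a::finite \<Rightarrow> real ^ 'b::finite"
  assumes "linear L" "linear L'" "matrix L = matrix L'" shows "L = L'"
  using matrix_vector_mul(2)[OF assms(1)] matrix_vector_mul(2)[OF assms(2)] assms(3) by metis

text \<open>The first two blocks fix source and target. The third fixes the derivative, since a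
  linear map is determined by its matrix, and one pair of charts decides equality of jets.\<close>

lemma inj_on_jet_chart:
  assumes \<phi>: "\<phi> \<in> AT" and \<psi>: "\<psi> \<in> AM"
  shows "inj_on (snd (JC (\<phi>, \<psi>))) (fst (JC (\<phi>, \<psi>)))"
proof (rule inj_onI)
  fix p q assume p: "p \<in> fst (JC (\<phi>, \<psi>))" and q: "q \<in> fst (JC (\<phi>, \<psi>))"
    and eq: "snd (JC (\<phi>, \<psi>)) p = snd (JC (\<phi>, \<psi>)) q"
  note p' = p[unfolded jet_chart_domain] and q' = q[unfolded jet_chart_domain]
  have t: "fst p = fst q" using eq p' q' smooth_atlas_inj[OF AT \<phi>] by (auto simp: jet_chart_apply dest: inj_onD)
  have m: "jet_target p = jet_target q"
    using eq p' q' smooth_atlas_inj[OF AM \<psi>] by (auto simp: jet_chart_apply dest: inj_onD)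
  have sp: "smooth_at (jet_rep p) (fst p)" and sq: "smooth_at (jet_rep q) (fst p)"
    using p' q' jet_of_jet_rep(1)[of p] jet_of_jet_rep(1)[of q] t by simp_all
  have mp: "jet_rep p (fst p) = jet_rep q (fst p)" using m t by (simp add: jet_target_def)
  have ip: "jet_rep p (fst p) \<in> fst \<psi>" "jet_rep q (fst p) \<in> fst \<psi>"
    using p' q' t by (auto simp: jet_target_def)
  have "jet_deriv \<phi> \<psi> (jet_rep p) (fst p) = jet_deriv \<phi> \<psi> (jet_rep q) (fst p)"
    using eq t p' ip sp sq
    by (intro matrix_eq_iff_linear linear_jet_deriv \<phi> \<psi>) (auto simp: jet_chart_apply)
  then have "JO (jet_rep p) (fst p) = JO (jet_rep q) (fst p)"
    using p' ip mp by (intro jet_of_eqI[OF sq sp \<phi> _ \<psi>]) auto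
  then show "p = q" using jet_of_jet_rep(2)[of p] jet_of_jet_rep(2)[of q] p' q' t by metis
qed

text \<open>Every matrix occurs as a Jacobian: the jet is that of a map which is affine in the
  charts, with linear part \<open>V\<close>.\<close>

lemma jet_with_coordinates:
  assumes \<phi>: "\<phi> \<in> AT" "t \<in> fst \<phi>" and \<psi>: "\<psi> \<in> AM" "m \<in> fst \<psi>"
  obtains p where "p \<in> fst (JC (\<phi>, \<psi>))" "fst p = t" "jet_target p = m"
    "snd (JC (\<phi>, \<psi>)) p = (snd \<phi> t, snd \<psi> m, V)"
proof -
  let ?a = "snd \<phi> t" and ?b = "snd \<psi> m"
  define h where "h y = ?b + V *v (y - ?a)" for y
  define f where "f s = chart_inv \<psi> (h (snd \<phi> s))" for s
  note invT = smooth_atlas_chart(5)[OF AT \<phi>(1)] and invM = smooth_atlas_chart(5)[OF AM \<psi>(1)]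
  have h: "continuous_on UNIV h" unfolding h_def
    by (intro continuous_intros bounded_linear.continuous_on[OF matrix_vector_mul_bounded_linear])
  \<comment> \<open>The affine map may leave the image of the target chart, where
    \<open>chart_inv\<close> has no meaning, so it is used only where it stays inside.\<close>
  define W where "W = fst \<phi> \<inter> (h \<circ> snd \<phi>) -` (snd \<psi> ` fst \<psi>)"
  have "continuous_on (fst \<phi>) (h \<circ> snd \<phi>)"
    using smooth_atlas_chart(3)[OF AT \<phi>(1)] continuous_on_subset[OF h] by (intro continuous_on_compose) auto
  then have W: "open W" unfolding W_def
    using smooth_atlas_chart(1)[OF AT \<phi>(1)] smooth_atlas_chart(2)[OF AM \<psi>(1)] by (rule continuous_open_preimage)
  have ft: "f t = m" using invM \<psi> by (simp add: f_def h_def)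
  have tW: "t \<in> W" using \<phi> \<psi> by (auto simp: W_def h_def)
  have eq: "(snd \<psi> \<circ> f \<circ> chart_inv \<phi>) y = h y" if "y \<in> snd \<phi> ` W" for y
    using that invT invM by (auto simp: W_def f_def)
  have o: "open (snd \<phi> ` W)"
    using smooth_atlas_open_image[OF AT \<phi>(1) W] by (simp add: W_def Int_absorb1)
  have bl: "bounded_linear ((*v) V)" by (rule matrix_vector_mul_bounded_linear)
  have "smooth_on (snd \<phi> ` W) h"
    unfolding h_def using o by (intro smooth_on_add smooth_on_linear[OF _ bl] smooth_on_diff) auto
  then have "smooth_on (snd \<phi> ` W) (snd \<psi> \<circ> f \<circ> chart_inv \<phi>)"
    using smooth_on_cong[OF o, of "snd \<psi> \<circ> f \<circ> chart_inv \<phi>" h] eq by simp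
  moreover have "f ` W \<subseteq> fst \<psi>" using invM by (auto simp: W_def f_def)
  ultimately have f: "smooth_at f t"
    unfolding smooth_map_near_def using \<phi> \<psi> W tW
    by (intro bexI[of _ \<phi>] bexI[of _ \<psi>] exI[of _ W]) (auto simp: W_def)
  have D: "(h has_derivative (\<lambda>v. V *v v)) (at ?a)"
    unfolding h_def
    by (auto intro!: derivative_eq_intros bounded_linear.has_derivative[OF bl])
  have "jet_deriv \<phi> \<psi> f t = fderiv h ?a"
    unfolding jet_deriv_def by (rule frechet_derivative_cong_open[OF o _ eq]) (use tW in auto)
  also have "\<dots> = (*v) V" using D by (metis frechet_derivative_at)
  finally have "matrix (jet_deriv \<phi> \<psi> f t) = V" by simp
  then show ?thesis
    using that[of "JO f t"] f \<phi> \<psi> ft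
    by (simp add: jet_chart_jet_of jet_chart_domain jet_of_in_jet_space jet_target_jet_of)
qed

text \<open>The fibre coordinates are unrestricted, so images of such boxes are products. Openness
  of chart overlaps in the jet space then follows from openness on the two base manifolds.\<close>

lemma jet_chart_image:
  assumes \<phi>: "\<phi> \<in> AT" and \<psi>: "\<psi> \<in> AM"
  shows "snd (JC (\<phi>, \<psi>)) ` ({p \<in> JS. fst p \<in> U \<and> jet_target p \<in> V} \<inter> fst (JC (\<phi>, \<psi>))) =
    snd \<phi> ` (fst \<phi> \<inter> U) \<times> snd \<psi> ` (fst \<psi> \<inter> V) \<times> UNIV" (is "?f ` ?S = ?R")
proof
  show "?f ` ?S \<subseteq> ?R" by (auto simp: jet_chart_domain jet_chart_apply)
  show "?R \<subseteq> ?f ` ?S"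
  proof
    fix z assume "z \<in> ?R"
    then obtain t m X where z: "z = (snd \<phi> t, snd \<psi> m, X)" "t \<in> fst \<phi>" "t \<in> U" "m \<in> fst \<psi>" "m \<in> V"
      by auto
    obtain p where "p \<in> fst (JC (\<phi>, \<psi>))" "fst p = t" "jet_target p = m"
      "snd (JC (\<phi>, \<psi>)) p = (snd \<phi> t, snd \<psi> m, X)"
      using jet_with_coordinates[OF \<phi> z(2) \<psi> z(4), of X] .
    then show "z \<in> ?f ` ?S" using z by (intro image_eqI[of _ _ p]) (auto simp: jet_chart_domain)
  qed
qed

lemma jet_atlas_iff: "c \<in> E \<longleftrightarrow> (\<exists>\<phi>\<in>AT. \<exists>\<psi>\<in>AM. c = JC (\<phi>, \<psi>))"
  by (auto simp: jet_atlas_def)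

lemma carrier_of_jet_atlas: "carrier_of E = JS"
proof
  show "carrier_of E \<subseteq> JS"
    by (auto simp: carrier_of_def jet_atlas_def jet_chart_domain)
  show "JS \<subseteq> carrier_of E"
  proof
    fix p assume p: "p \<in> JS"
    obtain \<phi> where "\<phi> \<in> AT" "fst p \<in> fst \<phi>" using AT by (rule smooth_atlas_cover)
    moreover obtain \<psi> where "\<psi> \<in> AM" "jet_target p \<in> fst \<psi>" using AM by (rule smooth_atlas_cover)
    ultimately show "p \<in> carrier_of E" using p by (force simp: carrier_of_def jet_atlas_def jet_chart_domain)
  qed
qed

lemma jet_atlas_open_box:
  assumes "open U" "open V"
  shows "atlas_open E {p \<in> JS. fst p \<in> U \<and> jet_target p \<in> V}"
  unfolding atlas_open_def carrier_of_jet_atlas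
proof (intro conjI ballI)
  fix c assume "c \<in> E"
  then obtain \<phi> \<psi> where c: "\<phi> \<in> AT" "\<psi> \<in> AM" "c = JC (\<phi>, \<psi>)" by (auto simp: jet_atlas_iff)
  show "open (snd c ` ({p \<in> JS. fst p \<in> U \<and> jet_target p \<in> V} \<inter> fst c))"
    unfolding c(3) jet_chart_image[OF c(1,2)]
    by (intro open_Times smooth_atlas_open_image[OF AT c(1) assms(1)]
      smooth_atlas_open_image[OF AM c(2) assms(2)] open_UNIV)
qed auto

text \<open>The last block is the rule for \<open>x\<^sup>i\<^sub>\<alpha>\<close> in matrix form.
  The Jacobian of the inverse change of \<open>t\<close> comes from the reverse transition map at
  the new coordinates, so no matrix has to be inverted.\<close>

definition jet_transition where
  "jet_transition \<phi> \<psi> \<phi>' \<psi>' = (\<lambda>(a, b, V).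
     ((snd \<phi>' \<circ> chart_inv \<phi>) a, (snd \<psi>' \<circ> chart_inv \<psi>) b,
      matrix (fderiv (snd \<psi>' \<circ> chart_inv \<psi>) b) **
        (V ** matrix (fderiv (snd \<phi> \<circ> chart_inv \<phi>') ((snd \<phi>' \<circ> chart_inv \<phi>) a)))))"

lemma jet_chart_change:
  assumes \<phi>: "\<phi> \<in> AT" and \<psi>: "\<psi> \<in> AM" and \<phi>': "\<phi>' \<in> AT" and \<psi>': "\<psi>' \<in> AM"
    and p: "p \<in> fst (JC (\<phi>, \<psi>))" "p \<in> fst (JC (\<phi>', \<psi>'))"
  shows "snd (JC (\<phi>', \<psi>')) p = jet_transition \<phi> \<psi> \<phi>' \<psi>' (snd (JC (\<phi>, \<psi>)) p)"
proof -
  note d = p[unfolded jet_chart_domain jet_target_def]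
  let ?f = "jet_rep p" and ?t = "fst p"
  have f: "smooth_at ?f ?t" using d jet_of_jet_rep by blast
  let ?Dm = "fderiv (snd \<psi>' \<circ> chart_inv \<psi>) (snd \<psi> (?f ?t))"
  let ?Dt = "fderiv (snd \<phi> \<circ> chart_inv \<phi>') (snd \<phi>' ?t)"
  have "jet_deriv \<phi>' \<psi>' ?f ?t = ?Dm \<circ> (jet_deriv \<phi> \<psi> ?f ?t \<circ> ?Dt)"
    using d by (intro jet_deriv_change_charts f \<phi> \<psi> \<phi>' \<psi>') auto
  moreover have "linear ?Dm" "linear ?Dt"
    using transition_differentiable[OF AM \<psi> \<psi>'] transition_differentiable[OF AT \<phi>' \<phi>] d
    by (auto intro: linear_frechet_derivative)
  moreover have "linear (jet_deriv \<phi> \<psi> ?f ?t)" using d by (intro linear_jet_deriv f \<phi> \<psi>) auto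
  ultimately have "matrix (jet_deriv \<phi>' \<psi>' ?f ?t) = matrix ?Dm ** (matrix (jet_deriv \<phi> \<psi> ?f ?t) ** matrix ?Dt)"
    by (simp add: matrix_compose linear_compose)
  then show ?thesis
    using d smooth_atlas_chart(5)[OF AT \<phi>] smooth_atlas_chart(5)[OF AM \<psi>]
    by (simp add: jet_chart_apply jet_transition_def jet_target_def)
qed

lemma jet_overlap:
  assumes "\<phi> \<in> AT" "\<psi> \<in> AM"
  shows "snd (JC (\<phi>, \<psi>)) ` (fst (JC (\<phi>, \<psi>)) \<inter> fst (JC (\<phi>', \<psi>'))) =
     snd \<phi> ` (fst \<phi> \<inter> fst \<phi>') \<times> snd \<psi> ` (fst \<psi> \<inter> fst \<psi>') \<times> UNIV"
proof -
  have "fst (JC (\<phi>, \<psi>)) \<inter> fst (JC (\<phi>', \<psi>')) =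
    {p \<in> JS. fst p \<in> fst \<phi>' \<and> jet_target p \<in> fst \<psi>'} \<inter> fst (JC (\<phi>, \<psi>))"
    by (auto simp: jet_chart_domain)
  then show ?thesis using jet_chart_image[OF assms] by simp
qed

text \<open>Entrywise the last block is a sum of products of first derivatives of the base
  transitions with fibre coordinates. The derivatives of the inverse change of \<open>t\<close> are
  smooth functions composed with the forward change.\<close>

lemma smooth_on_jet_transition:
  assumes \<phi>: "\<phi> \<in> AT" and \<psi>: "\<psi> \<in> AM" and \<phi>': "\<phi>' \<in> AT" and \<psi>': "\<psi>' \<in> AM"
  shows "smooth_on (snd \<phi> ` (fst \<phi> \<inter> fst \<phi>') \<times> snd \<psi> ` (fst \<psi> \<inter> fst \<psi>') \<times> UNIV)
    (jet_transition \<phi> \<psi> \<phi>' \<psi>')"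
proof -
  let ?T = "snd \<phi> ` (fst \<phi> \<inter> fst \<phi>')" and ?T' = "snd \<phi>' ` (fst \<phi>' \<inter> fst \<phi>)"
  let ?X = "snd \<psi> ` (fst \<psi> \<inter> fst \<psi>')"
  let ?S = "?T \<times> ?X \<times> (UNIV :: (real ^ 'p ^ 'n) set)"
  let ?\<theta> = "snd \<phi>' \<circ> chart_inv \<phi>" and ?\<xi> = "snd \<psi>' \<circ> chart_inv \<psi>" and ?\<theta>' = "snd \<phi> \<circ> chart_inv \<phi>'"
  have o: "open ?T" "open ?T'" "open ?X"
    by (intro smooth_atlas_open_image[OF AT] smooth_atlas_open_image[OF AM]
      smooth_atlas_chart(1)[OF AT] smooth_atlas_chart(1)[OF AM] assms)+
  then have S: "open ?S" by (intro open_Times) auto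
  have \<theta>: "smooth_on ?S (?\<theta> \<circ> fst)"
    by (rule smooth_on_compose[OF S o(1) smooth_on_fst[OF S] smooth_atlas_transition[OF AT \<phi> \<phi>']]) auto
  have snd1: "smooth_on ?S (\<lambda>z. fst (snd z))" "smooth_on ?S (\<lambda>z. snd (snd z))"
    by (rule smooth_on_linear[OF S bounded_linear_fst smooth_on_snd[OF S]]
        smooth_on_linear[OF S bounded_linear_snd smooth_on_snd[OF S]])+
  have \<xi>: "smooth_on ?S (?\<xi> \<circ> (\<lambda>z. fst (snd z)))"
    by (rule smooth_on_compose[OF S o(3) snd1(1) smooth_atlas_transition[OF AM \<psi> \<psi>']]) auto
  have M1: "smooth_on ?S ((\<lambda>b. fderiv ?\<xi> b v) \<circ> (\<lambda>z. fst (snd z)))" for v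
    by (rule smooth_on_compose[OF S o(3) snd1(1)
      smooth_on_frechet_derivative[OF smooth_atlas_transition[OF AM \<psi> \<psi>']]]) auto
  have M2: "smooth_on ?S ((\<lambda>a. fderiv ?\<theta>' a v) \<circ> (?\<theta> \<circ> fst))" for v
    by (rule smooth_on_compose[OF S o(2) \<theta>
      smooth_on_frechet_derivative[OF smooth_atlas_transition[OF AT \<phi>' \<phi>]]])
      (use smooth_atlas_chart(5)[OF AT \<phi>] in auto)
  have entry: "smooth_on ?S (\<lambda>z. \<Sum>k\<in>UNIV. fderiv ?\<xi> (fst (snd z)) (axis k 1) $ i *
      (\<Sum>l\<in>UNIV. snd (snd z) $ k $ l * fderiv ?\<theta>' (?\<theta> (fst z)) (axis j 1) $ l))" for i j
  proof (intro smooth_on_sum smooth_on_mult S)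
    show "smooth_on ?S (\<lambda>z. fderiv ?\<xi> (fst (snd z)) (axis k 1) $ i)" for k
      using smooth_on_linear[OF S bounded_linear_vec_nth M1] by (simp add: o_def)
    show "smooth_on ?S (\<lambda>z. snd (snd z) $ k $ l)" for k l
      by (rule smooth_on_linear[OF S bounded_linear_vec_nth smooth_on_linear[OF S bounded_linear_vec_nth snd1(2)]])
    show "smooth_on ?S (\<lambda>z. fderiv ?\<theta>' (?\<theta> (fst z)) (axis j 1) $ l)" for l
      using smooth_on_linear[OF S bounded_linear_vec_nth M2] by (simp add: o_def)
  qed
  have "smooth_on ?S (\<lambda>z. matrix (fderiv ?\<xi> (fst (snd z))) **
        (snd (snd z) ** matrix (fderiv ?\<theta>' (?\<theta> (fst z)))))"
  proof (rule smooth_on_euclidean[OF S])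
    fix b :: "real ^ 'p ^ 'n" assume "b \<in> Basis"
    then obtain i j where b: "b = axis i (axis j 1)" by (auto simp: Basis_vec_def)
    show "smooth_on ?S (\<lambda>z. (matrix (fderiv ?\<xi> (fst (snd z))) **
        (snd (snd z) ** matrix (fderiv ?\<theta>' (?\<theta> (fst z))))) \<bullet> b)"
      using entry[of i j] by (simp add: b inner_axis matrix_matrix_mult_def matrix_def)
  qed
  then have "smooth_on ?S (\<lambda>z. (?\<theta> (fst z), ?\<xi> (fst (snd z)), matrix (fderiv ?\<xi> (fst (snd z))) **
        (snd (snd z) ** matrix (fderiv ?\<theta>' (?\<theta> (fst z))))))"
    using \<theta> \<xi> S by (intro smooth_on_Pair) (auto simp: o_def)
  then show ?thesis by (simp add: jet_transition_def case_prod_unfold)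
qed

sublocale compatible_charts E
proof
  fix c assume "c \<in> E"
  then show "inj_on (snd c) (fst c)" using inj_on_jet_chart by (auto simp: jet_atlas_iff)
next
  fix c c' assume "c \<in> E" "c' \<in> E"
  then obtain \<phi> \<psi> \<phi>' \<psi>' where c: "\<phi> \<in> AT" "\<psi> \<in> AM" "\<phi>' \<in> AT" "\<psi>' \<in> AM" "c = JC (\<phi>, \<psi>)" "c' = JC (\<phi>', \<psi>')"
    by (auto simp: jet_atlas_iff)
  show o: "open (snd c ` (fst c \<inter> fst c'))"
    unfolding c(5,6) jet_overlap[OF c(1,2)]
    by (intro open_Times smooth_atlas_open_image[OF AT] smooth_atlas_open_image[OF AM]
      smooth_atlas_chart(1)[OF AT] smooth_atlas_chart(1)[OF AM] c open_UNIV)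
  have inv: "chart_inv c (snd c p) = p" if "p \<in> fst c" for p
    using inj_on_jet_chart[OF c(1,2)] that by (simp add: chart_inv_def c)
  have "jet_transition \<phi> \<psi> \<phi>' \<psi>' z = (snd c' \<circ> chart_inv c) z" if "z \<in> snd c ` (fst c \<inter> fst c')" for z
    using that jet_chart_change[OF c(1-4)] inv by (auto simp: c(5,6))
  then show "smooth_on (snd c ` (fst c \<inter> fst c')) (snd c' \<circ> chart_inv c)"
    using smooth_on_cong[OF o, of "jet_transition \<phi> \<psi> \<phi>' \<psi>'" "snd c' \<circ> chart_inv c"]
      smooth_on_jet_transition[OF c(1-4)] by (simp add: c(5,6) jet_overlap[OF c(1,2)])
qed

text \<open>Jets with different sources or targets are separated in a base manifold. Jets with the
  same source and target lie in a common chart, where injectivity reduces the question to Euclidean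
  space.\<close>

sublocale smooth_charts E
proof
  fix p q assume pq: "p \<in> carrier_of E" "q \<in> carrier_of E" "p \<noteq> q"
  then have J: "p \<in> JS" "q \<in> JS" by (auto simp: carrier_of_jet_atlas)
  consider "fst p \<noteq> fst q" | "jet_target p \<noteq> jet_target q" | "fst p = fst q" "jet_target p = jet_target q" by blast
  then show "\<exists>U V. atlas_open E U \<and> atlas_open E V \<and> p \<in> U \<and> q \<in> V \<and> U \<inter> V = {}"
  proof cases
    case 1
    then obtain U V where "open U" "open V" "fst p \<in> U" "fst q \<in> V" "U \<inter> V = {}"
      using hausdorff by metis
    then show ?thesis using J jet_atlas_open_box[of U UNIV] jet_atlas_open_box[of V UNIV]
      by (intro exI[of _ "{p \<in> JS. fst p \<in> U \<and> jet_target p \<in> UNIV}"]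
        exI[of _ "{p \<in> JS. fst p \<in> V \<and> jet_target p \<in> UNIV}"]) auto
  next
    case 2
    then obtain U V where "open U" "open V" "jet_target p \<in> U" "jet_target q \<in> V" "U \<inter> V = {}"
      using hausdorff by metis
    then show ?thesis using J jet_atlas_open_box[of UNIV U] jet_atlas_open_box[of UNIV V]
      by (intro exI[of _ "{p \<in> JS. fst p \<in> UNIV \<and> jet_target p \<in> U}"]
        exI[of _ "{p \<in> JS. fst p \<in> UNIV \<and> jet_target p \<in> V}"]) auto
  next
    case 3
    obtain c where c: "c \<in> E" "p \<in> fst c" using pq(1) by (rule carrierE)
    then have q: "q \<in> fst c" using 3 J by (auto simp: jet_atlas_iff jet_chart_domain)
    have "snd c p \<noteq> snd c q" using inj_chart[OF c(1)] c(2) q pq(3) by (auto dest: inj_onD)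
    then obtain U V where "open U" "open V" "snd c p \<in> U" "snd c q \<in> V" "U \<inter> V = {}"
      using hausdorff by metis
    then show ?thesis using c q atlas_open_preimage[OF c(1), of U] atlas_open_preimage[OF c(1), of V]
      by (intro exI[of _ "{p \<in> fst c. snd c p \<in> U}"] exI[of _ "{p \<in> fst c. snd c p \<in> V}"]) auto
  qed
qed

end

section \<open>Adapted bases and distributions\<close>

lemma sum_sum_delta:
  fixes g :: "'a::finite \<Rightarrow> 'b::finite \<Rightarrow> real"
  shows "(\<Sum>j\<in>UNIV. \<Sum>\<beta>\<in>UNIV. g j \<beta> * (if i = j \<and> \<gamma> = \<beta> then 1 else 0)) = g i \<gamma>"
proof -
  have "(\<Sum>\<beta>\<in>UNIV. g j \<beta> * (if i = j \<and> \<gamma> = \<beta> then 1 else 0)) = (if i = j then g j \<gamma> else 0)" for j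
    by (cases "i = j") (simp_all add: if_distrib[of "\<lambda>x. _ * x"] cong: if_cong)
  then show ?thesis by simp
qed

context jet_bundle
begin

section \<open>Coordinates and coordinate fields on the jet space\<close>

abbreviation "CC \<equiv> AT \<times> AM"
abbreviation "jdom \<equiv> jet_dom AT AM"
abbreviation "ct \<equiv> coord_t AT AM"
abbreviation "cx \<equiv> coord_x AT AM"
abbreviation "cv \<equiv> coord_v AT AM"
abbreviation "dt \<equiv> d_t AT AM"
abbreviation "dx \<equiv> d_x AT AM"
abbreviation "dv \<equiv> d_v AT AM"

lemma jet_chart_in_atlas: "c \<in> CC \<Longrightarrow> JC c \<in> E"
  by (auto simp: jet_atlas_def)

lemma jet_dom_eq: "p \<in> jdom c \<longleftrightarrow> p \<in> fst (JC c)"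
  by (simp add: jet_dom_def)

lemma jet_dom_open: "c \<in> CC \<Longrightarrow> atlas_open E (jdom c)"
  unfolding jet_dom_def using jet_chart_in_atlas atlas_open_chart_domain by blast

lemma jet_dom_cover:
  assumes "p \<in> JS" obtains c where "c \<in> CC" "p \<in> jdom c"
  using assms by (auto simp: carrier_of_def jet_atlas_def jet_dom_def simp flip: carrier_of_jet_atlas)

lemma jet_dom_subset: "c \<in> CC \<Longrightarrow> p \<in> jdom c \<Longrightarrow> p \<in> JS"
  by (cases c) (auto simp: jet_dom_def jet_chart_domain)

lemma bounded_linear_t: "bounded_linear (\<lambda>z::('p, 'n) jet_coords. fst z $ \<alpha>)"
  by (rule bounded_linear_compose[OF bounded_linear_vec_nth bounded_linear_fst])

lemma bounded_linear_x: "bounded_linear (\<lambda>z::('p, 'n) jet_coords. fst (snd z) $ i)"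
  by (rule bounded_linear_compose[OF bounded_linear_vec_nth
    bounded_linear_compose[OF bounded_linear_fst bounded_linear_snd]])

lemma bounded_linear_v: "bounded_linear (\<lambda>z::('p, 'n) jet_coords. snd (snd z) $ i $ \<alpha>)"
  by (rule bounded_linear_compose[OF bounded_linear_vec_nth bounded_linear_compose[OF bounded_linear_vec_nth
    bounded_linear_compose[OF bounded_linear_snd bounded_linear_snd]]])

lemma coord_eq:
  "ct c \<alpha> = (\<lambda>q. fst (snd (JC c) q) $ \<alpha>)"
  "cx c i = (\<lambda>q. fst (snd (snd (JC c) q)) $ i)"
  "cv c i \<alpha> = (\<lambda>q. snd (snd (snd (JC c) q)) $ i $ \<alpha>)"
  by (simp_all add: fun_eq_iff coord_t_def coord_x_def coord_v_def)

lemma coord_smooth: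
  assumes "c \<in> CC"
  shows "smooth_fun E (jdom c) (ct c \<alpha>)" "smooth_fun E (jdom c) (cx c i)" "smooth_fun E (jdom c) (cv c i \<alpha>)"
  unfolding coord_eq jet_dom_def
  by (rule smooth_fun_coordinate[OF jet_chart_in_atlas[OF assms] bounded_linear_t]
      smooth_fun_coordinate[OF jet_chart_in_atlas[OF assms] bounded_linear_x]
      smooth_fun_coordinate[OF jet_chart_in_atlas[OF assms] bounded_linear_v])+

lemma partial_coord:
  assumes "c \<in> CC" "p \<in> jdom c"
  shows "partial E (JC c) v p (ct c \<alpha>) = fst v $ \<alpha>" "partial E (JC c) v p (cx c i) = fst (snd v) $ i"
    "partial E (JC c) v p (cv c i \<alpha>) = snd (snd v) $ i $ \<alpha>"
proof -
  note C = jet_chart_in_atlas[OF assms(1)] assms(2)[unfolded jet_dom_eq]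
  show "partial E (JC c) v p (ct c \<alpha>) = fst v $ \<alpha>" "partial E (JC c) v p (cx c i) = fst (snd v) $ i"
    "partial E (JC c) v p (cv c i \<alpha>) = snd (snd v) $ i $ \<alpha>"
    unfolding coord_eq
    by (rule partial_coordinate[OF C bounded_linear_t] partial_coordinate[OF C bounded_linear_x]
      partial_coordinate[OF C bounded_linear_v])+
qed

lemma coordinate_basis_apply [simp]:
  assumes "c \<in> CC" "p \<in> jdom c"
  shows "dt c \<alpha> p (ct c \<beta>) = (if \<beta> = \<alpha> then 1 else 0)" "dt c \<alpha> p (cx c i) = 0" "dt c \<alpha> p (cv c i \<beta>) = 0"
    "dx c j p (ct c \<beta>) = 0" "dx c j p (cx c i) = (if i = j then 1 else 0)" "dx c j p (cv c i \<beta>) = 0"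
    "dv c j \<alpha> p (ct c \<beta>) = 0" "dv c j \<alpha> p (cx c i) = 0"
    "dv c j \<alpha> p (cv c i \<beta>) = (if i = j \<and> \<beta> = \<alpha> then 1 else 0)"
  unfolding d_t_def d_x_def d_v_def partial_coord[OF assms] by (simp_all add: axis_def)

lemma jet_coords_expansion:
  fixes z :: "('p, 'n) jet_coords"
  shows "z = (\<Sum>\<alpha>\<in>UNIV. (fst z $ \<alpha>) *\<^sub>R (axis \<alpha> 1, 0, 0)) + (\<Sum>i\<in>UNIV. (fst (snd z) $ i) *\<^sub>R (0, axis i 1, 0))
    + (\<Sum>i\<in>UNIV. \<Sum>\<alpha>\<in>UNIV. (snd (snd z) $ i $ \<alpha>) *\<^sub>R (0, 0, axis i (axis \<alpha> 1)))" (is "z = ?a + ?b + ?c")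
proof -
  have axis2: "axis k (axis \<gamma> 1) $ i $ \<alpha> = (if i = k \<and> \<alpha> = \<gamma> then 1 else (0::real))"
    for i k :: 'n and \<alpha> \<gamma> :: 'p
    by (simp add: axis_def)
  have "snd (snd ?c) $ i $ \<alpha> = snd (snd z) $ i $ \<alpha>" for i \<alpha>
    by (simp only: snd_sum sum_component snd_scaleR vector_scaleR_component real_scaleR_def snd_conv
        axis2 sum_sum_delta)
  then show ?thesis
    by (simp add: prod_eq_iff vec_eq_iff fst_sum snd_sum sum_component axis_def if_distrib[of "\<lambda>x. _ * x"] cong: if_cong)
qed

lemma tangent_coordinate_expansion:
  assumes "tangent_at p u" and c: "c \<in> CC" "p \<in> jdom c"
  shows "u = (\<Sum>\<alpha>\<in>UNIV. u (ct c \<alpha>) *\<^sub>T dt c \<alpha> p) + (\<Sum>i\<in>UNIV. u (cx c i) *\<^sub>T dx c i p)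
    + (\<Sum>i\<in>UNIV. \<Sum>\<alpha>\<in>UNIV. u (cv c i \<alpha>) *\<^sub>T dv c i \<alpha> p)"
proof -
  note C = jet_chart_in_atlas[OF c(1)] c(2)[unfolded jet_dom_eq]
  obtain v where v: "u = partial E (JC c) v p" using tangent_at_chartE[OF assms(1) C] .
  note uv = partial_coord[OF c, of v, folded v]
  have "u = partial E (JC c) ((\<Sum>\<alpha>\<in>UNIV. (fst v $ \<alpha>) *\<^sub>R (axis \<alpha> 1, 0, 0)) + (\<Sum>i\<in>UNIV. (fst (snd v) $ i) *\<^sub>R (0, axis i 1, 0))
    + (\<Sum>i\<in>UNIV. \<Sum>\<alpha>\<in>UNIV. (snd (snd v) $ i $ \<alpha>) *\<^sub>R (0, 0, axis i (axis \<alpha> 1)))) p"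
    unfolding v jet_coords_expansion[of v, symmetric] ..
  also have "\<dots> = (\<Sum>\<alpha>\<in>UNIV. u (ct c \<alpha>) *\<^sub>T dt c \<alpha> p) + (\<Sum>i\<in>UNIV. u (cx c i) *\<^sub>T dx c i p)
    + (\<Sum>i\<in>UNIV. \<Sum>\<alpha>\<in>UNIV. u (cv c i \<alpha>) *\<^sub>T dv c i \<alpha> p)"
    by (simp only: partial_add[OF C] partial_sum[OF C] partial_scale[OF C] uv d_t_def d_x_def d_v_def)
  finally show ?thesis .
qed

lemma tangent_eq_coordinates:
  assumes "tangent_at p u" "tangent_at p w" "c \<in> CC" "p \<in> jdom c"
    and "\<And>\<alpha>. u (ct c \<alpha>) = w (ct c \<alpha>)" "\<And>i. u (cx c i) = w (cx c i)" "\<And>i \<alpha>. u (cv c i \<alpha>) = w (cv c i \<alpha>)"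
  shows "u = w"
  using tangent_coordinate_expansion[OF assms(1,3,4)] tangent_coordinate_expansion[OF assms(2,3,4)] assms(5-7)
  by simp

lemma tangent_at_basis:
  assumes "c \<in> CC" "p \<in> jdom c"
  shows "tangent_at p (dt c \<alpha> p)" "tangent_at p (dx c i p)" "tangent_at p (dv c i \<alpha> p)"
  unfolding d_t_def d_x_def d_v_def using assms jet_chart_in_atlas
  by (auto intro!: tangent_at_partial simp: jet_dom_eq)

lemma tangent_at_sum:
  "p \<in> carrier_of E \<Longrightarrow> (\<And>i. i \<in> I \<Longrightarrow> tangent_at p (u i)) \<Longrightarrow> tangent_at p (\<Sum>i\<in>I. u i)"
  by (induction I rule: infinite_finite_induct) (auto intro: tangent_at_add tangent_at_zero)

subsection \<open>Change of coordinates\<close>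

context
  fixes c c' :: "('t, 'm, 'p, 'n) chart_pair" and p
  assumes c: "c \<in> CC" "p \<in> jdom c" and c': "c' \<in> CC" "p \<in> jdom c'"
begin

abbreviation (input) "\<tau> \<equiv> jet_transition (fst c) (snd c) (fst c') (snd c')"
abbreviation (input) "Sov \<equiv> snd (fst c) ` (fst (fst c) \<inter> fst (fst c')) \<times>
  snd (snd c) ` (fst (snd c) \<inter> fst (snd c')) \<times> (UNIV :: (real ^ 'p ^ 'n) set)"

lemma overlap_image: "snd (JC c) ` (fst (JC c) \<inter> fst (JC c')) = Sov"
  using jet_overlap[of "fst c" "snd c" "fst c'" "snd c'"] c(1) by (auto simp: mem_Times_iff)

lemma overlap_open: "open Sov" "snd (JC c) p \<in> Sov"
  using open_overlap[OF jet_chart_in_atlas jet_chart_in_atlas, OF c(1) c'(1)] c(2) c'(2)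
  unfolding overlap_image[symmetric] jet_dom_eq by auto

text \<open>On the overlap the new coordinates are \<open>\<tau>\<close> of the old ones, so the old
  coordinate fields applied to them give the entries of the derivative of
  \<open>\<tau>\<close>.\<close>

lemma partial_coord_change:
  assumes L: "bounded_linear L"
  shows "(L \<circ> \<tau>) differentiable (at (snd (JC c) p))"
    "partial E (JC c) v p (\<lambda>q. L (snd (JC c') q)) = fderiv (L \<circ> \<tau>) (snd (JC c) p) v"
proof -
  note S = overlap_open
  have "smooth_on Sov (\<lambda>z. L (\<tau> z))"
    using c(1) c'(1) by (intro smooth_on_linear[OF S(1) L] smooth_on_jet_transition) auto
  then show "(L \<circ> \<tau>) differentiable (at (snd (JC c) p))"
    using smooth_on_imp_differentiable S(2) by (fastforce simp: o_def)
  have "smooth_near E p (\<lambda>q. L (snd (JC c') q))"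
    using smooth_near_coordinate[OF jet_chart_in_atlas[OF c'(1)] _ L] c'(2) by (simp add: jet_dom_eq)
  then have "partial E (JC c) v p (\<lambda>q. L (snd (JC c') q)) =
    fderiv ((\<lambda>q. L (snd (JC c') q)) \<circ> chart_inv (JC c)) (snd (JC c) p) v"
    by (rule partial_smooth)
  also have "fderiv ((\<lambda>q. L (snd (JC c') q)) \<circ> chart_inv (JC c)) (snd (JC c) p) =
    fderiv (L \<circ> \<tau>) (snd (JC c) p)"
  proof (rule frechet_derivative_cong_open[OF S])
    fix y assume "y \<in> Sov"
    then obtain q where q: "y = snd (JC c) q" "q \<in> fst (JC c)" "q \<in> fst (JC c')"
      unfolding overlap_image[symmetric] by auto
    then show "((\<lambda>q. L (snd (JC c') q)) \<circ> chart_inv (JC c)) y = (L \<circ> \<tau>) y"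
      using jet_chart_change[of "fst c" "snd c" "fst c'" "snd c'" q] c(1) c'(1)
        chart_inv_chart[OF jet_chart_in_atlas[OF c(1)] q(2)] by (simp add: mem_Times_iff)
  qed
  finally show "partial E (JC c) v p (\<lambda>q. L (snd (JC c') q)) = fderiv (L \<circ> \<tau>) (snd (JC c) p) v" .
qed

abbreviation (input) "D\<xi> \<equiv> fderiv (snd (snd c') \<circ> chart_inv (snd c)) (fst (snd (snd (JC c) p)))"
abbreviation (input) "D\<theta> \<equiv> fderiv (snd (fst c') \<circ> chart_inv (fst c)) (fst (snd (JC c) p))"

lemma partial_coord_t_change: "partial E (JC c) v p (ct c' \<alpha>) = D\<theta> (fst v) $ \<alpha>"
proof -
  have "(snd (fst c') \<circ> chart_inv (fst c)) differentiable (at (fst (snd (JC c) p)))"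
    by (rule smooth_on_imp_differentiable[OF smooth_atlas_transition[OF AT]])
      (use c(1) c'(1) overlap_open(2) in \<open>auto simp: mem_Times_iff\<close>)
  then have "((\<lambda>z. (snd (fst c') \<circ> chart_inv (fst c)) (fst z) $ \<alpha>) has_derivative (\<lambda>v. D\<theta> (fst v) $ \<alpha>)) (at (snd (JC c) p))"
    using bounded_linear.has_derivative[OF bounded_linear_vec_nth
      diff_chain_at[OF bounded_linear_imp_has_derivative[OF bounded_linear_fst] has_derivative_frechet]]
    by (fastforce simp: o_def)
  moreover have "(\<lambda>z. fst z $ \<alpha>) \<circ> \<tau> = (\<lambda>z. (snd (fst c') \<circ> chart_inv (fst c)) (fst z) $ \<alpha>)"
    by (auto simp: fun_eq_iff jet_transition_def)
  ultimately show ?thesis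
    unfolding coord_eq partial_coord_change(2)[OF bounded_linear_t] by (simp only: frechet_derivative_eqI)
qed

lemma partial_coord_x_change: "partial E (JC c) v p (cx c' i) = D\<xi> (fst (snd v)) $ i"
proof -
  have "(snd (snd c') \<circ> chart_inv (snd c)) differentiable (at (fst (snd (snd (JC c) p))))"
    by (rule smooth_on_imp_differentiable[OF smooth_atlas_transition[OF AM]])
      (use c(1) c'(1) overlap_open(2) in \<open>auto simp: mem_Times_iff\<close>)
  then have "((\<lambda>z. (snd (snd c') \<circ> chart_inv (snd c)) (fst (snd z)) $ i) has_derivative (\<lambda>v. D\<xi> (fst (snd v)) $ i)) (at (snd (JC c) p))"
    using bounded_linear.has_derivative[OF bounded_linear_vec_nth
      diff_chain_at[OF bounded_linear_imp_has_derivative[OF bounded_linear_compose[OF bounded_linear_fst bounded_linear_snd]] has_derivative_frechet]]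
    by (fastforce simp: o_def)
  moreover have "(\<lambda>z. fst (snd z) $ i) \<circ> \<tau> = (\<lambda>z. (snd (snd c') \<circ> chart_inv (snd c)) (fst (snd z)) $ i)"
    by (auto simp: fun_eq_iff jet_transition_def)
  ultimately show ?thesis
    unfolding coord_eq partial_coord_change(2)[OF bounded_linear_x] by (simp only: frechet_derivative_eqI)
qed

abbreviation (input) "D\<theta>' \<equiv> fderiv (snd (fst c) \<circ> chart_inv (fst c')) (fst (snd (JC c') p))"

text \<open>The new fibre coordinates are affine along a fibre direction, since the Jacobians depend
  on the base point only. Differentiating along the line therefore gives the entry without
  differentiating the Jacobians.\<close>

lemma partial_coord_v_change:
  "partial E (JC c) (0, 0, axis k (axis \<gamma> 1)) p (cv c' j \<beta>) = D\<xi> (axis k 1) $ j * D\<theta>' (axis \<beta> 1) $ \<gamma>"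
proof -
  let ?L = "\<lambda>z::('p, 'n) jet_coords. snd (snd z) $ j $ \<beta>"
  let ?x = "snd (JC c) p" and ?v = "(0, 0, axis k (axis \<gamma> 1)) :: ('p, 'n) jet_coords"
  let ?k = "D\<xi> (axis k 1) $ j * D\<theta>' (axis \<beta> 1) $ \<gamma>"
  have th: "(snd (fst c') \<circ> chart_inv (fst c)) (fst ?x) = fst (snd (JC c') p)"
    using jet_chart_change[of "fst c" "snd c" "fst c'" "snd c'" p] c c'
    by (auto simp: mem_Times_iff jet_dom_eq jet_transition_def case_prod_unfold)
  have lin: "(?L \<circ> \<tau>) (?x + s *\<^sub>R ?v) = (?L \<circ> \<tau>) ?x + ?k * s" for s
  proof -
    have "(\<Sum>k'\<in>UNIV. D\<xi> (axis k' 1) $ j * (\<Sum>l\<in>UNIV. s * axis k (axis \<gamma> 1) $ k' $ l * D\<theta>' (axis \<beta> 1) $ l))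
      = (\<Sum>k'\<in>UNIV. \<Sum>l\<in>UNIV. (s * D\<xi> (axis k' 1) $ j * D\<theta>' (axis \<beta> 1) $ l) * (if k = k' \<and> \<gamma> = l then 1 else 0))"
      by (auto simp: sum_distrib_left axis_def intro!: sum.cong)
    also have "\<dots> = ?k * s" by (simp only: sum_sum_delta) simp
    finally have "(\<Sum>k'\<in>UNIV. D\<xi> (axis k' 1) $ j * (\<Sum>l\<in>UNIV. s * axis k (axis \<gamma> 1) $ k' $ l * D\<theta>' (axis \<beta> 1) $ l)) = ?k * s" .
    then show ?thesis using th
      by (simp add: jet_transition_def case_prod_unfold matrix_matrix_mult_def matrix_def distrib_left distrib_right sum.distrib)
  qed
  have "((\<lambda>s. (?L \<circ> \<tau>) (?x + s *\<^sub>R ?v)) has_real_derivative fderiv (?L \<circ> \<tau>) (?x + 0 *\<^sub>R ?v) ?v) (at 0)"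
    using partial_coord_change(1)[OF bounded_linear_v]
    by (intro has_real_derivative_along_line) (simp only: scaleR_zero_left add_0_right)
  moreover have "((\<lambda>s. (?L \<circ> \<tau>) (?x + s *\<^sub>R ?v)) has_real_derivative ?k) (at 0)"
    unfolding lin by (auto intro!: derivative_eq_intros)
  ultimately have "fderiv (?L \<circ> \<tau>) (?x + 0 *\<^sub>R ?v) ?v = ?k" by (rule DERIV_unique)
  then show ?thesis
    unfolding coord_eq partial_coord_change(2)[OF bounded_linear_v]
    by (simp only: scaleR_zero_left add_0_right)
qed

end

text \<open>The change is triangular, and on the fibres it is the product of two Jacobians. The base
  derivatives of \<open>cv c'\<close> stay unevaluated: they are exactly the inhomogeneous terms of
  the transformation rules.\<close>

lemma coordinate_change:
  assumes c: "c \<in> CC" "p \<in> jdom c" and c': "c' \<in> CC" "p \<in> jdom c'"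
  shows "dt c \<alpha> p (cx c' j) = 0" "dx c i p (ct c' \<beta>) = 0" "dv c i \<alpha> p (ct c' \<beta>) = 0" "dv c i \<alpha> p (cx c' j) = 0"
    "dv c k \<gamma> p (cv c' j \<beta>) = dx c k p (cx c' j) * dt c' \<beta> p (ct c \<gamma>)"
proof -
  have [simp]: "linear (fderiv (snd (snd c') \<circ> chart_inv (snd c)) (fst (snd (snd (JC c) p))))"
    by (rule linear_frechet_derivative, rule smooth_on_imp_differentiable[OF smooth_atlas_transition[OF AM]])
      (use c(1) c'(1) overlap_open(2)[OF c c'] in \<open>auto simp: mem_Times_iff\<close>)
  have [simp]: "linear (fderiv (snd (fst c') \<circ> chart_inv (fst c)) (fst (snd (JC c) p)))"
    by (rule linear_frechet_derivative, rule smooth_on_imp_differentiable[OF smooth_atlas_transition[OF AT]])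
      (use c(1) c'(1) overlap_open(2)[OF c c'] in \<open>auto simp: mem_Times_iff\<close>)
  show "dt c \<alpha> p (cx c' j) = 0" "dx c i p (ct c' \<beta>) = 0" "dv c i \<alpha> p (ct c' \<beta>) = 0" "dv c i \<alpha> p (cx c' j) = 0"
    unfolding d_t_def d_x_def d_v_def partial_coord_t_change[OF c c'] partial_coord_x_change[OF c c']
    by (simp_all add: linear_0)
  show "dv c k \<gamma> p (cv c' j \<beta>) = dx c k p (cx c' j) * dt c' \<beta> p (ct c \<gamma>)"
    unfolding d_t_def d_x_def d_v_def partial_coord_v_change[OF c c'] partial_coord_x_change[OF c c']
      partial_coord_t_change[OF c' c] by simp
qed

end

subsection \<open>Distributions and projections\<close>

locale nonlinear_jet_bundle = jet_bundle AT AM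
  for AT :: "('t::t2_space, real ^ 'p::finite) chart set"
    and AM :: "('m::t2_space, real ^ 'n::finite) chart set" +
  fixes M :: "('t, 'm, 'p, 'n) coeffs_t" and N :: "('t, 'm, 'p, 'n) coeffs_x"
  assumes NC: "nonlinear_connection AT AM M N"
begin

abbreviation "et \<equiv> delta_t AT AM M"
abbreviation "ex \<equiv> delta_x AT AM N"
abbreviation "h_T \<equiv> proj_t AT AM M N"
abbreviation "h_M \<equiv> proj_x AT AM M N"
abbreviation "h_V \<equiv> proj_v AT AM M N"
abbreviation "DT \<equiv> dist_t AT AM M"
abbreviation "DX \<equiv> dist_x AT AM N"
abbreviation "DV \<equiv> dist_v AT AM"

lemma coeffs_smooth:
  "c \<in> CC \<Longrightarrow> smooth_fun E (jdom c) (M c i \<alpha> \<beta>)" "c \<in> CC \<Longrightarrow> smooth_fun E (jdom c) (N c i \<alpha> j)"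
  using NC unfolding nonlinear_connection_def by blast+

lemma transformation_rules:
  assumes "c \<in> CC" "c' \<in> CC" "p \<in> jdom c" "p \<in> jdom c'"
  shows "(\<Sum>\<mu>\<in>UNIV. M c' j \<beta> \<mu> p * dt c \<alpha> p (ct c' \<mu>)) =
      (\<Sum>k\<in>UNIV. \<Sum>\<gamma>\<in>UNIV. M c k \<gamma> \<alpha> p * dx c k p (cx c' j) * dt c' \<beta> p (ct c \<gamma>)) - dt c \<alpha> p (cv c' j \<beta>)"
    "(\<Sum>k\<in>UNIV. N c' j \<beta> k p * dx c i p (cx c' k)) =
      (\<Sum>k\<in>UNIV. \<Sum>\<gamma>\<in>UNIV. N c k \<gamma> i p * dx c k p (cx c' j) * dt c' \<beta> p (ct c \<gamma>)) - dx c i p (cv c' j \<beta>)"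
  using NC assms unfolding nonlinear_connection_def by blast+

lemma delta_at:
  "et c \<alpha> p = dt c \<alpha> p - (\<Sum>j\<in>UNIV. \<Sum>\<beta>\<in>UNIV. M c j \<beta> \<alpha> p *\<^sub>T dv c j \<beta> p)"
  "ex c i p = dx c i p - (\<Sum>j\<in>UNIV. \<Sum>\<beta>\<in>UNIV. N c j \<beta> i p *\<^sub>T dv c j \<beta> p)"
  by (simp_all add: delta_t_def delta_x_def sum_apply_fun)

lemma delta_apply:
  assumes "c \<in> CC" "p \<in> jdom c"
  shows "et c \<alpha> p (ct c \<beta>) = (if \<beta> = \<alpha> then 1 else 0)" "et c \<alpha> p (cx c i) = 0"
    "et c \<alpha> p (cv c i \<beta>) = - M c i \<beta> \<alpha> p"
    "ex c j p (ct c \<beta>) = 0" "ex c j p (cx c i) = (if i = j then 1 else 0)"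
    "ex c j p (cv c i \<beta>) = - N c i \<beta> j p"
  using assms sum_sum_delta[of "\<lambda>j \<gamma>. M c j \<gamma> \<alpha> p" i \<beta>] sum_sum_delta[of "\<lambda>i \<gamma>. N c i \<gamma> j p" i \<beta>]
  by (simp_all add: delta_at sum_apply_fun)

lemma delta_tangent:
  assumes "c \<in> CC" "p \<in> jdom c"
  shows "tangent_at p (et c \<alpha> p)" "tangent_at p (ex c i p)"
proof -
  have "p \<in> carrier_of E" using jet_dom_subset[OF assms] by (simp add: carrier_of_jet_atlas)
  then show "tangent_at p (et c \<alpha> p)" "tangent_at p (ex c i p)"
    unfolding delta_at using tangent_at_basis[OF assms]
    by (intro tangent_at_diff tangent_at_sum tangent_at_scale; simp)+
qed

lemma tangent_apply:
  assumes "tangent_at p u" "c \<in> CC" "p \<in> jdom c"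
  shows "u f = (\<Sum>\<alpha>\<in>UNIV. u (ct c \<alpha>) * dt c \<alpha> p f) + (\<Sum>i\<in>UNIV. u (cx c i) * dx c i p f)
    + (\<Sum>i\<in>UNIV. \<Sum>\<alpha>\<in>UNIV. u (cv c i \<alpha>) * dv c i \<alpha> p f)"
  using fun_cong[OF tangent_coordinate_expansion[OF assms], of f] by (simp add: sum_apply_fun)

text \<open>Equations of the three distributions. Unlike the spanning sets, these are easily seen to be
  invariant under the transformation rules.\<close>

definition horizontal_t :: "('t, 'm, 'p, 'n) chart_pair \<Rightarrow> ('t, 'm) jet \<Rightarrow> ('t, 'm) jet tangent \<Rightarrow> bool" where
  "horizontal_t c p u \<longleftrightarrow> tangent_at p u \<and> (\<forall>i. u (cx c i) = 0) \<and>
     (\<forall>i \<alpha>. u (cv c i \<alpha>) = - (\<Sum>\<beta>\<in>UNIV. M c i \<alpha> \<beta> p * u (ct c \<beta>)))"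

definition horizontal_x :: "('t, 'm, 'p, 'n) chart_pair \<Rightarrow> ('t, 'm) jet \<Rightarrow> ('t, 'm) jet tangent \<Rightarrow> bool" where
  "horizontal_x c p u \<longleftrightarrow> tangent_at p u \<and> (\<forall>\<alpha>. u (ct c \<alpha>) = 0) \<and>
     (\<forall>i \<alpha>. u (cv c i \<alpha>) = - (\<Sum>j\<in>UNIV. N c i \<alpha> j p * u (cx c j)))"

definition vertical :: "('t, 'm, 'p, 'n) chart_pair \<Rightarrow> ('t, 'm) jet \<Rightarrow> ('t, 'm) jet tangent \<Rightarrow> bool" where
  "vertical c p u \<longleftrightarrow> tangent_at p u \<and> (\<forall>\<alpha>. u (ct c \<alpha>) = 0) \<and> (\<forall>i. u (cx c i) = 0)"

lemma sum_rearrange: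
  fixes m :: "'k::finite \<Rightarrow> 'g::finite \<Rightarrow> 'a::finite \<Rightarrow> real"
  shows "(\<Sum>k\<in>UNIV. \<Sum>\<gamma>\<in>UNIV. - (\<Sum>\<alpha>\<in>UNIV. m k \<gamma> \<alpha> * w \<alpha>) * (X k * T \<gamma>)) =
    - (\<Sum>\<alpha>\<in>UNIV. w \<alpha> * (\<Sum>k\<in>UNIV. \<Sum>\<gamma>\<in>UNIV. m k \<gamma> \<alpha> * X k * T \<gamma>))"
proof -
  have "- (\<Sum>\<alpha>\<in>UNIV. m k \<gamma> \<alpha> * w \<alpha>) * (X k * T \<gamma>) = - (\<Sum>\<alpha>\<in>UNIV. w \<alpha> * (m k \<gamma> \<alpha> * X k * T \<gamma>))" for k \<gamma>
    by (simp only: minus_mult_left[symmetric] sum_distrib_right) (simp add: mult_ac)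
  then have "(\<Sum>k\<in>UNIV. \<Sum>\<gamma>\<in>UNIV. - (\<Sum>\<alpha>\<in>UNIV. m k \<gamma> \<alpha> * w \<alpha>) * (X k * T \<gamma>)) =
     - (\<Sum>k\<in>UNIV. \<Sum>\<gamma>\<in>UNIV. \<Sum>\<alpha>\<in>UNIV. w \<alpha> * (m k \<gamma> \<alpha> * X k * T \<gamma>))"
    by (simp only: sum_negf)
  also have "(\<Sum>k\<in>UNIV. \<Sum>\<gamma>\<in>UNIV. \<Sum>\<alpha>\<in>UNIV. w \<alpha> * (m k \<gamma> \<alpha> * X k * T \<gamma>)) =
     (\<Sum>k\<in>UNIV. \<Sum>\<alpha>\<in>UNIV. \<Sum>\<gamma>\<in>UNIV. w \<alpha> * (m k \<gamma> \<alpha> * X k * T \<gamma>))"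
    by (rule sum.cong[OF refl], rule sum.swap)
  also have "\<dots> = (\<Sum>\<alpha>\<in>UNIV. \<Sum>k\<in>UNIV. \<Sum>\<gamma>\<in>UNIV. w \<alpha> * (m k \<gamma> \<alpha> * X k * T \<gamma>))"
    by (rule sum.swap)
  also have "\<dots> = (\<Sum>\<alpha>\<in>UNIV. w \<alpha> * (\<Sum>k\<in>UNIV. \<Sum>\<gamma>\<in>UNIV. m k \<gamma> \<alpha> * X k * T \<gamma>))"
    by (simp add: sum_distrib_left)
  finally show ?thesis .
qed

lemma sum_rearrange2:
  fixes m :: "'k::finite \<Rightarrow> real" and w :: "'a::finite \<Rightarrow> real"
  shows "(\<Sum>\<mu>\<in>UNIV. m \<mu> * (\<Sum>\<alpha>\<in>UNIV. w \<alpha> * d \<alpha> \<mu>)) = (\<Sum>\<alpha>\<in>UNIV. w \<alpha> * (\<Sum>\<mu>\<in>UNIV. m \<mu> * d \<alpha> \<mu>))"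
proof -
  have "(\<Sum>\<mu>\<in>UNIV. m \<mu> * (\<Sum>\<alpha>\<in>UNIV. w \<alpha> * d \<alpha> \<mu>)) = (\<Sum>\<mu>\<in>UNIV. \<Sum>\<alpha>\<in>UNIV. w \<alpha> * (m \<mu> * d \<alpha> \<mu>))"
    by (simp add: sum_distrib_left mult.left_commute)
  also have "\<dots> = (\<Sum>\<alpha>\<in>UNIV. \<Sum>\<mu>\<in>UNIV. w \<alpha> * (m \<mu> * d \<alpha> \<mu>))" by (rule sum.swap)
  finally show ?thesis by (simp add: sum_distrib_left)
qed

text \<open>In the old coordinate basis, the new fibre coordinates of \<open>u\<close> consist of a
  base part, with the inhomogeneous terms, and a fibre part, with the old coefficients times two
  Jacobians. The transformation rule turns their sum into the new coefficients. For vertical vectors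
  the triangular form of the change is the argument.\<close>

lemma horizontal_change:
  assumes c: "c \<in> CC" "p \<in> jdom c" and c': "c' \<in> CC" "p \<in> jdom c'"
  shows "horizontal_t c p u \<Longrightarrow> horizontal_t c' p u" "horizontal_x c p u \<Longrightarrow> horizontal_x c' p u"
    "vertical c p u \<Longrightarrow> vertical c' p u"
proof -
  note ch = coordinate_change[OF c c'] and tr = transformation_rules[OF c(1) c'(1) c(2) c'(2)]
  show "horizontal_t c' p u" if u: "horizontal_t c p u"
  proof -
    note u' = u[unfolded horizontal_t_def]
    have tu: "tangent_at p u" using u' by simp
    have x: "u (cx c' j) = 0" for j
      using u' by (subst tangent_apply[OF tu c]) (simp add: ch)
    have t: "u (ct c' \<mu>) = (\<Sum>\<alpha>\<in>UNIV. u (ct c \<alpha>) * dt c \<alpha> p (ct c' \<mu>))" for \<mu>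
      using u' by (subst tangent_apply[OF tu c]) (simp add: ch)
    have "u (cv c' j \<beta>) = (\<Sum>\<alpha>\<in>UNIV. u (ct c \<alpha>) * dt c \<alpha> p (cv c' j \<beta>)) +
      (\<Sum>k\<in>UNIV. \<Sum>\<gamma>\<in>UNIV. - (\<Sum>\<alpha>\<in>UNIV. M c k \<gamma> \<alpha> p * u (ct c \<alpha>)) * (dx c k p (cx c' j) * dt c' \<beta> p (ct c \<gamma>)))" for j \<beta>
      using u' by (subst tangent_apply[OF tu c]) (simp add: ch)
    then have "u (cv c' j \<beta>) = - (\<Sum>\<alpha>\<in>UNIV. u (ct c \<alpha>) * (\<Sum>\<mu>\<in>UNIV. M c' j \<beta> \<mu> p * dt c \<alpha> p (ct c' \<mu>)))" for j \<beta>
      unfolding sum_rearrange tr by (simp add: right_diff_distrib sum_subtractf)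
    then have "u (cv c' j \<beta>) = - (\<Sum>\<mu>\<in>UNIV. M c' j \<beta> \<mu> p * u (ct c' \<mu>))" for j \<beta>
      by (simp only: t sum_rearrange2[of "\<lambda>\<mu>. M c' j \<beta> \<mu> p" "\<lambda>\<alpha>. u (ct c \<alpha>)" "\<lambda>\<alpha> \<mu>. dt c \<alpha> p (ct c' \<mu>)"])
    then show ?thesis using tu x by (simp add: horizontal_t_def)
  qed
  show "horizontal_x c' p u" if u: "horizontal_x c p u"
  proof -
    note u' = u[unfolded horizontal_x_def]
    have tu: "tangent_at p u" using u' by simp
    have x: "u (ct c' j) = 0" for j
      using u' by (subst tangent_apply[OF tu c]) (simp add: ch)
    have t: "u (cx c' \<mu>) = (\<Sum>\<alpha>\<in>UNIV. u (cx c \<alpha>) * dx c \<alpha> p (cx c' \<mu>))" for \<mu>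
      using u' by (subst tangent_apply[OF tu c]) (simp add: ch)
    have "u (cv c' j \<beta>) = (\<Sum>\<alpha>\<in>UNIV. u (cx c \<alpha>) * dx c \<alpha> p (cv c' j \<beta>)) +
      (\<Sum>k\<in>UNIV. \<Sum>\<gamma>\<in>UNIV. - (\<Sum>\<alpha>\<in>UNIV. N c k \<gamma> \<alpha> p * u (cx c \<alpha>)) * (dx c k p (cx c' j) * dt c' \<beta> p (ct c \<gamma>)))" for j \<beta>
      using u' by (subst tangent_apply[OF tu c]) (simp add: ch)
    then have "u (cv c' j \<beta>) = - (\<Sum>\<alpha>\<in>UNIV. u (cx c \<alpha>) * (\<Sum>\<mu>\<in>UNIV. N c' j \<beta> \<mu> p * dx c \<alpha> p (cx c' \<mu>)))" for j \<beta>
      unfolding sum_rearrange tr by (simp add: right_diff_distrib sum_subtractf)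
    then have "u (cv c' j \<beta>) = - (\<Sum>\<mu>\<in>UNIV. N c' j \<beta> \<mu> p * u (cx c' \<mu>))" for j \<beta>
      by (simp only: t sum_rearrange2[of "\<lambda>k. N c' j \<beta> k p" "\<lambda>i. u (cx c i)" "\<lambda>i k. dx c i p (cx c' k)"])
    then show ?thesis using tu x by (simp add: horizontal_x_def)
  qed
  show "vertical c' p u" if u: "vertical c p u"
  proof -
    note u' = u[unfolded vertical_def]
    have tu: "tangent_at p u" using u' by simp
    have "u (ct c' \<alpha>) = 0" "u (cx c' i) = 0" for \<alpha> i
      using u' by (subst tangent_apply[OF tu c]; simp add: ch)+
    then show ?thesis using tu by (simp add: vertical_def)
  qed
qed

lemma horizontal_t_combination:
  assumes c: "c \<in> CC" "p \<in> jdom c"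
  shows "horizontal_t c p (\<Sum>\<alpha>\<in>UNIV. a \<alpha> *\<^sub>T et c \<alpha> p)"
proof -
  have "p \<in> carrier_of E" using jet_dom_subset[OF c] by (simp add: carrier_of_jet_atlas)
  then have "tangent_at p (\<Sum>\<alpha>\<in>UNIV. a \<alpha> *\<^sub>T et c \<alpha> p)"
    using delta_tangent[OF c] by (intro tangent_at_sum tangent_at_scale)
  then show ?thesis
    using c by (simp add: horizontal_t_def sum_apply_fun delta_apply sum_negf mult.commute
      if_distrib[of "\<lambda>x. _ * x"] cong: if_cong)
qed

lemma horizontal_x_combination:
  assumes c: "c \<in> CC" "p \<in> jdom c"
  shows "horizontal_x c p (\<Sum>i\<in>UNIV. a i *\<^sub>T ex c i p)"
proof -
  have "p \<in> carrier_of E" using jet_dom_subset[OF c] by (simp add: carrier_of_jet_atlas)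
  then have "tangent_at p (\<Sum>i\<in>UNIV. a i *\<^sub>T ex c i p)"
    using delta_tangent[OF c] by (intro tangent_at_sum tangent_at_scale)
  then show ?thesis
    using c by (simp add: horizontal_x_def sum_apply_fun delta_apply sum_negf mult.commute
      if_distrib[of "\<lambda>x. _ * x"] cong: if_cong)
qed

lemma vertical_combination:
  assumes c: "c \<in> CC" "p \<in> jdom c"
  shows "vertical c p (\<Sum>i\<in>UNIV. \<Sum>\<alpha>\<in>UNIV. a i \<alpha> *\<^sub>T dv c i \<alpha> p)"
proof -
  have "p \<in> carrier_of E" using jet_dom_subset[OF c] by (simp add: carrier_of_jet_atlas)
  then have "tangent_at p (\<Sum>i\<in>UNIV. \<Sum>\<alpha>\<in>UNIV. a i \<alpha> *\<^sub>T dv c i \<alpha> p)"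
    using tangent_at_basis[OF c] by (intro tangent_at_sum tangent_at_scale)
  then show ?thesis using c by (simp add: vertical_def sum_apply_fun)
qed

lemma horizontal_t_expansion:
  assumes c: "c \<in> CC" "p \<in> jdom c" and u: "horizontal_t c p u"
  shows "u = (\<Sum>\<alpha>\<in>UNIV. u (ct c \<alpha>) *\<^sub>T et c \<alpha> p)"
proof (rule tangent_eq_coordinates[OF _ _ c])
  show "tangent_at p u" "tangent_at p (\<Sum>\<alpha>\<in>UNIV. u (ct c \<alpha>) *\<^sub>T et c \<alpha> p)"
    using u horizontal_t_combination[OF c] by (auto simp: horizontal_t_def)
qed (use u c in \<open>simp_all add: horizontal_t_def sum_apply_fun delta_apply sum_negf mult.commute
      if_distrib[of "\<lambda>x. _ * x"] if_distrib[of "\<lambda>x. x * _"] cong: if_cong\<close>)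

lemma horizontal_x_expansion:
  assumes c: "c \<in> CC" "p \<in> jdom c" and u: "horizontal_x c p u"
  shows "u = (\<Sum>i\<in>UNIV. u (cx c i) *\<^sub>T ex c i p)"
proof (rule tangent_eq_coordinates[OF _ _ c])
  show "tangent_at p u" "tangent_at p (\<Sum>i\<in>UNIV. u (cx c i) *\<^sub>T ex c i p)"
    using u horizontal_x_combination[OF c] by (auto simp: horizontal_x_def)
qed (use u c in \<open>simp_all add: horizontal_x_def sum_apply_fun delta_apply sum_negf mult.commute
      if_distrib[of "\<lambda>x. _ * x"] if_distrib[of "\<lambda>x. x * _"] cong: if_cong\<close>)

lemma vertical_expansion:
  assumes c: "c \<in> CC" "p \<in> jdom c" and u: "vertical c p u"
  shows "u = (\<Sum>i\<in>UNIV. \<Sum>\<alpha>\<in>UNIV. u (cv c i \<alpha>) *\<^sub>T dv c i \<alpha> p)"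
  using u tangent_coordinate_expansion[of p u, OF _ c] by (simp add: vertical_def)

text \<open>The distributions are spans in some chart pair around \<open>p\<close>, and two members
  may use different ones. Expressing membership by equations in a prescribed chart pair makes the
  distributions visibly linear.\<close>

lemma dist_iff:
  assumes c: "c \<in> CC" "p \<in> jdom c"
  shows "u \<in> DT p \<longleftrightarrow> horizontal_t c p u" "u \<in> DX p \<longleftrightarrow> horizontal_x c p u" "u \<in> DV p \<longleftrightarrow> vertical c p u"
proof -
  show "u \<in> DT p \<longleftrightarrow> horizontal_t c p u"
  proof
    assume "u \<in> DT p"
    then obtain c' a where c': "c' \<in> CC" "p \<in> jdom c'" and u: "u = (\<Sum>\<alpha>\<in>UNIV. a \<alpha> *\<^sub>T et c' \<alpha> p)"
      unfolding dist_t_def by blast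
    show "horizontal_t c p u"
      unfolding u by (rule horizontal_change(1)[OF c' c horizontal_t_combination[OF c']])
  next
    assume "horizontal_t c p u"
    from horizontal_t_expansion[OF c this] show "u \<in> DT p"
      unfolding dist_t_def by (intro CollectI bexI[OF _ c(1)] conjI[OF c(2)] exI)
  qed
  show "u \<in> DX p \<longleftrightarrow> horizontal_x c p u"
  proof
    assume "u \<in> DX p"
    then obtain c' a where c': "c' \<in> CC" "p \<in> jdom c'" and u: "u = (\<Sum>\<alpha>\<in>UNIV. a \<alpha> *\<^sub>T ex c' \<alpha> p)"
      unfolding dist_x_def by blast
    show "horizontal_x c p u"
      unfolding u by (rule horizontal_change(2)[OF c' c horizontal_x_combination[OF c']])
  next
    assume "horizontal_x c p u"
    from horizontal_x_expansion[OF c this] show "u \<in> DX p"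
      unfolding dist_x_def by (intro CollectI bexI[OF _ c(1)] conjI[OF c(2)] exI)
  qed
  show "u \<in> DV p \<longleftrightarrow> vertical c p u"
  proof
    assume "u \<in> DV p"
    then obtain c' a where c': "c' \<in> CC" "p \<in> jdom c'" and u: "u = (\<Sum>i\<in>UNIV. \<Sum>\<alpha>\<in>UNIV. a i \<alpha> *\<^sub>T dv c' i \<alpha> p)"
      unfolding dist_v_def by blast
    show "vertical c p u"
      unfolding u by (rule horizontal_change(3)[OF c' c vertical_combination[OF c']])
  next
    assume "vertical c p u"
    from vertical_expansion[OF c this] show "u \<in> DV p"
      unfolding dist_v_def by (intro CollectI bexI[OF _ c(1)] conjI[OF c(2)] exI)
  qed
qed

lemma dist_diff:
  assumes "p \<in> JS"
  shows "u \<in> DT p \<Longrightarrow> w \<in> DT p \<Longrightarrow> u - w \<in> DT p" "u \<in> DX p \<Longrightarrow> w \<in> DX p \<Longrightarrow> u - w \<in> DX p"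
    "u \<in> DV p \<Longrightarrow> w \<in> DV p \<Longrightarrow> u - w \<in> DV p"
proof -
  obtain c where c: "c \<in> CC" "p \<in> jdom c" using assms by (rule jet_dom_cover)
  show "u \<in> DT p \<Longrightarrow> w \<in> DT p \<Longrightarrow> u - w \<in> DT p" "u \<in> DX p \<Longrightarrow> w \<in> DX p \<Longrightarrow> u - w \<in> DX p"
    "u \<in> DV p \<Longrightarrow> w \<in> DV p \<Longrightarrow> u - w \<in> DV p"
    unfolding dist_iff[OF c] horizontal_t_def horizontal_x_def vertical_def
    by (simp_all add: tangent_at_diff right_diff_distrib sum_subtractf)
qed

lemma dist_scale:
  assumes "p \<in> JS"
  shows "u \<in> DT p \<Longrightarrow> r *\<^sub>T u \<in> DT p" "u \<in> DX p \<Longrightarrow> r *\<^sub>T u \<in> DX p" "u \<in> DV p \<Longrightarrow> r *\<^sub>T u \<in> DV p"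
proof -
  obtain c where c: "c \<in> CC" "p \<in> jdom c" using assms by (rule jet_dom_cover)
  show "u \<in> DT p \<Longrightarrow> r *\<^sub>T u \<in> DT p" "u \<in> DX p \<Longrightarrow> r *\<^sub>T u \<in> DX p" "u \<in> DV p \<Longrightarrow> r *\<^sub>T u \<in> DV p"
    unfolding dist_iff[OF c] horizontal_t_def horizontal_x_def vertical_def
    by (simp_all add: tangent_at_scale sum_distrib_left mult.left_commute)
qed

text \<open>\<open>et\<close> has no x-coordinates and \<open>ex\<close> has no t-coordinates, so
  the coefficients can be read off from \<open>w\<close> directly; what remains has neither kind and
  is vertical.\<close>

lemma decomposition_exists:
  assumes w: "tangent_at p w" and c: "c \<in> CC" "p \<in> jdom c"
  shows "w - (\<Sum>\<alpha>\<in>UNIV. w (ct c \<alpha>) *\<^sub>T et c \<alpha> p) - (\<Sum>i\<in>UNIV. w (cx c i) *\<^sub>T ex c i p) \<in> DV p"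
  unfolding dist_iff[OF c] vertical_def
  using w horizontal_t_combination[OF c] horizontal_x_combination[OF c] c
  by (auto intro!: tangent_at_diff simp: horizontal_t_def horizontal_x_def sum_apply_fun delta_apply
      if_distrib[of "\<lambda>x. _ * x"] cong: if_cong)

text \<open>The t-coordinates of the sum come from \<open>u\<close> alone and its x-coordinates from
  \<open>u'\<close> alone, so both summands are given by formulas in the sum.\<close>

lemma decomposition_unique:
  assumes c: "c \<in> CC" "p \<in> jdom c" and u: "u \<in> DT p" "u' \<in> DX p" "u'' \<in> DV p"
  shows "u = (\<Sum>\<alpha>\<in>UNIV. (u + u' + u'') (ct c \<alpha>) *\<^sub>T et c \<alpha> p)"
    "u' = (\<Sum>i\<in>UNIV. (u + u' + u'') (cx c i) *\<^sub>T ex c i p)"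
proof -
  note u' = u[unfolded dist_iff[OF c]]
  have e: "(u + u' + u'') (ct c \<alpha>) = u (ct c \<alpha>)" "(u + u' + u'') (cx c i) = u' (cx c i)" for \<alpha> i
    using u' by (simp_all add: horizontal_t_def horizontal_x_def vertical_def)
  show "u = (\<Sum>\<alpha>\<in>UNIV. (u + u' + u'') (ct c \<alpha>) *\<^sub>T et c \<alpha> p)"
    "u' = (\<Sum>i\<in>UNIV. (u + u' + u'') (cx c i) *\<^sub>T ex c i p)"
    unfolding e by (rule horizontal_t_expansion[OF c u'(1)] horizontal_x_expansion[OF c u'(2)])+
qed

text \<open>Makes the definite descriptions in the projections usable: any exhibited decomposition
  of \<open>Y p\<close> is the one they select.\<close>

lemma projections_at:
  assumes c: "c \<in> CC" "p \<in> jdom c" and u: "u \<in> DT p" "u' \<in> DX p" "u'' \<in> DV p" and Y: "Y p = u + u' + u''"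
  shows "h_T Y p = u" "h_M Y p = u'" "h_V Y p = u''"
proof -
  have eq: "w = u" "w' = u'" "w'' = u''"
    if "w \<in> DT p" "w' \<in> DX p" "w'' \<in> DV p" "Y p = w + w' + w''" for w w' w''
  proof -
    have s: "w + w' + w'' = u + u' + u''" using that Y by simp
    show 1: "w = u"
      using decomposition_unique(1)[OF c that(1-3)] decomposition_unique(1)[OF c u] unfolding s by (rule trans[OF _ sym])
    show 2: "w' = u'"
      using decomposition_unique(2)[OF c that(1-3)] decomposition_unique(2)[OF c u] unfolding s by (rule trans[OF _ sym])
    show "w'' = u''" using s unfolding 1 2 by simp
  qed
  have p: "p \<in> JS" using c by (rule jet_dom_subset)
  show "h_T Y p = u"
    unfolding proj_t_def using p u Y eq(1) by (auto intro!: the_equality)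
  show "h_M Y p = u'"
    unfolding proj_x_def using p u Y eq(2) by (auto intro!: the_equality)
  show "h_V Y p = u''"
    unfolding proj_v_def using p u Y eq(3) by (auto intro!: the_equality)
qed

lemma projections_in_dist:
  assumes p: "p \<in> JS" and Y: "tangent_at p (Y p)"
  shows "h_T Y p \<in> DT p" "h_M Y p \<in> DX p" "h_V Y p \<in> DV p"
proof -
  obtain c where c: "c \<in> CC" "p \<in> jdom c" using p by (rule jet_dom_cover)
  define u where "u = (\<Sum>\<alpha>\<in>UNIV. Y p (ct c \<alpha>) *\<^sub>T et c \<alpha> p)"
  define u' where "u' = (\<Sum>i\<in>UNIV. Y p (cx c i) *\<^sub>T ex c i p)"
  have u: "u \<in> DT p" "u' \<in> DX p" "Y p - u - u' \<in> DV p"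
    using decomposition_exists[OF Y c] horizontal_t_combination[OF c] horizontal_x_combination[OF c]
    by (simp_all add: dist_iff[OF c] u_def u'_def)
  have "Y p = u + u' + (Y p - u - u')" by simp
  from projections_at[of c p u u' "Y p - u - u'" Y, OF c u this] u
  show "h_T Y p \<in> DT p" "h_M Y p \<in> DX p" "h_V Y p \<in> DV p" by simp_all
qed

lemma zero_in_dist:
  assumes "p \<in> JS" shows "0 \<in> DT p" "0 \<in> DX p" "0 \<in> DV p"
proof -
  obtain c where c: "c \<in> CC" "p \<in> jdom c" using assms by (rule jet_dom_cover)
  show "0 \<in> DT p" "0 \<in> DX p" "0 \<in> DV p"
    unfolding dist_iff[OF c] horizontal_t_def horizontal_x_def vertical_def
    using assms by (simp_all add: tangent_at_zero carrier_of_jet_atlas)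
qed

lemma projections_fix:
  assumes p: "p \<in> JS"
  shows "Y p \<in> DT p \<Longrightarrow> h_T Y p = Y p" "Y p \<in> DX p \<Longrightarrow> h_M Y p = Y p"
    "Y p \<in> DV p \<Longrightarrow> h_V Y p = Y p"
proof -
  obtain c where c: "c \<in> CC" "p \<in> jdom c" using p by (rule jet_dom_cover)
  note z = zero_in_dist[OF p]
  show "Y p \<in> DT p \<Longrightarrow> h_T Y p = Y p" using z by (intro projections_at(1)[OF c, of "Y p" 0 0]) auto
  show "Y p \<in> DX p \<Longrightarrow> h_M Y p = Y p" using z by (intro projections_at(2)[OF c, of 0 "Y p" 0]) auto
  show "Y p \<in> DV p \<Longrightarrow> h_V Y p = Y p" using z by (intro projections_at(3)[OF c, of 0 0 "Y p"]) auto
qed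

end

section \<open>Local components of the curvature\<close>

context smooth_charts
begin

text \<open>A projector that commutes with the connection forces the curvature to preserve its range.\<close>

lemma curvature_in_distribution:
  assumes D: "linear_connection A D"
    and comm: "\<And>X Y. X \<in> VF \<Longrightarrow> Y \<in> VF \<Longrightarrow> D X (P Y) = P (D X Y)"
    and into: "\<And>Y p. Y \<in> VF \<Longrightarrow> p \<in> carrier_of A \<Longrightarrow> P Y p \<in> S p"
    and fix_P: "P Z = Z"
    and diff: "\<And>u w. u \<in> S p \<Longrightarrow> w \<in> S p \<Longrightarrow> u - w \<in> S p"
    and XYZ: "X \<in> VF" "Y \<in> VF" "Z \<in> VF" and p: "p \<in> carrier_of A"
  shows "curvature A D X Y Z p \<in> S p"
proof -
  have closed: "X \<in> VF \<Longrightarrow> Y \<in> VF \<Longrightarrow> D X Y \<in> VF" for X Y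
    using D by (simp add: linear_connection_def)
  have one: "D X Z = P (D X Z)" if "X \<in> VF" for X
    using comm[OF that XYZ(3)] fix_P by simp
  have two: "D X (D Y Z) = P (D X (D Y Z))" if "X \<in> VF" "Y \<in> VF" for X Y
    using comm[OF that(1) closed[OF that(2) XYZ(3)]] one[OF that(2)] by simp
  have "D X (D Y Z) p \<in> S p" "D Y (D X Z) p \<in> S p" "D (lie_bracket A X Y) Z p \<in> S p"
    using two[OF XYZ(1,2)] two[OF XYZ(2,1)] one[OF vector_fields_lie_bracket[OF XYZ(1,2)]] into[OF _ p] closed XYZ
      vector_fields_lie_bracket[OF XYZ(1,2)] by metis+
  moreover have "curvature A D X Y Z p = D X (D Y Z) p - D Y (D X Z) p - D (lie_bracket A X Y) Z p"
    by (simp add: curvature_def)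
  ultimately show ?thesis using diff by (simp only:)
qed

end

section \<open>Extension of frame fields and local values of tensors\<close>

context nonlinear_jet_bundle
begin

text \<open>Conditions are imposed on the chart domain only; elsewhere the local fields carry no
  information, and their extensions are 0 there.\<close>

definition frame_field :: "('t, 'm, 'p, 'n) chart_pair \<Rightarrow> ('t, 'm) jet vfield \<Rightarrow> bool" where
  "frame_field c F \<longleftrightarrow> (\<exists>a. smooth_fun E (jdom c) a \<and> (\<forall>q\<in>jdom c. F q = partial E (JC c) (a q) q))"

lemma frame_field_basis:
  assumes c: "c \<in> CC"
  shows "frame_field c (et c \<alpha>)" "frame_field c (ex c i)" "frame_field c (dv c i \<alpha>)"
proof -
  note o = jet_dom_open[OF c]
  have C: "JC c \<in> E" "q \<in> jdom c \<Longrightarrow> q \<in> fst (JC c)" for q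
    using c jet_chart_in_atlas by (auto simp: jet_dom_eq)
  have "smooth_fun E (jdom c) (\<lambda>q. (axis \<alpha> 1, 0, 0) - (\<Sum>j\<in>UNIV. \<Sum>\<beta>\<in>UNIV. M c j \<beta> \<alpha> q *\<^sub>R ((0, 0, axis j (axis \<beta> 1)) :: ('p, 'n) jet_coords)))"
    using coeffs_smooth(1)[OF c] by (intro smooth_fun_diff smooth_fun_sum smooth_fun_scaleR o smooth_fun_const)
  moreover have "et c \<alpha> q = partial E (JC c) ((axis \<alpha> 1, 0, 0) - (\<Sum>j\<in>UNIV. \<Sum>\<beta>\<in>UNIV. M c j \<beta> \<alpha> q *\<^sub>R (0, 0, axis j (axis \<beta> 1)))) q"
    if "q \<in> jdom c" for q
    by (simp only: partial_diff[OF C(1) C(2)[OF that]] partial_sum[OF C(1) C(2)[OF that]] partial_scale[OF C(1) C(2)[OF that]]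
      delta_at d_t_def d_v_def)
  ultimately show "frame_field c (et c \<alpha>)" unfolding frame_field_def by blast
  have "smooth_fun E (jdom c) (\<lambda>q. (0, axis i 1, 0) - (\<Sum>j\<in>UNIV. \<Sum>\<beta>\<in>UNIV. N c j \<beta> i q *\<^sub>R ((0, 0, axis j (axis \<beta> 1)) :: ('p, 'n) jet_coords)))"
    using coeffs_smooth(2)[OF c] by (intro smooth_fun_diff smooth_fun_sum smooth_fun_scaleR o smooth_fun_const)
  moreover have "ex c i q = partial E (JC c) ((0, axis i 1, 0) - (\<Sum>j\<in>UNIV. \<Sum>\<beta>\<in>UNIV. N c j \<beta> i q *\<^sub>R (0, 0, axis j (axis \<beta> 1)))) q"
    if "q \<in> jdom c" for q
    by (simp only: partial_diff[OF C(1) C(2)[OF that]] partial_sum[OF C(1) C(2)[OF that]] partial_scale[OF C(1) C(2)[OF that]]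
      delta_at d_x_def d_v_def)
  ultimately show "frame_field c (ex c i)" unfolding frame_field_def by blast
  show "frame_field c (dv c i \<alpha>)"
    unfolding frame_field_def d_v_def by (intro exI[of _ "\<lambda>q. (0, 0, axis i (axis \<alpha> 1))"]) simp
qed

text \<open>The last property controls the extension at every point: it is 0 or a multiple of
  \<open>F\<close>, hence lies in each distribution that contains \<open>F\<close>. This is what
  allows the projections to act on it.\<close>

lemma frame_field_extension:
  assumes c: "c \<in> CC" and F: "frame_field c F" and p: "p \<in> jdom c"
  obtains X U where "X \<in> VF" "atlas_open E U" "p \<in> U" "U \<subseteq> jdom c" "\<And>q. q \<in> U \<Longrightarrow> X q = F q"
    "\<And>q. X q = 0 \<or> (q \<in> jdom c \<and> (\<exists>r. X q = r *\<^sub>T F q))"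
proof -
  obtain a where a: "smooth_fun E (jdom c) a" "\<And>q. q \<in> jdom c \<Longrightarrow> F q = partial E (JC c) (a q) q"
    using F unfolding frame_field_def by blast
  have "jdom c \<subseteq> fst (JC c)" by (simp add: jet_dom_def)
  then obtain X \<rho> U where X: "X \<in> VF" "\<And>q. X q = (if q \<in> jdom c then \<rho> q *\<^sub>T partial E (JC c) (a q) q else 0)"
    "atlas_open E U" "p \<in> U" "U \<subseteq> jdom c" "\<And>q. q \<in> U \<Longrightarrow> \<rho> q = 1"
    by (rule local_field_extension[OF jet_chart_in_atlas[OF c] jet_dom_open[OF c] _ a(1) p]) blast
  show ?thesis
  proof (rule that[OF X(1,3-5)])
    show "X q = F q" if "q \<in> U" for q using that X(2,5,6) a(2) by auto
    show "X q = 0 \<or> (q \<in> jdom c \<and> (\<exists>r. X q = r *\<^sub>T F q))" for q using X(2)[of q] a(2) by auto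
  qed
qed

text \<open>A single triple of global fields represents the local value on a whole neighbourhood, so
  smoothness of \<open>Q X Y Z\<close> passes to the local value. The final property is recorded for
  \<open>Z\<close> because the field acted on decides the distribution.\<close>

lemma local_value_near:
  assumes Q: "curvature_type_tensor E Q" and c: "c \<in> CC" and p: "p \<in> jdom c"
    and F: "frame_field c F" and G: "frame_field c G" and H: "frame_field c H"
  obtains X Y Z W where "X \<in> VF" "Y \<in> VF" "Z \<in> VF" "atlas_open E W" "p \<in> W" "W \<subseteq> jdom c"
    "\<And>q. q \<in> W \<Longrightarrow> local_value E Q F G H q = Q X Y Z q"
    "\<And>q. Z q = 0 \<or> (q \<in> jdom c \<and> (\<exists>r. Z q = r *\<^sub>T H q))"
proof -
  obtain X U where X: "X \<in> VF" and U: "atlas_open E U" "p \<in> U" "U \<subseteq> jdom c" "\<And>q. q \<in> U \<Longrightarrow> X q = F q"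
    by (rule frame_field_extension[OF c F p]) blast
  obtain Y V where Y: "Y \<in> VF" and V: "atlas_open E V" "p \<in> V" "\<And>q. q \<in> V \<Longrightarrow> Y q = G q"
    by (rule frame_field_extension[OF c G p]) blast
  obtain Z W where Z: "Z \<in> VF" "\<And>q. Z q = 0 \<or> (q \<in> jdom c \<and> (\<exists>r. Z q = r *\<^sub>T H q))"
    and W: "atlas_open E W" "p \<in> W" "\<And>q. q \<in> W \<Longrightarrow> Z q = H q"
    by (rule frame_field_extension[OF c H p]) blast
  show ?thesis
  proof (rule that[OF X Y Z(1)])
    show "atlas_open E (U \<inter> (V \<inter> W))" using U V W by (intro atlas_open_Int)
    show "local_value E Q F G H q = Q X Y Z q" if "q \<in> U \<inter> (V \<inter> W)" for q
    proof (rule local_value_eq[OF Q X Y Z(1)])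
      show "agree_near E q X F" unfolding agree_near_def using U(1,4) that by (intro exI[of _ U]) simp
      show "agree_near E q Y G" unfolding agree_near_def using V(1,3) that by (intro exI[of _ V]) simp
      show "agree_near E q Z H" unfolding agree_near_def using W(1,3) that by (intro exI[of _ W]) simp
    qed
  qed (use U V W Z in auto)
qed

lemma local_value_smooth:
  assumes Q: "curvature_type_tensor E Q" and c: "c \<in> CC"
    and FGH: "frame_field c F" "frame_field c G" "frame_field c H" and f: "smooth_fun E (jdom c) f"
  shows "smooth_fun E (jdom c) (\<lambda>p. local_value E Q F G H p f)"
proof (rule smooth_fun_local)
  fix p assume p: "p \<in> jdom c"
  obtain X Y Z W where VF: "X \<in> VF" "Y \<in> VF" "Z \<in> VF" and W: "atlas_open E W" "p \<in> W" "W \<subseteq> jdom c"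
    "\<And>q. q \<in> W \<Longrightarrow> local_value E Q F G H q = Q X Y Z q"
    by (rule local_value_near[OF Q c p FGH]) blast
  have "smooth_fun E W (\<lambda>q. Q X Y Z q f)"
    using tensor_closed[OF Q VF] W(1) smooth_fun_subset[OF f W(3)] by (rule vector_field_apply_smooth)
  then have "smooth_fun E W (\<lambda>p. local_value E Q F G H p f)"
    using smooth_fun_cong[OF W(1), of "\<lambda>p. local_value E Q F G H p f" "\<lambda>q. Q X Y Z q f"] W(4) by simp
  then show "\<exists>U. atlas_open E U \<and> p \<in> U \<and> smooth_fun E U (\<lambda>p. local_value E Q F G H p f)"
    using W by blast
qed

section \<open>Components of a tensor in the adapted basis\<close>

lemma coefficient_of_combination:
  assumes c: "c \<in> CC" "p \<in> jdom c"
  shows "(\<Sum>\<alpha>\<in>UNIV. a \<alpha> *\<^sub>T et c \<alpha> p) (ct c \<beta>) = a \<beta>"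
    "(\<Sum>i\<in>UNIV. b i *\<^sub>T ex c i p) (cx c j) = b j"
    "(\<Sum>i\<in>UNIV. \<Sum>\<alpha>\<in>UNIV. d i \<alpha> *\<^sub>T dv c i \<alpha> p) (cv c j \<beta>) = d j \<beta>"
  using c sum_sum_delta[of d j \<beta>]
  by (simp_all add: sum_apply_fun delta_apply if_distrib[of "\<lambda>x. _ * x"] cong: if_cong)

text \<open>Each coordinate function is dual to the frame only within one distribution;
  \<open>cv\<close>, for instance, is \<open>- M\<close> on \<open>et\<close>. The entries are
  therefore true coefficients only when the values of \<open>Q\<close> lie in the distribution of
  the field acted on.\<close>

definition frame_components ::
  "(('t, 'm) jet vfield \<Rightarrow> ('t, 'm) jet vfield \<Rightarrow> ('t, 'm) jet vfield \<Rightarrow> ('t, 'm) jet vfield)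
     \<Rightarrow> ('t, 'm, 'p, 'n) chart_pair \<Rightarrow> ('t, 'm) jet \<Rightarrow> ('p, 'n) curvature_components" where
  "frame_components Q c p = (let R = local_value E Q; T = et c; X = ex c; V = dv c; t = ct c; x = cx c; v = cv c in
   \<lparr>Rt_tt = \<lambda>\<delta> \<alpha> \<beta> \<gamma>. R (T \<gamma>) (T \<beta>) (T \<alpha>) p (t \<delta>),
    Rx_tt = \<lambda>l i \<beta> \<gamma>. R (T \<gamma>) (T \<beta>) (X i) p (x l),
    Rv_tt = \<lambda>l \<delta> i \<alpha> \<beta> \<gamma>. R (T \<gamma>) (T \<beta>) (V i \<alpha>) p (v l \<delta>),
    Rt_tx = \<lambda>\<delta> \<alpha> \<beta> k. R (X k) (T \<beta>) (T \<alpha>) p (t \<delta>),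
    Rx_tx = \<lambda>l i \<beta> k. R (X k) (T \<beta>) (X i) p (x l),
    Rv_tx = \<lambda>l \<delta> i \<alpha> \<beta> k. R (X k) (T \<beta>) (V i \<alpha>) p (v l \<delta>),
    Rt_xx = \<lambda>\<delta> \<alpha> j k. R (X k) (X j) (T \<alpha>) p (t \<delta>),
    Rx_xx = \<lambda>l i j k. R (X k) (X j) (X i) p (x l),
    Rv_xx = \<lambda>l \<delta> i \<alpha> j k. R (X k) (X j) (V i \<alpha>) p (v l \<delta>),
    Pt_tv = \<lambda>\<delta> \<alpha> \<beta> k \<gamma>. R (V k \<gamma>) (T \<beta>) (T \<alpha>) p (t \<delta>),
    Px_tv = \<lambda>l i \<beta> k \<gamma>. R (V k \<gamma>) (T \<beta>) (X i) p (x l),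
    Pv_tv = \<lambda>l \<delta> i \<alpha> \<beta> k \<gamma>. R (V k \<gamma>) (T \<beta>) (V i \<alpha>) p (v l \<delta>),
    Pt_xv = \<lambda>\<delta> \<alpha> j k \<gamma>. R (V k \<gamma>) (X j) (T \<alpha>) p (t \<delta>),
    Px_xv = \<lambda>l i j k \<gamma>. R (V k \<gamma>) (X j) (X i) p (x l),
    Pv_xv = \<lambda>l \<delta> i \<alpha> j k \<gamma>. R (V k \<gamma>) (X j) (V i \<alpha>) p (v l \<delta>),
    St_vv = \<lambda>\<delta> \<alpha> j \<beta> k \<gamma>. R (V k \<gamma>) (V j \<beta>) (T \<alpha>) p (t \<delta>),
    Sx_vv = \<lambda>l i j \<beta> k \<gamma>. R (V k \<gamma>) (V j \<beta>) (X i) p (x l),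
    Sv_vv = \<lambda>l \<delta> i \<alpha> j \<beta> k \<gamma>. R (V k \<gamma>) (V j \<beta>) (V i \<alpha>) p (v l \<delta>)\<rparr>)"

lemma smooth_frame_components:
  assumes "curvature_type_tensor E Q" "c \<in> CC"
  shows "smooth_components E (jdom c) (frame_components Q c)"
  unfolding smooth_components_def
  by (intro conjI allI; simp only: frame_components_def Let_def curvature_components.simps;
      rule local_value_smooth[OF assms]; rule frame_field_basis[OF assms(2)] coord_smooth[OF assms(2)])

lemma local_expressions_unique:
  assumes c: "c \<in> CC" and L: "local_expressions AT AM M N Q c K" and p: "p \<in> jdom c"
  shows "K p = frame_components Q c p"
proof -
  note l = L[unfolded local_expressions_def Let_def, rule_format, OF p]
  show ?thesis
    by (rule curvature_components.equality; (intro ext)?)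
      (simp_all add: frame_components_def Let_def l coefficient_of_combination[OF c p])
qed

text \<open>The coefficients are fixed before the functional \<open>L\<close>, so the same expansion
  serves two tensors that are to be compared.\<close>

lemma vector_field_frame_coefficients:
  assumes c: "c \<in> CC" "p \<in> jdom c" and X: "X \<in> VF"
    and T: "\<And>\<alpha>. T \<alpha> \<in> VF" "\<And>\<alpha>. agree_near E p (T \<alpha>) (et c \<alpha>)"
    and S: "\<And>i. S i \<in> VF" "\<And>i. agree_near E p (S i) (ex c i)"
    and V: "\<And>i \<alpha>. V i \<alpha> \<in> VF" "\<And>i \<alpha>. agree_near E p (V i \<alpha>) (dv c i \<alpha>)"
  obtains a b d where "\<And>L. tensorial_at p L \<Longrightarrow> L X = (\<Sum>\<alpha>\<in>UNIV. a \<alpha> *\<^sub>T L (T \<alpha>)) + (\<Sum>i\<in>UNIV. b i *\<^sub>T L (S i))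
    + (\<Sum>i\<in>UNIV. \<Sum>\<alpha>\<in>UNIV. d i \<alpha> *\<^sub>T L (V i \<alpha>))"
proof -
  obtain UT where UT: "\<And>\<alpha>. atlas_open E (UT \<alpha>) \<and> p \<in> UT \<alpha> \<and> (\<forall>q\<in>UT \<alpha>. T \<alpha> q = et c \<alpha> q)"
    using T(2) unfolding agree_near_def by metis
  obtain US where US: "\<And>i. atlas_open E (US i) \<and> p \<in> US i \<and> (\<forall>q\<in>US i. S i q = ex c i q)"
    using S(2) unfolding agree_near_def by metis
  obtain UV where UV: "\<And>i \<alpha>. atlas_open E (UV i \<alpha>) \<and> p \<in> UV i \<alpha> \<and> (\<forall>q\<in>UV i \<alpha>. V i \<alpha> q = dv c i \<alpha> q)"
    using V(2) unfolding agree_near_def by metis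
  \<comment> \<open>The sum type gathers the three kinds of frame fields into one finite family, to
    which the expansion for a single sum applies.\<close>
  define F where "F z = (case z of Inl \<alpha> \<Rightarrow> T \<alpha> | Inr (Inl i) \<Rightarrow> S i | Inr (Inr (i, \<alpha>)) \<Rightarrow> V i \<alpha>)" for z :: "'p + 'n + 'n \<times> 'p"
  define U where "U z = (case z of Inl \<alpha> \<Rightarrow> UT \<alpha> | Inr (Inl i) \<Rightarrow> US i | Inr (Inr (i, \<alpha>)) \<Rightarrow> UV i \<alpha>)" for z :: "'p + 'n + 'n \<times> 'p"
  define W where "W = jdom c \<inter> (\<Inter>z\<in>UNIV. U z)"
  have oW: "atlas_open E W"
    unfolding W_def
    by (rule atlas_open_finite_Inter[OF _ _ jet_dom_open[OF c(1)]]) (auto simp: U_def UT US UV split: sum.split)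
  have pW: "p \<in> W" using c UT US UV by (auto simp: W_def U_def split: sum.split)
  \<comment> \<open>The frame fields \<open>et\<close> and \<open>ex\<close> have fibre coordinates
    \<open>- M\<close> and \<open>- N\<close>; subtracting the two horizontal parts of
    \<open>X\<close> adds these contributions to its fibre coordinates.\<close>
  define d where "d i \<alpha> q = X q (cv c i \<alpha>) + (\<Sum>\<beta>\<in>UNIV. M c i \<alpha> \<beta> q * X q (ct c \<beta>)) + (\<Sum>j\<in>UNIV. N c i \<alpha> j q * X q (cx c j))" for i \<alpha> q
  define a where "a z q = (case z of Inl \<alpha> \<Rightarrow> X q (ct c \<alpha>) | Inr (Inl i) \<Rightarrow> X q (cx c i) | Inr (Inr (i, \<alpha>)) \<Rightarrow> d i \<alpha> q)" for z :: "'p + 'n + 'n \<times> 'p" and q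
  have split_sum: "(\<Sum>z\<in>UNIV. g z) = (\<Sum>\<alpha>\<in>UNIV. g (Inl \<alpha>)) + (\<Sum>i\<in>UNIV. g (Inr (Inl i))) + (\<Sum>i\<in>UNIV. \<Sum>\<alpha>\<in>UNIV. g (Inr (Inr (i, \<alpha>))))"
    for g :: "'p + 'n + 'n \<times> 'p \<Rightarrow> ('t, 'm) jet tangent"
    by (simp add: UNIV_Plus_UNIV[symmetric] sum.Plus UNIV_Times_UNIV[symmetric] sum.cartesian_product add.assoc
      del: UNIV_Plus_UNIV UNIV_Times_UNIV)
  have smooth_d: "smooth_fun E W (d i \<alpha>)" for i \<alpha>
  proof (rule smooth_fun_subset)
    note o = jet_dom_open[OF c(1)]
    show "smooth_fun E (jdom c) (d i \<alpha>)" unfolding d_def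
      by (intro smooth_fun_add smooth_fun_sum smooth_fun_mult o coeffs_smooth c(1)
         vector_field_apply_smooth[OF X o] coord_smooth)
  qed (simp add: W_def)
  have smooth_a: "smooth_fun E W (a z)" for z
  proof -
    note s = smooth_fun_subset[OF vector_field_apply_smooth[OF X jet_dom_open[OF c(1)]], of _ W]
    show ?thesis
      using s[OF coord_smooth(1)[OF c(1)]] s[OF coord_smooth(2)[OF c(1)]] smooth_d
      by (cases z rule: sum.exhaust[case_product sum.exhaust[where y = "projr z"]])
        (auto simp: a_def[abs_def] W_def split: sum.split prod.split)
  qed
  have eq: "X q = (\<Sum>z\<in>UNIV. a z q *\<^sub>T F z q)" if q: "q \<in> W" for q
  proof -
    have qc: "q \<in> jdom c" using q by (simp add: W_def)
    have qU: "q \<in> U z" for z using q by (simp add: W_def)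
    have F: "T \<alpha> q = et c \<alpha> q" "S i q = ex c i q" "V i \<alpha> q = dv c i \<alpha> q" for \<alpha> i
      using UT[of \<alpha>] US[of i] UV[of i \<alpha>] qU[of "Inl \<alpha>"] qU[of "Inr (Inl i)"] qU[of "Inr (Inr (i, \<alpha>))"]
      by (auto simp: U_def)
    have tX: "tangent_at q (X q)"
      using X jet_dom_subset[OF c(1) qc] by (simp add: vector_field_tangent carrier_of_jet_atlas)
    let ?u = "\<Sum>\<alpha>\<in>UNIV. X q (ct c \<alpha>) *\<^sub>T et c \<alpha> q" and ?u' = "\<Sum>i\<in>UNIV. X q (cx c i) *\<^sub>T ex c i q"
    have "X q - ?u - ?u' = (\<Sum>i\<in>UNIV. \<Sum>\<alpha>\<in>UNIV. (X q - ?u - ?u') (cv c i \<alpha>) *\<^sub>T dv c i \<alpha> q)"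
      using decomposition_exists[OF tX c(1) qc] unfolding dist_iff[OF c(1) qc]
      by (rule vertical_expansion[OF c(1) qc])
    moreover have "(X q - ?u - ?u') (cv c i \<alpha>) = d i \<alpha> q" for i \<alpha>
      by (simp add: d_def sum_apply_fun delta_apply[OF c(1) qc] sum_negf mult.commute)
    ultimately have "X q - ?u - ?u' = (\<Sum>i\<in>UNIV. \<Sum>\<alpha>\<in>UNIV. d i \<alpha> q *\<^sub>T dv c i \<alpha> q)" by (simp only:)
    then have "X q = ?u + ?u' + (\<Sum>i\<in>UNIV. \<Sum>\<alpha>\<in>UNIV. d i \<alpha> q *\<^sub>T dv c i \<alpha> q)"
      by (simp only: diff_eq_eq ac_simps)
    then show ?thesis by (simp only: split_sum a_def F_def F sum.case prod.case)
  qed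
  have FV: "F z \<in> VF" for z using T(1) S(1) V(1) by (auto simp: F_def split: sum.split)
  show ?thesis
  proof (rule that[of "\<lambda>\<alpha>. a (Inl \<alpha>) p" "\<lambda>i. a (Inr (Inl i)) p" "\<lambda>i \<alpha>. a (Inr (Inr (i, \<alpha>))) p"])
    fix L assume "tensorial_at p L"
    from tensorial_at_local_combination[OF this X FV oW pW smooth_a eq]
    show "L X = (\<Sum>\<alpha>\<in>UNIV. a (Inl \<alpha>) p *\<^sub>T L (T \<alpha>)) + (\<Sum>i\<in>UNIV. a (Inr (Inl i)) p *\<^sub>T L (S i)) +
         (\<Sum>i\<in>UNIV. \<Sum>\<alpha>\<in>UNIV. a (Inr (Inr (i, \<alpha>))) p *\<^sub>T L (V i \<alpha>))"
      by (simp only: split_sum F_def sum.case prod.case)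
  qed
qed

text \<open>Equal components give equal values on extended frame fields at \<open>p\<close>. The
  slots are then released one at a time, the third before the second and the first, each by an
  expansion whose coefficients do not depend on the tensor.\<close>

lemma tensor_determined_by_components:
  assumes Q: "curvature_type_tensor E Q" and R: "curvature_type_tensor E R"
    and LQ: "\<And>c. c \<in> CC \<Longrightarrow> local_expressions AT AM M N Q c (K c)"
    and LR: "\<And>c. c \<in> CC \<Longrightarrow> local_expressions AT AM M N R c (K c)"
    and XYZ: "X \<in> VF" "Y \<in> VF" "Z \<in> VF"
  shows "Q X Y Z = R X Y Z"
proof
  fix p
  show "Q X Y Z p = R X Y Z p"
  proof (cases "p \<in> JS")
    case False
    \<comment> \<open>Values of a tensor are vector fields, and these are 0 off the jet space by
      convention.\<close>
    then show ?thesis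
      using vector_field_outside[OF tensor_closed[OF Q XYZ]] vector_field_outside[OF tensor_closed[OF R XYZ]]
      by (simp add: carrier_of_jet_atlas)
  next
    case True
    then obtain c where c: "c \<in> CC" "p \<in> jdom c" by (rule jet_dom_cover)
    have ext: "\<exists>G. G \<in> VF \<and> agree_near E p G F" if F: "frame_field c F" for F
    proof -
      obtain G U where "G \<in> VF" "atlas_open E U" "p \<in> U" "\<And>q. q \<in> U \<Longrightarrow> G q = F q"
        by (rule frame_field_extension[OF c(1) F c(2)]) blast
      then show ?thesis unfolding agree_near_def by blast
    qed
    obtain T where T: "\<And>\<alpha>. T \<alpha> \<in> VF" "\<And>\<alpha>. agree_near E p (T \<alpha>) (et c \<alpha>)"
      using ext[OF frame_field_basis(1)[OF c(1)]] by metis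
    obtain S where S: "\<And>i. S i \<in> VF" "\<And>i. agree_near E p (S i) (ex c i)"
      using ext[OF frame_field_basis(2)[OF c(1)]] by metis
    have "\<forall>i \<alpha>. \<exists>G. G \<in> VF \<and> agree_near E p G (dv c i \<alpha>)"
      using ext[OF frame_field_basis(3)[OF c(1)]] by blast
    then obtain V where V: "\<And>i \<alpha>. V i \<alpha> \<in> VF" "\<And>i \<alpha>. agree_near E p (V i \<alpha>) (dv c i \<alpha>)"
      by metis
    have key: "Q F' G' H' p = R F' G' H' p"
      if "F' \<in> VF" "G' \<in> VF" "H' \<in> VF" "agree_near E p F' F" "agree_near E p G' G" "agree_near E p H' H"
        "local_value E Q F G H p = local_value E R F G H p" for F' G' H' F G H
      using local_value_eq[OF Q that(1-6)] local_value_eq[OF R that(1-6)] that(7) by simp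
    note lQ = LQ[OF c(1), unfolded local_expressions_def Let_def, rule_format, OF c(2)]
      and lR = LR[OF c(1), unfolded local_expressions_def Let_def, rule_format, OF c(2)]
    have frame_ext: "L Y = L' Y"
      if L: "tensorial_at p L" "tensorial_at p L'" and Y: "Y \<in> VF"
        and eq: "\<And>\<alpha>. L (T \<alpha>) = L' (T \<alpha>)" "\<And>i. L (S i) = L' (S i)" "\<And>i \<alpha>. L (V i \<alpha>) = L' (V i \<alpha>)"
      for L L' Y
    proof -
      obtain a b d where "\<And>L. tensorial_at p L \<Longrightarrow> L Y = (\<Sum>\<alpha>\<in>UNIV. a \<alpha> *\<^sub>T L (T \<alpha>)) + (\<Sum>i\<in>UNIV. b i *\<^sub>T L (S i))
          + (\<Sum>i\<in>UNIV. \<Sum>\<alpha>\<in>UNIV. d i \<alpha> *\<^sub>T L (V i \<alpha>))"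
        by (rule vector_field_frame_coefficients[OF c Y T S V]) blast
      from this[OF L(1)] this[OF L(2)] show ?thesis by (simp only: eq)
    qed
    define P where "P F G \<longleftrightarrow> (\<forall>\<alpha>. Q F G (T \<alpha>) p = R F G (T \<alpha>) p) \<and> (\<forall>i. Q F G (S i) p = R F G (S i) p)
      \<and> (\<forall>i \<alpha>. Q F G (V i \<alpha>) p = R F G (V i \<alpha>) p)" for F G
    have P1: "P (T \<gamma>) (T \<beta>)" "P (S k) (T \<beta>)" "P (S k) (S j)" "P (V k \<gamma>) (T \<beta>)" "P (V k \<gamma>) (S j)" "P (V k \<gamma>) (V j \<beta>)"
      for \<gamma> \<beta> k j
      unfolding P_def
      by (intro conjI allI; rule key, rule T(1) S(1) V(1), rule T(1) S(1) V(1), rule T(1) S(1) V(1),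
          rule T(2) S(2) V(2), rule T(2) S(2) V(2), rule T(2) S(2) V(2), simp only: lQ lR)+
    have swap: "P G F" if "P F G" "F \<in> VF" "G \<in> VF" for F G
      using that T(1) S(1) V(1) unfolding P_def
      by (simp add: tensor_swap[OF Q, of F G] tensor_swap[OF R, of F G])
    have P2: "P (T \<gamma>) (S j)" "P (T \<gamma>) (V j \<beta>)" "P (S k) (V j \<beta>)" for \<gamma> \<beta> k j
      using swap[OF P1(2) S(1) T(1)] swap[OF P1(4) V(1) T(1)] swap[OF P1(5) V(1) S(1)] by blast+
    have third: "Q F G Z p = R F G Z p" if "P F G" "F \<in> VF" "G \<in> VF" for F G
      using that by (intro frame_ext[OF tensorial_at_third[OF Q] tensorial_at_third[OF R] XYZ(3)])
        (auto simp: P_def)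
    note frames = third[OF P1(1) T(1) T(1)] third[OF P1(2) S(1) T(1)] third[OF P1(3) S(1) S(1)]
      third[OF P1(4) V(1) T(1)] third[OF P1(5) V(1) S(1)] third[OF P1(6) V(1) V(1)]
      third[OF P2(1) T(1) S(1)] third[OF P2(2) T(1) V(1)] third[OF P2(3) S(1) V(1)]
    \<comment> \<open>The last slot now holds the arbitrary \<open>Z\<close>; only the middle one
      still has to leave the frame.\<close>
    have second: "Q F Y Z p = R F Y Z p"
      if "F \<in> VF" "\<And>\<alpha>. Q F (T \<alpha>) Z p = R F (T \<alpha>) Z p" "\<And>i. Q F (S i) Z p = R F (S i) Z p"
        "\<And>i \<alpha>. Q F (V i \<alpha>) Z p = R F (V i \<alpha>) Z p" for F
      using that by (intro frame_ext[OF tensorial_at_second[OF Q _ XYZ(3)] tensorial_at_second[OF R _ XYZ(3)] XYZ(2)])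
    show ?thesis
      by (rule frame_ext[OF tensorial_at_first[OF Q XYZ(2,3)] tensorial_at_first[OF R XYZ(2,3)] XYZ(1)])
        (rule second; rule T(1) S(1) V(1) frames)+
  qed
qed

section \<open>The curvature preserves the three distributions\<close>

lemma basis_in_dist:
  assumes "c \<in> CC" "p \<in> jdom c"
  shows "et c \<alpha> p \<in> DT p" "ex c i p \<in> DX p" "dv c i \<alpha> p \<in> DV p"
  unfolding dist_iff[OF assms] horizontal_t_def horizontal_x_def vertical_def
  using assms delta_tangent[OF assms] tangent_at_basis[OF assms]
  by (simp_all add: delta_apply if_distrib[of "\<lambda>x. _ * x"] cong: if_cong)

lemma curvature_preserves_dist:
  assumes D: "gamma_linear_connection AT AM M N D"
    and XYZ: "X \<in> VF" "Y \<in> VF" "Z \<in> VF" and p: "p \<in> JS"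
  shows "(\<And>q. q \<in> JS \<Longrightarrow> Z q \<in> DT q) \<Longrightarrow> curvature E D X Y Z p \<in> DT p"
    "(\<And>q. q \<in> JS \<Longrightarrow> Z q \<in> DX q) \<Longrightarrow> curvature E D X Y Z p \<in> DX p"
    "(\<And>q. q \<in> JS \<Longrightarrow> Z q \<in> DV q) \<Longrightarrow> curvature E D X Y Z p \<in> DV p"
proof -
  have lin: "linear_connection E D" using D by (simp add: gamma_linear_connection_def)
  have pc: "p \<in> carrier_of E" using p by (simp add: carrier_of_jet_atlas)
  have out: "Z q = 0" if "q \<notin> JS" for q
    using vector_field_outside[OF XYZ(3)] that by (simp add: carrier_of_jet_atlas)
  have comm: "D X (h_T Y) = h_T (D X Y)"
    "D X (h_M Y) = h_M (D X Y)" "D X (h_V Y) = h_V (D X Y)"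
    if "X \<in> VF" "Y \<in> VF" for X Y
    using D that by (simp_all add: gamma_linear_connection_def)
  have into: "h_T Y q \<in> DT q" "h_M Y q \<in> DX q" "h_V Y q \<in> DV q"
    if "Y \<in> VF" "q \<in> carrier_of E" for Y q
    using that projections_in_dist[of q Y] vector_field_tangent[of Y q] by (simp_all add: carrier_of_jet_atlas)
  \<comment> \<open>Off the jet space field and projection are both 0 by convention. With the values
    on the jet space this gives the equality of fields to which \<open>D\<close> is applied.\<close>
  have fix_at: "h_T Z q = Z q" "h_M Z q = Z q" "h_V Z q = Z q" if "q \<notin> JS" for q
    using out[OF that] that by (simp_all add: proj_t_def proj_x_def proj_v_def)
  show "curvature E D X Y Z p \<in> DT p" if "\<And>q. q \<in> JS \<Longrightarrow> Z q \<in> DT q"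
    using projections_fix(1) fix_at(1) that
    by (intro curvature_in_distribution[where P = h_T and S = DT, OF lin comm(1) into(1) ext dist_diff(1)[OF p] XYZ pc]) blast+
  show "curvature E D X Y Z p \<in> DX p" if "\<And>q. q \<in> JS \<Longrightarrow> Z q \<in> DX q"
    using projections_fix(2) fix_at(2) that
    by (intro curvature_in_distribution[where P = h_M and S = DX, OF lin comm(2) into(2) ext dist_diff(2)[OF p] XYZ pc]) blast+
  show "curvature E D X Y Z p \<in> DV p" if "\<And>q. q \<in> JS \<Longrightarrow> Z q \<in> DV q"
    using projections_fix(3) fix_at(3) that
    by (intro curvature_in_distribution[where P = h_V and S = DV, OF lin comm(3) into(3) ext dist_diff(3)[OF p] XYZ pc]) blast+
qed

text \<open>Kept abstract in \<open>S\<close> to serve all three distributions. Closure under 0 and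
  multiples puts the extension of \<open>H\<close> into \<open>S\<close> at every point, not only
  near \<open>p\<close>, as the preservation property demands.\<close>

lemma local_value_in_distribution:
  assumes Q: "curvature_type_tensor E Q" and c: "c \<in> CC" "p \<in> jdom c"
    and frames: "frame_field c F" "frame_field c G" "frame_field c H"
    and S: "\<And>q. q \<in> JS \<Longrightarrow> 0 \<in> S q" "\<And>q u r. q \<in> JS \<Longrightarrow> u \<in> S q \<Longrightarrow> r *\<^sub>T u \<in> S q"
    and H: "\<And>q. q \<in> jdom c \<Longrightarrow> H q \<in> S q"
    and preserves: "\<And>X Y Z. X \<in> VF \<Longrightarrow> Y \<in> VF \<Longrightarrow> Z \<in> VF \<Longrightarrow> (\<And>q. q \<in> JS \<Longrightarrow> Z q \<in> S q) \<Longrightarrow> Q X Y Z p \<in> S p"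
  shows "local_value E Q F G H p \<in> S p"
proof (rule local_value_near[OF Q c frames])
  fix X Y Z W
  assume XYZ: "X \<in> VF" "Y \<in> VF" "Z \<in> VF" and W: "p \<in> W" "\<And>q. q \<in> W \<Longrightarrow> local_value E Q F G H q = Q X Y Z q"
    and Z: "\<And>q. Z q = 0 \<or> (q \<in> jdom c \<and> (\<exists>r. Z q = r *\<^sub>T H q))"
  have "Z q \<in> S q" if "q \<in> JS" for q using Z[of q] S[OF that] H[of q] by auto
  then show ?thesis using preserves[OF XYZ] W by simp
qed

lemma local_curvature_in_dist:
  assumes D: "gamma_linear_connection AT AM M N D" and c: "c \<in> CC" "p \<in> jdom c"
    and FG: "frame_field c F" "frame_field c G"
  shows "local_value E (curvature E D) F G (et c \<alpha>) p \<in> DT p"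
    "local_value E (curvature E D) F G (ex c i) p \<in> DX p"
    "local_value E (curvature E D) F G (dv c i \<alpha>) p \<in> DV p"
proof -
  have Q: "curvature_type_tensor E (curvature E D)"
    using D by (intro curvature_type_tensor_curvature) (simp add: gamma_linear_connection_def)
  note intro = local_value_in_distribution[OF Q c FG frame_field_basis(1)[OF c(1)], where S = DT]
    local_value_in_distribution[OF Q c FG frame_field_basis(2)[OF c(1)], where S = DX]
    local_value_in_distribution[OF Q c FG frame_field_basis(3)[OF c(1)], where S = DV]
  note dist = zero_in_dist dist_scale basis_in_dist[OF c(1)] curvature_preserves_dist[OF D _ _ _ jet_dom_subset[OF c]]
  show "local_value E (curvature E D) F G (et c \<alpha>) p \<in> DT p" by (rule intro(1); rule dist; assumption)
  show "local_value E (curvature E D) F G (ex c i) p \<in> DX p" by (rule intro(2); rule dist; assumption)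
  show "local_value E (curvature E D) F G (dv c i \<alpha>) p \<in> DV p" by (rule intro(3); rule dist; assumption)
qed

text \<open>Preservation of the distributions puts each value into the right one, and its equations
  then convert membership into an expansion whose coefficients are precisely the
  \<open>frame_components\<close>.\<close>

lemma local_expressions_curvature:
  assumes D: "gamma_linear_connection AT AM M N D" and c: "c \<in> CC"
  shows "local_expressions AT AM M N (curvature E D) c (frame_components (curvature E D) c)"
proof -
  let ?R = "local_value E (curvature E D)"
  note f = frame_field_basis[OF c]
  have expansions:
    "?R F G (et c \<alpha>) p = (\<Sum>\<delta>\<in>UNIV. ?R F G (et c \<alpha>) p (ct c \<delta>) *\<^sub>T et c \<delta> p)"
    "?R F G (ex c i) p = (\<Sum>l\<in>UNIV. ?R F G (ex c i) p (cx c l) *\<^sub>T ex c l p)"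
    "?R F G (dv c i \<alpha>) p =
      (\<Sum>l\<in>UNIV. \<Sum>\<delta>\<in>UNIV. ?R F G (dv c i \<alpha>) p (cv c l \<delta>) *\<^sub>T dv c l \<delta> p)"
    if "p \<in> jdom c" "frame_field c F" "frame_field c G" for p F G \<alpha> i
    by (rule horizontal_t_expansion[OF c that(1)], rule dist_iff(1)[OF c that(1), THEN iffD1],
          rule local_curvature_in_dist(1)[OF D c that])
       (rule horizontal_x_expansion[OF c that(1)], rule dist_iff(2)[OF c that(1), THEN iffD1],
          rule local_curvature_in_dist(2)[OF D c that],
        rule vertical_expansion[OF c that(1)], rule dist_iff(3)[OF c that(1), THEN iffD1],
          rule local_curvature_in_dist(3)[OF D c that])
  show ?thesis
    unfolding local_expressions_def Let_def
    by (intro ballI conjI allI; simp only: frame_components_def Let_def curvature_components.simps;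
        rule expansions; (assumption | rule f))
qed

end

theorem theorem3p1:
  fixes AT :: "('t::{t2_space, second_countable_topology}, real ^ 'p::finite) chart set"
    and AM :: "('m::{t2_space, second_countable_topology}, real ^ 'n::finite) chart set"
    and M :: "('t, 'm, 'p, 'n) coeffs_t"
    and N :: "('t, 'm, 'p, 'n) coeffs_x"
    and D :: "('t, 'm) jet vfield \<Rightarrow> ('t, 'm) jet vfield \<Rightarrow> ('t, 'm) jet vfield"
  assumes "smooth_atlas AT" and "smooth_atlas AM"
    and "nonlinear_connection AT AM M N"
    and "gamma_linear_connection AT AM M N D"
  shows "curvature_type_tensor (jet_atlas AT AM) (curvature (jet_atlas AT AM) D) \<and>
    (\<exists>K :: ('t, 'm, 'p, 'n) chart_pair \<Rightarrow> ('t, 'm) jet \<Rightarrow> ('p, 'n) curvature_components.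
      (\<forall>c\<in>AT \<times> AM.
         smooth_components (jet_atlas AT AM) (jet_dom AT AM c) (K c) \<and>
         local_expressions AT AM M N (curvature (jet_atlas AT AM) D) c (K c) \<and>
         (\<forall>K'. local_expressions AT AM M N (curvature (jet_atlas AT AM) D) c K' \<longrightarrow>
            (\<forall>p\<in>jet_dom AT AM c. K' p = K c p))) \<and>
      (\<forall>Q. curvature_type_tensor (jet_atlas AT AM) Q \<and>
           (\<forall>c\<in>AT \<times> AM. local_expressions AT AM M N Q c (K c)) \<longrightarrow>
         (\<forall>X\<in>vector_fields (jet_atlas AT AM). \<forall>Y\<in>vector_fields (jet_atlas AT AM).
          \<forall>Z\<in>vector_fields (jet_atlas AT AM).
            Q X Y Z = curvature (jet_atlas AT AM) D X Y Z)))"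
proof -
  interpret nonlinear_jet_bundle AT AM M N
    using assms(1-3) by unfold_locales
  let ?R = "curvature E D"
  have R: "curvature_type_tensor E ?R"
    using assms(4) by (intro curvature_type_tensor_curvature) (simp add: gamma_linear_connection_def)
  note L = local_expressions_curvature[OF assms(4)]
  show ?thesis
  \<comment> \<open>The same witness serves the local expressions, their uniqueness, and the
    comparison with an arbitrary tensor \<open>Q\<close>.\<close>
  proof (intro conjI exI[of _ "frame_components ?R"] ballI allI impI)
    fix Q X Y Z
    assume "curvature_type_tensor E Q \<and>
      (\<forall>c\<in>AT \<times> AM. local_expressions AT AM M N Q c (frame_components ?R c))"
    then have Q: "curvature_type_tensor E Q"
      and LQ: "\<And>c. c \<in> AT \<times> AM \<Longrightarrow> local_expressions AT AM M N Q c (frame_components ?R c)" by blast+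
    assume "X \<in> VF" "Y \<in> VF" "Z \<in> VF"
    then show "Q X Y Z = ?R X Y Z"
      using LQ L by (intro tensor_determined_by_components[OF Q R, where K = "frame_components ?R"]) simp_all
  qed (use R L local_expressions_unique smooth_frame_components[OF R] in blast)+
qed

end
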